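(* Let $d\ge2$. The set $\{C\in\mathcal{C}_{ar}^d:\mu_C^{dis}(\mathbb{I}^d)=0\}$ is co-meager in $(\mathcal{C}_{ar}^d,d_\infty)$.
   Context: Notation: $\mathbb{I}=[0,1]$; $\inf\emptyset=\infty$. The uniform metric is $d_\infty(A,B)=\sup_{\mathbf{x}\in\mathbb{I}^d}|A(\mathbf{x})-B(\mathbf{x})|$. A subset of a topological space is meager if it can be covered by countably many nowhere dense sets, and co-meager if its complement is meager. A generator is a continuous non-increasing $\psi:[0,\infty)\to\mathbb{I}$ with $\psi(0)=1$, $\psi(\infty):=\lim_{z\to\infty}\psi(z)=0$, strictly decreasing on $[0,\inf\{x:\psi(x)=0\})$; its pseudo-inverse is $\varphi(y)=\inf\{z\in[0,\infty]:\psi(z)=y\}$, $y\in\mathbb{I}$. $\mathcal{C}_{ar}^d$ is the set of $d$-dimensional Archimedean copulas, i.e. copulas of the form $C(\mathbf{x})=\psi(\sum_{i=1}^d\varphi(x_i))$ (this function is a copula iff $\psi$ is $d$-monotone, i.e., with $\psi$ continuous on $[0,\infty)$, on $(0,\infty)$ $\psi$ is differentiable up to order $d-2$, $(-1)^k\psi^{(k)}\ge0$ for $k\le d-2$, and $(-1)^{d-2}\psi^{(d-2)}$ is non-increasing and convex). $\mu_C$ is the probability measure on $\mathbb{I}^d$ with distribution function $C$; $C^{1:d-1}$ is the marginal copula of the first $d-1$ coordinates, with measure $\mu_{C^{1:d-1}}$. Let $K_C:\mathbb{I}^{d-1}\times\mathcal{B}(\mathbb{I})\to\mathbb{I}$ be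 (a version of) the regular conditional distribution of the last coordinate given the first $d-1$ under $\mu_C$, and let $K_C^{dis}(\mathbf{x},\cdot)$ be the discrete (purely atomic) part of $K_C(\mathbf{x},\cdot)$. The discrete component is $\mu_C^{dis}(E\times F)=\int_E K_C^{dis}(\mathbf{x},F)\,d\mu_{C^{1:d-1}}(\mathbf{x})$ for Borel $E\subseteq\mathbb{I}^{d-1}$, $F\subseteq\mathbb{I}$. *)

theory Defs
  imports "HOL-Probability.Probability"
begin

section \<open>The unit cube and copulas\<close>

text \<open>
  Coordinates are indexed by \<open>0, \<dots>, d - 1\<close>, and a point of the \<open>d\<close>-dimensional unit cube is
  a function that is \<open>undefined\<close> outside \<open>{..<d}\<close>. In the same way, functions on the cube
  are \<open>undefined\<close> outside the cube, so that equality of functions is equality on the cube.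
\<close>

definition icube :: "nat \<Rightarrow> (nat \<Rightarrow> real) set" where
  "icube d = {..<d} \<rightarrow>\<^sub>E {0..1}"

definition unit_borel :: "real measure" where
  "unit_borel = restrict_space borel {0..1}"

definition icube_borel :: "nat \<Rightarrow> (nat \<Rightarrow> real) measure" where
  "icube_borel d = Pi\<^sub>M {..<d} (\<lambda>_. unit_borel)"

definition has_df :: "nat \<Rightarrow> (nat \<Rightarrow> real) measure \<Rightarrow> ((nat \<Rightarrow> real) \<Rightarrow> real) \<Rightarrow> bool" where
  "has_df d \<mu> C \<longleftrightarrow> prob_space \<mu> \<and> sets \<mu> = sets (icube_borel d) \<and>
     (\<forall>x\<in>icube d. measure \<mu> {y \<in> icube d. \<forall>i<d. y i \<le> x i} = C x)"

definition copula :: "nat \<Rightarrow> ((nat \<Rightarrow> real) \<Rightarrow> real) \<Rightarrow> bool" where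
  "copula d C \<longleftrightarrow> C \<in> extensional (icube d) \<and> (\<exists>\<mu>. has_df d \<mu> C) \<and>
     (\<forall>i<d. \<forall>t\<in>{0..1}. C (\<lambda>j\<in>{..<d}. if j = i then t else 1) = t)"

definition copula_measure :: "nat \<Rightarrow> ((nat \<Rightarrow> real) \<Rightarrow> real) \<Rightarrow> (nat \<Rightarrow> real) measure" where
  "copula_measure d C = (THE \<mu>. has_df d \<mu> C)"

text \<open>The marginal copula of the first \<open>d - 1\<close> coordinates.\<close>

definition marginal :: "nat \<Rightarrow> ((nat \<Rightarrow> real) \<Rightarrow> real) \<Rightarrow> ((nat \<Rightarrow> real) \<Rightarrow> real)" where
  "marginal d C = (\<lambda>x\<in>icube (d - 1). C (x(d - 1 := 1)))"


section \<open>Archimedean copulas\<close>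

definition generator :: "(real \<Rightarrow> real) \<Rightarrow> bool" where
  "generator \<psi> \<longleftrightarrow> \<psi> \<in> {0..} \<rightarrow> {0..1} \<and> continuous_on {0..} \<psi> \<and> antimono_on {0..} \<psi> \<and>
     \<psi> 0 = 1 \<and> (\<psi> \<longlongrightarrow> 0) at_top \<and>
     strict_antimono_on {x. 0 \<le> x \<and> ennreal x < Inf (ennreal ` {z. 0 \<le> z \<and> \<psi> z = 0})} \<psi>"

text \<open>The extension of a generator to \<open>[0, \<infinity>]\<close>, with \<open>\<psi>(\<infinity>) = lim \<psi>(z) = 0\<close>.\<close>

definition gen_ext :: "(real \<Rightarrow> real) \<Rightarrow> ennreal \<Rightarrow> real" where
  "gen_ext \<psi> z = (if z = \<infinity> then 0 else \<psi> (enn2real z))"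

definition pseudo_inv :: "(real \<Rightarrow> real) \<Rightarrow> real \<Rightarrow> ennreal" where
  "pseudo_inv \<psi> y = Inf {z. gen_ext \<psi> z = y}"

definition archimedean_copulas :: "nat \<Rightarrow> ((nat \<Rightarrow> real) \<Rightarrow> real) set" where
  "archimedean_copulas d = {C. copula d C \<and>
     (\<exists>\<psi>. generator \<psi> \<and> (\<forall>x\<in>icube d. C x = gen_ext \<psi> (\<Sum>i<d. pseudo_inv \<psi> (x i))))}"

text \<open>
  The space of Archimedean copulas with the uniform metric; its carrier and its distance are
  spelled out in the lemmas \<open>mspace_archimedean\<close> and \<open>mdist_archimedean\<close> below.
\<close>

definition archimedean_metric :: "nat \<Rightarrow> ((nat \<Rightarrow> real) \<Rightarrow> real) metric" where
  "archimedean_metric d = submetric (funspace (icube d) euclidean_metric) (archimedean_copulas d)"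


section \<open>Conditional distributions and the discrete component\<close>

text \<open>
  \<open>K\<close> is a version of the regular conditional distribution of the last coordinate given the
  first \<open>d - 1\<close> coordinates; the set on the left-hand side of the last equation is
  \<open>E \<times> F\<close>.
\<close>

definition cond_kernel ::
    "nat \<Rightarrow> ((nat \<Rightarrow> real) \<Rightarrow> real) \<Rightarrow> ((nat \<Rightarrow> real) \<Rightarrow> real measure) \<Rightarrow> bool" where
  "cond_kernel d C K \<longleftrightarrow> K \<in> icube_borel (d - 1) \<rightarrow>\<^sub>M prob_algebra unit_borel \<and>
     (\<forall>E\<in>sets (icube_borel (d - 1)). \<forall>F\<in>sets unit_borel.
        emeasure (copula_measure d C)
          {y \<in> icube d. restrict y {..<d - 1} \<in> E \<and> y (d - 1) \<in> F} =
        (\<integral>\<^sup>+x\<in>E. emeasure (K x) F \<partial>copula_measure (d - 1) (marginal d C)))"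

definition copula_kernel :: "nat \<Rightarrow> ((nat \<Rightarrow> real) \<Rightarrow> real) \<Rightarrow> (nat \<Rightarrow> real) \<Rightarrow> real measure" where
  "copula_kernel d C = (SOME K. cond_kernel d C K)"

text \<open>The restriction of a finite measure to its (countable) set of atoms.\<close>

definition discrete_part :: "real measure \<Rightarrow> real measure" where
  "discrete_part \<nu> = density \<nu> (indicator {t \<in> space \<nu>. emeasure \<nu> {t} \<noteq> 0})"

text \<open>The value of the discrete component on the rectangle \<open>E \<times> F\<close>.\<close>

definition discrete_component ::
    "nat \<Rightarrow> ((nat \<Rightarrow> real) \<Rightarrow> real) \<Rightarrow> (nat \<Rightarrow> real) set \<Rightarrow> real set \<Rightarrow> ennreal" where
  "discrete_component d C E F =
     (\<integral>\<^sup>+x\<in>E. emeasure (discrete_part (copula_kernel d C x)) F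
        \<partial>copula_measure (d - 1) (marginal d C))"


section \<open>Baire category\<close>

definition nowhere_dense_in :: "'a topology \<Rightarrow> 'a set \<Rightarrow> bool" where
  "nowhere_dense_in X N \<longleftrightarrow> N \<subseteq> topspace X \<and> X interior_of (X closure_of N) = {}"

definition meager_in :: "'a topology \<Rightarrow> 'a set \<Rightarrow> bool" where
  "meager_in X S \<longleftrightarrow> S \<subseteq> topspace X \<and>
     (\<exists>\<N>. countable \<N> \<and> (\<forall>N\<in>\<N>. nowhere_dense_in X N) \<and> S \<subseteq> \<Union>\<N>)"

definition comeager_in :: "'a topology \<Rightarrow> 'a set \<Rightarrow> bool" where
  "comeager_in X S \<longleftrightarrow> S \<subseteq> topspace X \<and> meager_in X (topspace X - S)"


section \<open>Well-definedness\<close>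

lemma space_icube_borel: "space (icube_borel d) = icube d"
  by (simp add: icube_borel_def icube_def unit_borel_def space_PiM space_restrict_space)

lemma has_df_range:
  assumes "has_df d \<mu> C" "x \<in> icube d"
  shows "C x \<in> {0..1}"
proof -
  have "prob_space \<mu>" "C x = measure \<mu> {y \<in> icube d. \<forall>i<d. y i \<le> x i}"
    using assms by (auto simp: has_df_def)
  then show ?thesis
    by (simp add: prob_space.prob_le_1)
qed

lemma archimedean_in_fspace:
  assumes "C \<in> archimedean_copulas d"
  shows "C \<in> mspace (funspace (icube d) euclidean_metric)"
proof -
  have "C \<in> extensional (icube d)" "C ` icube d \<subseteq> {0..1}"
  proof -
    have "copula d C" using assms by (simp add: archimedean_copulas_def)
    then obtain \<mu> where "C \<in> extensional (icube d)" "has_df d \<mu> C"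
      unfolding copula_def by blast
    then show "C \<in> extensional (icube d)" "C ` icube d \<subseteq> {0..1}"
      using has_df_range by blast+
  qed
  moreover have "bounded (C ` icube d)"
    using \<open>C ` icube d \<subseteq> {0..1}\<close> by (rule bounded_subset[OF bounded_closed_interval])
  ultimately show ?thesis
    by (simp add: Met_TC.fspace_def)
qed

lemma mspace_archimedean: "mspace (archimedean_metric d) = archimedean_copulas d"
  using archimedean_in_fspace unfolding archimedean_metric_def mspace_submetric by blast

lemma mdist_archimedean:
  assumes "A \<in> archimedean_copulas d" "B \<in> archimedean_copulas d"
  shows "mdist (archimedean_metric d) A B = (SUP x\<in>icube d. \<bar>A x - B x\<bar>)"
proof -
  have "icube d \<noteq> {}"
    by (auto simp: icube_def PiE_eq_empty_iff)
  then show ?thesis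
    using assms[THEN archimedean_in_fspace]
    by (simp add: archimedean_metric_def Met_TC.fdist_def dist_real_def)
qed

lemma topspace_archimedean:
  "topspace (mtopology_of (archimedean_metric d)) = archimedean_copulas d"
  by (simp add: mspace_archimedean)

lemma sets_unit_borel: "sets unit_borel = sigma_sets {0..1} ((\<lambda>t. {0..t}) ` {0..1})"
proof -
  have "sets unit_borel = (\<inter>) {0..1} ` sigma_sets UNIV (range atMost)"
    by (simp add: unit_borel_def sets_restrict_space arg_cong[OF borel_eq_atMost, of sets])
  also have "\<dots> = sigma_sets {0..1} ((\<inter>) {0..1} ` range atMost)"
  proof (rule sigma_sets_Int)
    have "{0..1::real} \<in> sets (sigma UNIV (range atMost))"
      unfolding borel_eq_atMost[symmetric] by simp
    then show "{0..1::real} \<in> sigma_sets UNIV (range atMost)"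
      by simp
  qed simp
  also have "\<dots> = sigma_sets {0..1} ((\<lambda>t. {0..t}) ` {0..1})"
  proof (rule sigma_sets_eqI)
    fix A :: "real set" assume "A \<in> (\<inter>) {0..1} ` range atMost"
    then obtain t where A: "A = {0..1} \<inter> {..t}" by blast
    consider "t < 0" | "t \<in> {0..1}" | "t > 1" by fastforce
    then show "A \<in> sigma_sets {0..1} ((\<lambda>t. {0..t}) ` {0..1})"
    proof cases
      case 1
      then have "A = {}" using A by auto
      then show ?thesis by (simp add: sigma_sets.Empty)
    next
      case 2
      then have "A = {0..t}" using A by auto
      then show ?thesis using 2 by auto
    next
      case 3
      then have "A = {0..1}" using A by auto
      then show ?thesis by (simp add: sigma_sets_top)
    qed
  next
    fix A :: "real set" assume "A \<in> (\<lambda>t. {0..t}) ` {0..1}"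
    then obtain t where "t \<in> {0..1}" "A = {0..t}" by auto
    then have "A = {0..1} \<inter> {..t}" by auto
    then show "A \<in> sigma_sets {0..1} ((\<inter>) {0..1} ` range atMost)"
      by (intro sigma_sets.Basic) blast
  qed
  finally show ?thesis .
qed

lemma sets_icube_borel:
  "sets (icube_borel d) =
     sigma_sets (icube d) ((\<lambda>x. {y \<in> icube d. \<forall>i<d. y i \<le> x i}) ` icube d)"
proof -
  define E :: "real set set" where "E = (\<lambda>t. {0..t}) ` {0..1}"
  have E: "E \<subseteq> Pow {0..1}" by (auto simp: E_def)
  have "sets (icube_borel d) = sets (Pi\<^sub>M {..<d} (\<lambda>_. sigma {0..1} E))"
    unfolding icube_borel_def using E
    by (intro sets_PiM_cong) (simp_all add: sets_unit_borel E_def)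
  also have "\<dots> = sets (sigma (icube d)
      {{f \<in> icube d. \<forall>i\<in>j. f i \<in> A i} | A j. j \<in> {{..<d}} \<and> A \<in> Pi j (\<lambda>_. E)})"
    unfolding icube_def
  proof (rule sets_PiM_sigma)
    show "\<exists>S\<subseteq>E. countable S \<and> {0..1} = \<Union>S"
      by (rule exI[of _ "{{0..1}}"]) (auto simp: E_def)
  qed (use E in auto)
  also have "{{f \<in> icube d. \<forall>i\<in>j. f i \<in> A i} | A j. j \<in> {{..<d}} \<and> A \<in> Pi j (\<lambda>_. E)} =
      (\<lambda>x. {y \<in> icube d. \<forall>i<d. y i \<le> x i}) ` icube d" (is "?L = ?R")
  proof (intro subset_antisym subsetI)
    fix Z assume "Z \<in> ?L"
    then obtain A where A: "\<And>i. i < d \<Longrightarrow> A i \<in> E" "Z = {f \<in> icube d. \<forall>i<d. f i \<in> A i}"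
      by auto
    have "\<exists>s. s \<in> {0..1} \<and> A i = {0..s}" if "i < d" for i
      using A(1)[OF that] by (auto simp: E_def)
    then obtain t where t: "\<And>i. i < d \<Longrightarrow> t i \<in> {0..1} \<and> A i = {0..t i}"
      by metis
    have "Z = {y \<in> icube d. \<forall>i<d. y i \<le> restrict t {..<d} i}"
      using A(2) t by (auto simp: icube_def PiE_iff)
    moreover have "restrict t {..<d} \<in> icube d"
      using t by (auto simp: icube_def)
    ultimately show "Z \<in> ?R" by blast
  next
    fix Z assume "Z \<in> ?R"
    then obtain x where x: "x \<in> icube d" "Z = {y \<in> icube d. \<forall>i<d. y i \<le> x i}"
      by auto
    then have "Z = {y \<in> icube d. \<forall>i\<in>{..<d}. y i \<in> {0..x i}}"
      by (auto simp: icube_def PiE_iff)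
    moreover have "(\<lambda>i. {0..x i}) \<in> {..<d} \<rightarrow> E"
      using x(1) by (auto simp: icube_def PiE_iff E_def)
    ultimately show "Z \<in> ?L"
      by (intro CollectI exI[of _ "\<lambda>i. {0..x i}"] exI[of _ "{..<d}"]) simp
  qed
  finally show ?thesis
    by (simp add: image_subset_iff)
qed

lemma has_df_unique:
  assumes \<mu>: "has_df d \<mu> C" and \<nu>: "has_df d \<nu> C"
  shows "\<mu> = \<nu>"
proof -
  define G where "G = (\<lambda>x. {y \<in> icube d. \<forall>i<d. y i \<le> x i}) ` icube d"
  interpret \<mu>: prob_space \<mu> using \<mu> by (simp add: has_df_def)
  interpret \<nu>: prob_space \<nu> using \<nu> by (simp add: has_df_def)
  show ?thesis
  proof (rule measure_eqI_generator_eq[where \<Omega>="icube d" and E=G and A="\<lambda>_. icube d"])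
    show "Int_stable G"
    proof (rule Int_stableI)
      fix a b assume "a \<in> G" "b \<in> G"
      then obtain x z where xz: "x \<in> icube d" "z \<in> icube d"
        "a = {y \<in> icube d. \<forall>i<d. y i \<le> x i}" "b = {y \<in> icube d. \<forall>i<d. y i \<le> z i}"
        by (auto simp: G_def)
      define w where "w = (\<lambda>i\<in>{..<d}. min (x i) (z i))"
      have "w \<in> icube d"
        using xz(1,2) by (auto simp: w_def icube_def PiE_iff min_def)
      moreover have "a \<inter> b = {y \<in> icube d. \<forall>i<d. y i \<le> w i}"
        unfolding xz(3,4) by (auto simp: w_def)
      ultimately show "a \<inter> b \<in> G" unfolding G_def by blast
    qed
    show "emeasure \<mu> X = emeasure \<nu> X" if "X \<in> G" for X
      using that \<mu> \<nu> by (auto simp: G_def has_df_def \<mu>.emeasure_eq_measure \<nu>.emeasure_eq_measure)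
    have "(\<lambda>i\<in>{..<d}. 1) \<in> icube d" by (auto simp: icube_def)
    moreover have "\<forall>y\<in>icube d. \<forall>i<d. y i \<le> (\<lambda>i\<in>{..<d}. 1) i"
      by (simp add: icube_def PiE_iff)
    then have "icube d = {y \<in> icube d. \<forall>i<d. y i \<le> (\<lambda>i\<in>{..<d}. 1) i}"
      by blast
    ultimately have "icube d \<in> G" unfolding G_def by (intro image_eqI)
    then show "range (\<lambda>_::nat. icube d) \<subseteq> G" by simp
    show "sets \<mu> = sigma_sets (icube d) G" "sets \<nu> = sigma_sets (icube d) G"
      using \<mu> \<nu> unfolding has_df_def G_def sets_icube_borel[symmetric] by simp_all
  qed (auto simp: G_def)
qed

lemma copula_measure_eq: "has_df d \<mu> C \<Longrightarrow> copula_measure d C = \<mu>"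
  unfolding copula_measure_def using has_df_unique by blast

lemma has_df_copula_measure: "copula d C \<Longrightarrow> has_df d (copula_measure d C) C"
  using copula_measure_eq by (auto simp: copula_def)

end

theory Submission
  imports Defs
begin

text \<open>
  Let \<open>X\<close> have distribution function \<open>C(x) = \<psi>(\<Sum>\<phi>(x\<^sub>i))\<close> and put \<open>Z\<^sub>i = \<phi>(X\<^sub>i)\<close>, \<open>S = \<Sum>Z\<^sub>i\<close>. Then
  \<open>P(Z\<^sub>1 \<ge> a\<^sub>1, \<dots>, Z\<^sub>d \<ge> a\<^sub>d) = \<psi>(\<Sum>a\<^sub>i)\<close>. As this depends only on \<open>\<Sum>a\<^sub>i\<close>, the law of \<open>Z\<close> is invariant
  under translations inside the orthant that preserve the sum of the coordinates. Averaging over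
  such translations shows that the law of \<open>((Z\<^sub>1, \<dots>, Z\<^bsub>d-1\<^esub>), S)\<close> is absolutely continuous with respect to
  the product of Lebesgue measure and the law of \<open>S\<close>. A density yields an explicit conditional
  distribution of \<open>S\<close> given \<open>Z\<^sub>1, \<dots>, Z\<^bsub>d-1\<^esub>\<close> that is dominated by the law of \<open>S\<close>, so the discrete
  component vanishes whenever \<open>S\<close> has no atoms, that is, whenever all level sets of \<open>C\<close> are \<open>\<mu>\<^sub>C\<close>-null.

  It remains to see that the sets of copulas having a level set of mass at least \<open>1/n\<close> are nowhere
  dense. Dividing \<open>Z\<close> by an independent variable \<open>W\<close> without atoms that is close to 1 gives an
  Archimedean copula with generator \<open>z \<mapsto> E \<psi>(zW)\<close> that is close to \<open>C\<close> and has no level set of positive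
  mass. Counting grid cells shows that copulas near the latter have only level sets of small mass.
\<close>

section \<open>Generators and their inverses\<close>

text \<open>The conditional law of the last coordinate is classically written with the derivative of
  \<open>\<psi>\<close> of order d-1, which in general exists only in a one-sided sense. Working
  with the law of Z avoids derivatives altogether: the density comes from Radon-Nikodym, and a
  function is shown to be an Archimedean copula by exhibiting a random vector with the right
  survival function instead of checking d-monotonicity. The perturbation is W = 1 - U^n with U
  uniform. It is injective in U, so a prescribed value of S/W fixes U; it is close to 1 for large n;
  and its arbitrarily small values make the mixed generator strictly positive even when
  \<open>\<psi>\<close> reaches 0. This last point matters because the level set at 0 can carry
  mass: it carries all of it for the countermonotonic copula in dimension two. Uniform closeness of
  copulas controls only boxes, and only up to a factor. Hence the mesh of the grid is fixed before
  the distance, so that the number of boxes is a constant.\<close>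

definition arch_fun :: "nat \<Rightarrow> (real \<Rightarrow> real) \<Rightarrow> (nat \<Rightarrow> real) \<Rightarrow> real" where
  "arch_fun d \<psi> = (\<lambda>x\<in>icube d. gen_ext \<psi> (\<Sum>i<d. pseudo_inv \<psi> (x i)))"

text \<open>A real-valued substitute for \<open>pseudo_inv\<close>, whose value at 0 may be
  infinite. The value 0 chosen there is a convention; it affects only the event that some coordinate
  vanishes, which is null under every copula.\<close>

definition real_inv :: "(real \<Rightarrow> real) \<Rightarrow> real \<Rightarrow> real" where
  "real_inv \<psi> x = (if 0 < x then enn2real (pseudo_inv \<psi> x) else 0)"

lemma icube_iff: "x \<in> icube d \<longleftrightarrow> x \<in> extensional {..<d} \<and> (\<forall>i<d. 0 \<le> x i \<and> x i \<le> 1)"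
  by (auto simp: icube_def PiE_iff)

lemma generator_range: "generator \<psi> \<Longrightarrow> 0 \<le> z \<Longrightarrow> 0 \<le> \<psi> z \<and> \<psi> z \<le> 1"
  unfolding generator_def by (auto simp: Pi_iff)

lemma generator_antimono: "generator \<psi> \<Longrightarrow> 0 \<le> x \<Longrightarrow> x \<le> y \<Longrightarrow> \<psi> y \<le> \<psi> x"
  unfolding generator_def by (auto simp: monotone_on_def)

text \<open>The definition grants strictness only below the infimum of the zeros. If
  \<open>\<psi> y\<close> is nonzero, then y lies below every zero, and since the zero set is closed
  its infimum is attained, so y lies strictly below the infimum as well.\<close>

lemma generator_strict:
  assumes g: "generator \<psi>" and "0 \<le> x" "x < y" "0 < \<psi> x"
  shows "\<psi> y < \<psi> x"
proof (cases "\<psi> y = 0")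
  case False
  have "ennreal y < Inf (ennreal ` {z. 0 \<le> z \<and> \<psi> z = 0})"
  proof (rule ccontr)
    assume "\<not> ?thesis"
    then have *: "Inf (ennreal ` {z. 0 \<le> z \<and> \<psi> z = 0}) \<le> ennreal y" by simp
    define A where "A = {z. 0 \<le> z \<and> \<psi> z = 0}"
    have cl: "closed A"
    proof -
      have "continuous_on {0..} \<psi>" using g by (simp add: generator_def)
      then have "closed ({0..} \<inter> \<psi> -` {0})"
        by (rule continuous_closed_preimage) auto
      also have "{0..} \<inter> \<psi> -` {0} = A" by (auto simp: A_def)
      finally show ?thesis .
    qed
    have gt: "y < z" if "z \<in> A" for z
    proof (rule ccontr)
      assume "\<not> y < z"
      then have "\<psi> y \<le> \<psi> z" using generator_antimono[OF g, of z y] that by (simp add: A_def)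
      then show False using False that generator_range[OF g, of y] assms by (auto simp: A_def)
    qed
    show False
    proof (cases "A = {}")
      case True
      then have "Inf (ennreal ` {z. 0 \<le> z \<and> \<psi> z = 0}) = \<infinity>" unfolding A_def by simp
      with * show ?thesis by (simp add: top_unique)
    next
      case False
      have bd: "bdd_below A" by (rule bdd_belowI[of _ 0]) (auto simp: A_def)
      then have "Inf A \<in> A" using closed_contains_Inf[OF False] cl by blast
      then have "y < Inf A" by (rule gt)
      moreover have "ennreal (Inf A) \<le> Inf (ennreal ` A)"
        using bd by (intro Inf_greatest) (auto intro!: ennreal_leI cInf_lower)
      ultimately show False
        using * assms unfolding A_def[symmetric]
        by (metis ennreal_less_iff le_less_trans less_le_not_le order.strict_trans1 linorder_not_less)
    qed
  qed
  moreover from this have "ennreal x < Inf (ennreal ` {z. 0 \<le> z \<and> \<psi> z = 0})"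
    using assms by (meson ennreal_lessI le_less_trans less_trans)
  ultimately show ?thesis
    using g assms unfolding generator_def monotone_on_def by auto
qed (use assms in auto)

lemma generator_surj:
  assumes g: "generator \<psi>" and "0 < x" "x \<le> 1"
  shows "\<exists>z\<ge>0. \<psi> z = x"
proof -
  have "(\<psi> \<longlongrightarrow> 0) at_top" using g by (simp add: generator_def)
  then have "eventually (\<lambda>z. \<psi> z < x) at_top" using assms by (auto dest: order_tendstoD)
  then obtain b where b: "0 \<le> b" "\<psi> b < x"
    by (metis (mono_tags, lifting) eventually_at_top_linorder linorder_le_cases)
  have "continuous_on {0..b} \<psi>" using g by (auto simp: generator_def elim: continuous_on_subset)
  then have "\<exists>z. 0 \<le> z \<and> z \<le> b \<and> \<psi> z = x"
    using b assms g by (intro IVT2') (auto simp: generator_def)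
  then show ?thesis by auto
qed

lemma pseudo_inv_gen:
  assumes g: "generator \<psi>" and "0 \<le> z" "0 < \<psi> z"
  shows "pseudo_inv \<psi> (\<psi> z) = ennreal z"
proof -
  have "{w. gen_ext \<psi> w = \<psi> z} = {ennreal z}"
  proof (intro subset_antisym subsetI)
    fix w assume w: "w \<in> {w. gen_ext \<psi> w = \<psi> z}"
    then have "w \<noteq> \<infinity>" using assms by (auto simp: gen_ext_def)
    then obtain r where r: "w = ennreal r" "0 \<le> r" by (cases w) auto
    then have "\<psi> r = \<psi> z" using w by (auto simp: gen_ext_def)
    then have "r = z"
      using generator_strict[OF g, of r z] generator_strict[OF g, of z r] r assms
      by (cases r z rule: linorder_cases) auto
    then show "w \<in> {ennreal z}" using r by simp
  qed (use assms in \<open>auto simp: gen_ext_def\<close>)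
  then show ?thesis unfolding pseudo_inv_def by simp
qed

lemma gen_ext_ennreal: "0 \<le> z \<Longrightarrow> gen_ext \<psi> (ennreal z) = \<psi> z"
  by (simp add: gen_ext_def)

lemma gen_ext_antimono:
  assumes g: "generator \<psi>" and "v \<le> w"
  shows "gen_ext \<psi> w \<le> gen_ext \<psi> v"
proof (cases "w = \<infinity>")
  case True
  then show ?thesis using generator_range[OF g] by (auto simp: gen_ext_def)
next
  case False
  then show ?thesis using assms generator_antimono[OF g]
    by (auto simp: gen_ext_def enn2real_mono top.not_eq_extremum top_unique)
qed

lemma gen_ext_nonneg: "generator \<psi> \<Longrightarrow> 0 \<le> gen_ext \<psi> w"
  using generator_range by (auto simp: gen_ext_def)

text \<open>The value 0 needs its own argument because its preimage is not a singleton in general: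
  either \<open>\<psi>\<close> has zeros and closedness gives a smallest one, or infinity is the
  only preimage.\<close>

lemma gen_ext_pseudo_inv_0:
  assumes g: "generator \<psi>"
  shows "gen_ext \<psi> (pseudo_inv \<psi> 0) = 0"
proof (cases "\<exists>z\<ge>0. \<psi> z = 0")
  case True
  define A where "A = {z. 0 \<le> z \<and> \<psi> z = 0}"
  have "continuous_on {0..} \<psi>" using g by (simp add: generator_def)
  then have "closed ({0..} \<inter> \<psi> -` {0})"
    by (rule continuous_closed_preimage) auto
  also have "{0..} \<inter> \<psi> -` {0} = A" by (auto simp: A_def)
  finally have "closed A" .
  moreover have bd: "bdd_below A" by (rule bdd_belowI[of _ 0]) (auto simp: A_def)
  moreover have "A \<noteq> {}" using True by (auto simp: A_def)
  ultimately have "Inf A \<in> A" using closed_contains_Inf by blast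
  then have z: "0 \<le> Inf A" "\<psi> (Inf A) = 0" by (auto simp: A_def)
  have "pseudo_inv \<psi> 0 = ennreal (Inf A)"
    unfolding pseudo_inv_def
  proof (rule Inf_eqI)
    fix w assume "w \<in> {w. gen_ext \<psi> w = 0}"
    then show "ennreal (Inf A) \<le> w"
      by (cases w) (auto simp: gen_ext_def A_def intro!: ennreal_leI cInf_lower bdd_belowI[of _ 0])
  next
    fix u assume "\<And>w. w \<in> {w. gen_ext \<psi> w = 0} \<Longrightarrow> u \<le> w"
    then show "u \<le> ennreal (Inf A)" using z by (auto simp: gen_ext_ennreal)
  qed
  then show ?thesis using z by (simp add: gen_ext_ennreal)
next
  case False
  then have "{w. gen_ext \<psi> w = 0} = {\<infinity>}"
    by (auto simp: gen_ext_def)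
  then show ?thesis unfolding pseudo_inv_def by (simp add: gen_ext_def)
qed

lemma gen_ext_pseudo_inv:
  assumes g: "generator \<psi>" and "0 \<le> x" "x \<le> 1"
  shows "gen_ext \<psi> (pseudo_inv \<psi> x) = x"
  using assms generator_surj[OF g, of x] pseudo_inv_gen[OF g] gen_ext_pseudo_inv_0[OF g] gen_ext_ennreal
  by (cases "x = 0") force+

lemma pseudo_inv_1: "generator \<psi> \<Longrightarrow> pseudo_inv \<psi> 1 = 0"
  using pseudo_inv_gen[of \<psi> 0] by (simp add: generator_def)

lemma real_inv_nonneg [simp]: "0 \<le> real_inv \<psi> x"
  by (simp add: real_inv_def)

lemma real_inv_0: "real_inv \<psi> 0 = 0"
  by (simp add: real_inv_def)

lemma real_inv_gen: "generator \<psi> \<Longrightarrow> 0 \<le> z \<Longrightarrow> 0 < \<psi> z \<Longrightarrow> real_inv \<psi> (\<psi> z) = z"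
  by (simp add: real_inv_def pseudo_inv_gen)

lemma gen_real_inv: "generator \<psi> \<Longrightarrow> 0 < x \<Longrightarrow> x \<le> 1 \<Longrightarrow> \<psi> (real_inv \<psi> x) = x"
  using generator_surj[of \<psi> x] real_inv_gen[of \<psi>] by force

text \<open>This and \<open>real_inv_le_iff\<close> translate between thresholds for X_i and for
  Z_i, reversing the order. Injectivity of \<open>\<psi>\<close> where it is positive makes the
  equivalences hold with weak inequalities on both sides.\<close>

lemma le_real_inv_iff:
  assumes g: "generator \<psi>" and "0 < x" "x \<le> 1" "0 \<le> a"
  shows "a \<le> real_inv \<psi> x \<longleftrightarrow> x \<le> \<psi> a"
proof
  assume "a \<le> real_inv \<psi> x"
  then show "x \<le> \<psi> a" using generator_antimono[OF g, of a "real_inv \<psi> x"] gen_real_inv[OF g] assms by auto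
next
  assume *: "x \<le> \<psi> a"
  show "a \<le> real_inv \<psi> x"
  proof (rule ccontr)
    assume "\<not> ?thesis"
    then show False
      using generator_strict[OF g, of "real_inv \<psi> x" a] gen_real_inv[OF g] assms * by auto
  qed
qed

lemma real_inv_le_iff:
  assumes g: "generator \<psi>" and "0 < x" "x \<le> 1" "0 \<le> a"
  shows "real_inv \<psi> x \<le> a \<longleftrightarrow> \<psi> a \<le> x"
proof
  assume "real_inv \<psi> x \<le> a"
  then show "\<psi> a \<le> x" using generator_antimono[OF g, of "real_inv \<psi> x" a] gen_real_inv[OF g] assms by auto
next
  assume *: "\<psi> a \<le> x"
  show "real_inv \<psi> x \<le> a"
  proof (rule ccontr)
    assume n: "\<not> ?thesis"
    then have "x \<le> \<psi> a" using le_real_inv_iff[OF assms] by auto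
    then show False using * n real_inv_gen[OF g, of a] assms by auto
  qed
qed

lemma real_inv_measurable:
  assumes g: "generator \<psi>"
  shows "real_inv \<psi> \<in> borel_measurable unit_borel"
proof (rule borel_measurableI_le)
  fix z
  have "x \<in> {x \<in> space unit_borel. real_inv \<psi> x \<le> z} \<longleftrightarrow>
    x \<in> (if 0 \<le> z then {0..1} \<inter> ({x. 0 < x \<and> \<psi> z \<le> x} \<union> {0}) else {})" for x
  proof (cases "0 \<le> z")
    case True
    then show ?thesis using real_inv_le_iff[OF g, of x z]
      by (cases "x = 0") (auto simp: unit_borel_def space_restrict_space real_inv_0)
  next
    case False
    then show ?thesis using real_inv_nonneg[of \<psi> x] by (simp del: real_inv_nonneg)
  qed
  then have "{x \<in> space unit_borel. real_inv \<psi> x \<le> z} =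
    (if 0 \<le> z then {0..1} \<inter> ({x. 0 < x \<and> \<psi> z \<le> x} \<union> {0}) else {})"
    by blast
  also have "\<dots> \<in> sets unit_borel"
  proof -
    have "{x. 0 < x \<and> \<psi> z \<le> x} \<union> {0} \<in> sets borel" by measurable
    then have "{0..1} \<inter> ({x. 0 < x \<and> \<psi> z \<le> x} \<union> {0}) \<in> sets unit_borel"
      unfolding unit_borel_def sets_restrict_space by (rule imageI)
    then show ?thesis by simp
  qed
  finally show "{x \<in> space unit_borel. real_inv \<psi> x \<le> z} \<in> sets unit_borel" .
qed

text \<open>A generator is constrained on the half-line only; clamping the argument gives a function
  continuous on the whole line, which is what the Borel measurability arguments compose
  with.\<close>

lemma generator_clamp_continuous:
  assumes g: "generator \<psi>"
  shows "continuous_on UNIV (\<lambda>z. \<psi> (max 0 z))"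
proof -
  have "continuous_on {0..} \<psi>" using g by (simp add: generator_def)
  then show ?thesis by (rule continuous_on_compose2) (auto intro!: continuous_intros)
qed

section \<open>Values of the Archimedean formula\<close>

lemma arch_fun_zero:
  assumes g: "generator \<psi>" and x: "x \<in> icube d" "j < d" "x j = 0"
  shows "arch_fun d \<psi> x = 0"
proof -
  have "pseudo_inv \<psi> 0 \<le> (\<Sum>i<d. pseudo_inv \<psi> (x i))"
    using x member_le_sum[of j "{..<d}" "\<lambda>i. pseudo_inv \<psi> (x i)"] by auto
  from gen_ext_antimono[OF g this] show ?thesis
    using x gen_ext_pseudo_inv_0[OF g] gen_ext_nonneg[OF g] by (simp add: arch_fun_def order_antisym)
qed

lemma gen_icube: "generator \<psi> \<Longrightarrow> (\<And>i. i < d \<Longrightarrow> 0 \<le> a i) \<Longrightarrow> (\<lambda>i\<in>{..<d}. \<psi> (a i)) \<in> icube d"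
  using generator_range by (auto simp: icube_iff)

text \<open>If all \<open>\<psi> (a i)\<close> are positive, the pseudo-inverse recovers each
  \<open>a i\<close>. If one of them is 0, it may recover something else, but then both sides are
  0.\<close>

lemma arch_fun_gen:
  assumes g: "generator \<psi>" and a: "\<And>i. i < d \<Longrightarrow> 0 \<le> a i"
  shows "arch_fun d \<psi> (\<lambda>i\<in>{..<d}. \<psi> (a i)) = \<psi> (\<Sum>i<d. a i)"
proof (cases "\<exists>j<d. \<psi> (a j) = 0")
  case True
  then obtain j where j: "j < d" "\<psi> (a j) = 0" by blast
  have "a j \<le> (\<Sum>i<d. a i)" using a j by (intro member_le_sum) auto
  then have "\<psi> (\<Sum>i<d. a i) \<le> 0" using generator_antimono[OF g] a j by metis
  then have "\<psi> (\<Sum>i<d. a i) = 0" using generator_range[OF g, of "\<Sum>i<d. a i"] a by (force intro: sum_nonneg)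
  moreover have "arch_fun d \<psi> (\<lambda>i\<in>{..<d}. \<psi> (a i)) = 0"
    using gen_icube[OF g, of d a] a j by (intro arch_fun_zero[OF g]) auto
  ultimately show ?thesis by simp
next
  case False
  then have "0 < \<psi> (a j)" if "j < d" for j using generator_range[OF g, of "a j"] a that by force
  then have "(\<Sum>i<d. pseudo_inv \<psi> ((\<lambda>i\<in>{..<d}. \<psi> (a i)) i)) = (\<Sum>i<d. ennreal (a i))"
    using a by (intro sum.cong) (auto simp: pseudo_inv_gen[OF g])
  also have "\<dots> = ennreal (\<Sum>i<d. a i)" using a by (intro sum_ennreal) auto
  finally have "arch_fun d \<psi> (\<lambda>i\<in>{..<d}. \<psi> (a i)) = gen_ext \<psi> (ennreal (\<Sum>i<d. a i))"
    using gen_icube[OF g, of d a] a by (simp add: arch_fun_def)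
  also have "\<dots> = \<psi> (\<Sum>i<d. a i)" by (intro gen_ext_ennreal sum_nonneg) (use a in auto)
  finally show ?thesis .
qed

lemma arch_fun_margin:
  assumes g: "generator \<psi>" and "i < d" "0 \<le> t" "t \<le> 1"
  shows "arch_fun d \<psi> (\<lambda>j\<in>{..<d}. if j = i then t else 1) = t"
proof -
  have "(\<Sum>k<d. pseudo_inv \<psi> ((\<lambda>j\<in>{..<d}. if j = i then t else 1) k)) =
     (\<Sum>k<d. if k = i then pseudo_inv \<psi> t else 0)"
    by (intro sum.cong) (auto simp: pseudo_inv_1[OF g])
  then show ?thesis using assms by (auto simp: arch_fun_def icube_iff gen_ext_pseudo_inv)
qed

lemma archimedean_arch_fun:
  assumes "C \<in> archimedean_copulas d"
  obtains \<psi> where "generator \<psi>" "C = arch_fun d \<psi>"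
proof -
  from assms obtain \<psi> where \<psi>: "copula d C" "generator \<psi>"
    "\<And>x. x \<in> icube d \<Longrightarrow> C x = gen_ext \<psi> (\<Sum>i<d. pseudo_inv \<psi> (x i))"
    by (auto simp: archimedean_copulas_def)
  moreover have "C = arch_fun d \<psi>"
    using \<psi> by (auto simp: copula_def arch_fun_def restrict_def extensional_def)
  ultimately show ?thesis using that by blast
qed

text \<open>Uniform margins are automatic for the formula, so producing a measure is all that
  remains. This takes the place of the criterion by d-monotonicity.\<close>

lemma arch_fun_copula_iff:
  assumes g: "generator \<psi>"
  shows "arch_fun d \<psi> \<in> archimedean_copulas d \<longleftrightarrow> (\<exists>\<mu>. has_df d \<mu> (arch_fun d \<psi>))"
  using g arch_fun_margin[OF g] by (auto simp: archimedean_copulas_def copula_def arch_fun_def)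

section \<open>Copulas and grid cells\<close>

lemma measurable_icube_nth:
  assumes "i < d" shows "(\<lambda>x. x i) \<in> icube_borel d \<rightarrow>\<^sub>M unit_borel"
  unfolding icube_borel_def using assms by (intro measurable_component_singleton) auto

lemma measurable_unit_borel_ident: "(\<lambda>x. x) \<in> borel_measurable unit_borel"
  unfolding unit_borel_def by (rule measurable_restrict_space1) simp

lemma measurable_icube_nth_borel:
  assumes "i < d" shows "(\<lambda>x. x i) \<in> borel_measurable (icube_borel d)"
  by (rule measurable_compose[OF measurable_icube_nth[OF assms] measurable_unit_borel_ident])

locale copula_law =
  fixes d :: nat and C :: "(nat \<Rightarrow> real) \<Rightarrow> real" and \<mu> :: "(nat \<Rightarrow> real) measure"
  assumes copula: "copula d C" and df: "has_df d \<mu> C"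
begin

sublocale prob_space \<mu> using df by (simp add: has_df_def)

lemma sets_mu: "sets \<mu> = sets (icube_borel d)"
  using df by (simp add: has_df_def)

lemma space_mu: "space \<mu> = icube d"
  using sets_eq_imp_space_eq[OF sets_mu] by (simp add: space_icube_borel)

lemma emeasure_mu: "emeasure \<mu> A = ennreal (measure \<mu> A)"
  by (rule emeasure_eq_measure)

lemma measurable_mu_nth:
  assumes "i < d" shows "(\<lambda>x. x i) \<in> borel_measurable \<mu>"
  using measurable_icube_nth_borel[OF assms] by (simp add: measurable_cong_sets[OF sets_mu refl])

lemma box_sets:
  assumes "J \<subseteq> {..<d}"
  shows "{x \<in> icube d. (\<forall>i<d. x i \<le> b i) \<and> (\<forall>i\<in>J. a i < x i)} \<in> sets \<mu>"
proof -
  have "{x \<in> space \<mu>. \<forall>i. (i < d \<longrightarrow> x i \<le> b i) \<and> (i \<in> J \<longrightarrow> a i < x i)} \<in> sets \<mu>"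
  proof (rule sets.sets_Collect_countable_All)
    fix i
    show "{x \<in> space \<mu>. (i < d \<longrightarrow> x i \<le> b i) \<and> (i \<in> J \<longrightarrow> a i < x i)} \<in> sets \<mu>"
    proof (cases "i < d")
      case True
      note [measurable] = measurable_mu_nth[OF True]
      show ?thesis by measurable
    next
      case False
      then have "i \<notin> J" using assms by auto
      with False show ?thesis by simp
    qed
  qed
  moreover have "{x \<in> space \<mu>. \<forall>i. (i < d \<longrightarrow> x i \<le> b i) \<and> (i \<in> J \<longrightarrow> a i < x i)} =
    {x \<in> icube d. (\<forall>i<d. x i \<le> b i) \<and> (\<forall>i\<in>J. a i < x i)}"
    by (auto simp: space_mu)
  ultimately show ?thesis by (simp only:)
qed

lemma le_sets: "{x \<in> icube d. \<forall>i<d. x i \<le> b i} \<in> sets \<mu>"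
proof -
  have "{x \<in> icube d. \<forall>i<d. x i \<le> b i} = {x \<in> icube d. (\<forall>i<d. x i \<le> b i) \<and> (\<forall>i\<in>{}. 0 < x i)}"
    by blast
  then show ?thesis using box_sets[OF empty_subsetI, of b "\<lambda>_. 0"] by (rule ssubst)
qed

lemma C_eq: "x \<in> icube d \<Longrightarrow> C x = measure \<mu> {y \<in> icube d. \<forall>i<d. y i \<le> x i}"
  using df by (simp add: has_df_def)

text \<open>Corners outside the cube are allowed because the differences of boxes below produce
  them: values above 1 are cut to 1, and a negative one makes the box empty.\<close>

lemma measure_le:
  "measure \<mu> {x \<in> icube d. \<forall>i<d. x i \<le> b i} =
    (if \<forall>i<d. 0 \<le> b i then C (\<lambda>i\<in>{..<d}. min 1 (b i)) else 0)"
proof (cases "\<forall>i<d. 0 \<le> b i")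
  case True
  then have "(\<lambda>i\<in>{..<d}. min 1 (b i)) \<in> icube d" by (auto simp: icube_iff)
  then have "C (\<lambda>i\<in>{..<d}. min 1 (b i)) =
    measure \<mu> {x \<in> icube d. \<forall>i<d. x i \<le> (\<lambda>i\<in>{..<d}. min 1 (b i)) i}"
    by (rule C_eq)
  also have "{x \<in> icube d. \<forall>i<d. x i \<le> (\<lambda>i\<in>{..<d}. min 1 (b i)) i} = {x \<in> icube d. \<forall>i<d. x i \<le> b i}"
    by (auto simp: icube_iff)
  finally show ?thesis unfolding if_P[OF True] by (rule sym)
next
  case False
  then have e: "{x \<in> icube d. \<forall>i<d. x i \<le> b i} = {}" by (fastforce simp: icube_iff)
  show ?thesis unfolding if_not_P[OF False] e by (rule measure_empty)
qed

lemma measure_margin: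
  assumes "i < d" "0 \<le> t" "t \<le> 1"
  shows "measure \<mu> {x \<in> icube d. x i \<le> t} = t"
proof -
  have "(\<lambda>j\<in>{..<d}. if j = i then t else 1) \<in> icube d" using assms by (auto simp: icube_iff)
  then have "C (\<lambda>j\<in>{..<d}. if j = i then t else 1) =
    measure \<mu> {x \<in> icube d. \<forall>k<d. x k \<le> (\<lambda>j\<in>{..<d}. if j = i then t else 1) k}"
    by (rule C_eq)
  also have "{x \<in> icube d. \<forall>k<d. x k \<le> (\<lambda>j\<in>{..<d}. if j = i then t else 1) k} = {x \<in> icube d. x i \<le> t}"
    using assms by (auto simp: icube_iff)
  finally have "measure \<mu> {x \<in> icube d. x i \<le> t} = C (\<lambda>j\<in>{..<d}. if j = i then t else 1)"
    by (rule sym)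
  also have "\<dots> = t" using copula assms unfolding copula_def by (auto simp del: restrict_apply)
  finally show ?thesis .
qed

lemma margin_sets: 
  assumes "i < d"
  shows "{x \<in> icube d. x i \<le> t} \<in> sets \<mu>" "{x \<in> icube d. s < x i \<and> x i \<le> t} \<in> sets \<mu>"
    "{x \<in> icube d. x i = t} \<in> sets \<mu>"
proof -
  note [measurable] = measurable_mu_nth[OF assms]
  show "{x \<in> icube d. x i \<le> t} \<in> sets \<mu>" "{x \<in> icube d. s < x i \<and> x i \<le> t} \<in> sets \<mu>"
    "{x \<in> icube d. x i = t} \<in> sets \<mu>"
    unfolding space_mu[symmetric] by measurable
qed

lemma measure_margin_Ioc:
  assumes "i < d" "0 \<le> s" "s \<le> t" "t \<le> 1"
  shows "measure \<mu> {x \<in> icube d. s < x i \<and> x i \<le> t} = t - s"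
proof -
  have "{x \<in> icube d. s < x i \<and> x i \<le> t} = {x \<in> icube d. x i \<le> t} - {x \<in> icube d. x i \<le> s}"
    by auto
  moreover have "{x \<in> icube d. x i \<le> s} \<subseteq> {x \<in> icube d. x i \<le> t}" using assms by auto
  ultimately show ?thesis
    using finite_measure_Diff[OF margin_sets(1)[OF assms(1), of t] margin_sets(1)[OF assms(1), of s]]
      measure_margin[OF assms(1)] assms by simp
qed

lemma AE_margin_neq:
  assumes i: "i < d"
  shows "AE x in \<mu>. x i \<noteq> t"
proof -
  have "measure \<mu> {x \<in> icube d. x i = t} = 0"
  proof (cases "0 < t \<and> t \<le> 1")
    case False
    \<comment> \<open>Here t is at most 0 or above 1, so inside the cube the slice is either empty
      or the face where the coordinate is 0.\<close>
    have "measure \<mu> {x \<in> icube d. x i = t} \<le> measure \<mu> {x \<in> icube d. x i \<le> 0}" 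
      using False i by (intro finite_measure_mono margin_sets) (auto simp: icube_iff)
    also have "\<dots> = 0" using measure_margin[OF i, of 0] by simp
    finally show ?thesis by (simp add: measure_le_0_iff)
  next
    case True
    have "measure \<mu> {x \<in> icube d. x i = t} \<le> 0 + e" if "e > 0" for e :: real
    proof -
      have "measure \<mu> {x \<in> icube d. x i = t} \<le> measure \<mu> {x \<in> icube d. max 0 (t - e) < x i \<and> x i \<le> t}"
        using True that i by (intro finite_measure_mono margin_sets) auto
      also have "\<dots> = t - max 0 (t - e)" using True that i by (intro measure_margin_Ioc) auto
      finally show ?thesis by linarith
    qed
    then have "measure \<mu> {x \<in> icube d. x i = t} \<le> 0" by (rule field_le_epsilon)
    then show ?thesis by (simp add: measure_le_0_iff)
  qed
  then show ?thesis
    using margin_sets(3)[OF i, of t] by (subst AE_iff_measurable[OF _ refl])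
      (auto simp: space_mu emeasure_eq_measure)
qed

lemma AE_pos: "AE x in \<mu>. \<forall>i<d. 0 < x i"
proof -
  have "AE x in \<mu>. \<forall>i\<in>{..<d}. x i \<noteq> 0"
    using AE_margin_neq by (subst AE_ball_countable) auto
  then show ?thesis
    by (rule AE_mp) (auto intro!: AE_I2 simp: space_mu icube_iff less_le)
qed

lemma C_range: "x \<in> icube d \<Longrightarrow> 0 \<le> C x \<and> C x \<le> 1"
  using has_df_range[OF df] by auto

lemma C_le_nth:
  assumes "x \<in> icube d" "i < d" shows "C x \<le> x i"
proof -
  have "C x \<le> measure \<mu> {y \<in> icube d. y i \<le> x i}"
    unfolding C_eq[OF assms(1)] using assms by (intro finite_measure_mono margin_sets) auto
  also have "\<dots> = x i" using assms by (intro measure_margin) (auto simp: icube_iff)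
  finally show ?thesis .
qed

text \<open>The box below x is covered by the box below y together with one slab per coordinate, and
  a slab has mass equal to its width because the margins are uniform.\<close>

lemma C_le_add:
  assumes x: "x \<in> icube d" and y: "y \<in> icube d"
  shows "C x \<le> C y + (\<Sum>i<d. \<bar>x i - y i\<bar>)"
proof -
  let ?B = "\<lambda>i. {z \<in> icube d. y i < z i \<and> z i \<le> max (x i) (y i)}"
  note le = le_sets[of y]
  have B: "?B i \<in> sets \<mu>" if "i < d" for i using margin_sets(2)[OF that] .
  have UB: "(\<Union>i<d. ?B i) \<in> sets \<mu>" by (rule sets.finite_UN) (simp, rule B, simp)
  have cover: "{z \<in> icube d. \<forall>i<d. z i \<le> x i} \<subseteq> {z \<in> icube d. \<forall>i<d. z i \<le> y i} \<union> (\<Union>i<d. ?B i)"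
  proof
    fix z assume z: "z \<in> {z \<in> icube d. \<forall>i<d. z i \<le> x i}"
    show "z \<in> {z \<in> icube d. \<forall>i<d. z i \<le> y i} \<union> (\<Union>i<d. ?B i)"
    proof (cases "\<forall>i<d. z i \<le> y i")
      case False
      then obtain i where "i < d" "y i < z i" by (auto simp: not_le)
      then have "z \<in> ?B i" "i < d" using z by (auto simp: le_max_iff_disj)
      then show ?thesis by blast
    qed (use z in blast)
  qed
  have "C x \<le> measure \<mu> ({z \<in> icube d. \<forall>i<d. z i \<le> y i} \<union> (\<Union>i<d. ?B i))"
    unfolding C_eq[OF x] by (rule finite_measure_mono[OF cover sets.Un[OF le UB]])
  also have "\<dots> \<le> measure \<mu> {z \<in> icube d. \<forall>i<d. z i \<le> y i} + measure \<mu> (\<Union>i<d. ?B i)"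
    by (rule measure_Un_le[OF le UB])
  also have "measure \<mu> (\<Union>i<d. ?B i) \<le> (\<Sum>i<d. measure \<mu> (?B i))"
    by (rule finite_measure_subadditive_finite) (simp, use B in blast)
  also have "\<dots> \<le> (\<Sum>i<d. \<bar>x i - y i\<bar>)"
  proof (rule sum_mono)
    fix i assume "i \<in> {..<d}"
    then have "measure \<mu> (?B i) = max (x i) (y i) - y i"
      using x y by (intro measure_margin_Ioc) (auto simp: icube_iff)
    then show "measure \<mu> (?B i) \<le> \<bar>x i - y i\<bar>" by simp
  qed
  finally show ?thesis using C_eq[OF y] by simp
qed

lemma C_lipschitz:
  assumes x: "x \<in> icube d" and y: "y \<in> icube d"
  shows "\<bar>C x - C y\<bar> \<le> (\<Sum>i<d. \<bar>x i - y i\<bar>)"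
  using C_le_add[OF x y] C_le_add[OF y x] by (simp add: abs_minus_commute abs_le_iff)

end

text \<open>Each strict lower bound is removed by writing the box as a difference of two boxes with
  one bound fewer. The error doubles every time, whence the factor 2^|J|.\<close>

lemma measure_box_diff:
  assumes "copula_law d C \<mu>" "copula_law d D \<nu>"
    and CD: "\<And>x. x \<in> icube d \<Longrightarrow> \<bar>C x - D x\<bar> \<le> \<eta>"
    and J: "J \<subseteq> {..<d}"
  shows "\<bar>measure \<mu> {x \<in> icube d. (\<forall>i<d. x i \<le> b i) \<and> (\<forall>i\<in>J. a i < x i)} -
      measure \<nu> {x \<in> icube d. (\<forall>i<d. x i \<le> b i) \<and> (\<forall>i\<in>J. a i < x i)}\<bar> \<le> 2 ^ card J * \<eta>"
proof -
  interpret \<mu>: copula_law d C \<mu> by fact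
  interpret \<nu>: copula_law d D \<nu> by fact
  have "finite J" using J finite_subset by blast
  then show ?thesis using J
  proof (induction J arbitrary: b rule: finite_induct)
    case empty
    have "(\<lambda>i\<in>{..<d}. 1) \<in> icube d" by (auto simp: icube_iff)
    then have "0 \<le> \<eta>" using CD by (meson abs_ge_zero order.trans)
    moreover have "(\<lambda>i\<in>{..<d}. min 1 (b i)) \<in> icube d" if "\<forall>i<d. 0 \<le> b i"
      using that by (auto simp: icube_iff)
    ultimately show ?case
      using CD[of "\<lambda>i\<in>{..<d}. min 1 (b i)"] \<mu>.measure_le[of b] \<nu>.measure_le[of b]
      by (cases "\<forall>i<d. 0 \<le> b i") (simp_all del: not_le not_all)
  next
    case (insert j J)
    let ?S = "\<lambda>J b. {x \<in> icube d. (\<forall>i<d. x i \<le> b i) \<and> (\<forall>i\<in>J. a i < x i)}"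
    \<comment> \<open>The minimum keeps the subtracted box inside the larger one also when
      \<open>a j\<close> exceeds \<open>b j\<close>.\<close>
    let ?b = "b(j := min (a j) (b j))"
    have j: "j < d" "J \<subseteq> {..<d}" using insert by auto
    have eq: "?S (insert j J) b = ?S J b - ?S J ?b"
      using j by (auto simp: not_le[symmetric])
    have sub: "?S J ?b \<subseteq> ?S J b" using j by (auto split: if_splits)
    have \<mu>_eq: "measure \<mu> (?S (insert j J) b) = measure \<mu> (?S J b) - measure \<mu> (?S J ?b)"
      unfolding eq by (rule \<mu>.finite_measure_Diff[OF _ _ sub]) (rule \<mu>.box_sets[OF j(2)])+
    have \<nu>_eq: "measure \<nu> (?S (insert j J) b) = measure \<nu> (?S J b) - measure \<nu> (?S J ?b)"
      unfolding eq by (rule \<nu>.finite_measure_Diff[OF _ _ sub]) (rule \<nu>.box_sets[OF j(2)])+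
    have "\<bar>u - v\<bar> \<le> 2 * e" if "u = p - q" "v = r - s" "\<bar>p - r\<bar> \<le> e" "\<bar>q - s\<bar> \<le> e"
      for u v p q r s e :: real using that by linarith
    from this[OF \<mu>_eq \<nu>_eq insert.IH[OF j(2)] insert.IH[OF j(2)]]
    show ?case by (simp only: card_insert_disjoint[OF insert.hyps] power_Suc mult.assoc)
  qed
qed

text \<open>Cover A by the grid cells that meet it. Each cell has nearly the same mass under both
  laws, the cells are disjoint, and those meeting A lie inside B. There are at most (m+1)^d cells,
  each contributing an error of at most 2^d \<open>\<eta>\<close>.\<close>

lemma measure_grid_le:
  assumes "copula_law d C \<mu>" "copula_law d D \<nu>"
    and CD: "\<And>x. x \<in> icube d \<Longrightarrow> \<bar>C x - D x\<bar> \<le> \<eta>"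
    and A: "A \<subseteq> icube d" and B: "B \<in> sets \<nu>" and m: "0 < (m::nat)"
    and AB: "\<And>x y. x \<in> A \<Longrightarrow> y \<in> icube d \<Longrightarrow> (\<And>i. i < d \<Longrightarrow> \<bar>x i - y i\<bar> \<le> 1 / m) \<Longrightarrow> y \<in> B"
  shows "measure \<mu> A \<le> measure \<nu> B + (2 * (m + 1)) ^ d * \<eta>"
proof -
  interpret \<mu>: copula_law d C \<mu> by fact
  interpret \<nu>: copula_law d D \<nu> by fact
  \<comment> \<open>There are m+1 indices per axis, not m: the half-open cell with index 0 is the
    one that catches the coordinate value 0.\<close>
  define I where "I = ({..<d} \<rightarrow>\<^sub>E {0..m})"
  define cell where "cell f = {x \<in> icube d. (\<forall>i<d. x i \<le> real (f i) / m) \<and>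
    (\<forall>i\<in>{..<d}. (real (f i) - 1) / m < x i)}" for f
  define J where "J = {f \<in> I. cell f \<inter> A \<noteq> {}}"
  have I: "finite I" "card I = (m + 1) ^ d" by (auto simp: I_def card_PiE finite_PiE)
  have "J \<subseteq> I" by (auto simp: J_def)
  from finite_subset[OF this I(1)] card_mono[OF I(1) this]
  have J: "finite J" "card J \<le> (m + 1) ^ d" unfolding I(2) by blast+
  have "(\<lambda>i\<in>{..<d}. 1) \<in> icube d" by (auto simp: icube_iff)
  then have eta: "0 \<le> \<eta>" using CD by (meson abs_ge_zero order.trans)
  have cover: "x \<in> (\<Union>f\<in>J. cell f)" if x: "x \<in> A" for x
  proof -
    define f where "f = (\<lambda>i\<in>{..<d}. nat \<lceil>m * x i\<rceil>)"
    have x01: "0 \<le> x i" "x i \<le> 1" if "i < d" for i using x A that by (auto simp: icube_iff)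
    have f: "f i \<le> m \<and> m * x i \<le> f i \<and> real (f i) - 1 < m * x i" if "i < d" for i
    proof -
      have "0 \<le> m * x i" "m * x i \<le> m" using x01[OF that] by (auto simp: mult_left_le)
      then have "0 \<le> \<lceil>m * x i\<rceil>" "\<lceil>m * x i\<rceil> \<le> m" by (simp_all add: ceiling_le_iff)
      then show ?thesis using that by (auto simp: f_def) linarith+
    qed
    have "f \<in> I" using f by (auto simp: I_def f_def)
    moreover have "x \<in> cell f"
      using f x A m by (auto simp: cell_def field_simps)
    ultimately show ?thesis using x by (auto simp: J_def)
  qed
  have cs: "cell f \<in> sets \<mu>" "cell f \<in> sets \<nu>" for f
    unfolding cell_def by (rule \<mu>.box_sets \<nu>.box_sets; simp)+
  have disj: "disjoint_family_on cell J"
    unfolding disjoint_family_on_def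
  proof (intro ballI impI)
    fix f g assume fg: "f \<in> J" "g \<in> J" "f \<noteq> g"
    then have "f \<in> {..<d} \<rightarrow>\<^sub>E {0..m}" "g \<in> {..<d} \<rightarrow>\<^sub>E {0..m}" by (auto simp only: J_def I_def)
    then obtain i where i: "i < d" "f i \<noteq> g i" using PiE_ext[of f _ _ g] fg(3) by blast
    show "cell f \<inter> cell g = {}"
    proof (rule ccontr)
      assume "\<not> ?thesis"
      then obtain x where "x \<in> cell f" "x \<in> cell g" by auto
      then have "real (f i) - 1 < m * x i" "m * x i \<le> f i" "real (g i) - 1 < m * x i" "m * x i \<le> g i"
        using i m by (auto simp: cell_def field_simps)
      then have "real (f i) - 1 < g i" "real (g i) - 1 < f i" by linarith+
      then show False using i by linarith
    qed
  qed
  have "measure \<mu> A \<le> measure \<mu> (\<Union>f\<in>J. cell f)"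
    using cover cs J by (intro \<mu>.finite_measure_mono) auto
  also have "\<dots> \<le> (\<Sum>f\<in>J. measure \<mu> (cell f))"
    using cs J by (intro \<mu>.finite_measure_subadditive_finite) auto
  also have "\<dots> \<le> (\<Sum>f\<in>J. measure \<nu> (cell f) + 2 ^ d * \<eta>)"
  proof (rule sum_mono)
    fix f
    show "measure \<mu> (cell f) \<le> measure \<nu> (cell f) + 2 ^ d * \<eta>"
      using measure_box_diff[OF assms(1,2) CD, of "{..<d}" "\<lambda>i. real (f i) / m" "\<lambda>i. (real (f i) - 1) / m"]
      by (simp add: cell_def abs_le_iff)
  qed
  also have "\<dots> = measure \<nu> (\<Union>f\<in>J. cell f) + card J * (2 ^ d * \<eta>)"
    using cs J disj by (simp add: sum.distrib \<nu>.finite_measure_finite_Union image_subset_iff)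
  also have "\<dots> \<le> measure \<nu> B + (m + 1) ^ d * (2 ^ d * \<eta>)"
  proof (intro add_mono mult_right_mono)
    show "measure \<nu> (\<Union>f\<in>J. cell f) \<le> measure \<nu> B"
    proof (rule \<nu>.finite_measure_mono[OF _ B], safe)
      fix f y assume "f \<in> J" and y: "y \<in> cell f"
      then obtain x where x: "x \<in> cell f" "x \<in> A" by (auto simp: J_def)
      show "y \<in> B"
      proof (rule AB[OF x(2)])
        show "y \<in> icube d" using y by (simp add: cell_def)
        fix i assume i: "i < d"
        have "(real (f i) - 1) / m < x i" "x i \<le> f i / m" "(real (f i) - 1) / m < y i" "y i \<le> f i / m"
          using i x y by (auto simp: cell_def)
        then show "\<bar>x i - y i\<bar> \<le> 1 / m" by (simp add: diff_divide_distrib)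
      qed
    qed
    show "real (card J) \<le> real ((m + 1) ^ d)" using J by (simp only: of_nat_le_iff)
  qed (use eta in auto)
  also have "(m + 1) ^ d * (2 ^ d * \<eta>) = (2 * (m + 1)) ^ d * \<eta>"
    by (simp only: power_mult_distrib of_nat_mult of_nat_power of_nat_numeral ac_simps)
  finally show ?thesis by (simp only: of_nat_power of_nat_mult of_nat_add of_nat_numeral of_nat_1)
qed

section \<open>The law of an Archimedean copula\<close>

lemma arch_fun_pos:
  assumes g: "generator \<psi>" and x: "x \<in> icube d" "\<And>i. i < d \<Longrightarrow> 0 < x i"
  shows "arch_fun d \<psi> x = \<psi> (\<Sum>i<d. real_inv \<psi> (x i))"
proof -
  have "x = (\<lambda>i\<in>{..<d}. \<psi> (real_inv \<psi> (x i)))"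
    using x by (intro extensionalityI[of _ "{..<d}"]) (auto simp: icube_iff gen_real_inv[OF g])
  then have "arch_fun d \<psi> x = arch_fun d \<psi> (\<lambda>i\<in>{..<d}. \<psi> (real_inv \<psi> (x i)))" by (rule arg_cong)
  also have "\<dots> = \<psi> (\<Sum>i<d. real_inv \<psi> (x i))" by (rule arch_fun_gen[OF g real_inv_nonneg])
  finally show ?thesis .
qed

lemma gen_clamp_measurable:
  assumes g: "generator \<psi>" and f: "f \<in> borel_measurable M"
  shows "(\<lambda>x. \<psi> (max 0 (f x))) \<in> borel_measurable M"
  by (rule measurable_compose[OF f borel_measurable_continuous_onI[OF generator_clamp_continuous[OF g]]])

lemma real_inv_nth_measurable:
  "generator \<psi> \<Longrightarrow> i < d \<Longrightarrow> (\<lambda>x. real_inv \<psi> (x i)) \<in> borel_measurable (icube_borel d)"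
  by (rule measurable_compose[OF measurable_icube_nth real_inv_measurable])

lemma arch_fun_measurable:
  assumes g: "generator \<psi>"
  shows "arch_fun d \<psi> \<in> borel_measurable (icube_borel d)"
proof -
  let ?S = "\<lambda>x. \<Sum>i<d. real_inv \<psi> (x i)"
  have eq: "arch_fun d \<psi> x = (if \<forall>i\<in>{..<d}. 0 < x i then \<psi> (max 0 (?S x)) else 0)"
    if x: "x \<in> icube d" for x
  proof (cases "\<forall>i\<in>{..<d}. 0 < x i")
    case True
    then show ?thesis using arch_fun_pos[OF g x] by (simp add: sum_nonneg)
  next
    case False
    then obtain i where "i < d" "x i = 0" using x by (force simp: icube_iff)
    then show ?thesis using arch_fun_zero[OF g x] unfolding if_not_P[OF False] by simp
  qed
  have "(\<lambda>x. if \<forall>i\<in>{..<d}. 0 < x i then \<psi> (max 0 (?S x)) else 0) \<in> borel_measurable (icube_borel d)"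
  proof (rule measurable_If)
    show "(\<lambda>x. \<psi> (max 0 (?S x))) \<in> borel_measurable (icube_borel d)"
      by (intro gen_clamp_measurable[OF g] borel_measurable_sum real_inv_nth_measurable[OF g]) simp
    show "{x \<in> space (icube_borel d). \<forall>i\<in>{..<d}. 0 < x i} \<in> sets (icube_borel d)"
    proof (cases "{..<d} = {}")
      case False
      then show ?thesis
        by (intro sets.sets_Collect_finite_All' borel_measurable_less measurable_icube_nth_borel) auto
    qed auto
  qed auto
  then show ?thesis
    using eq by (subst measurable_cong) (auto simp: space_icube_borel)
qed

locale arch_law = copula_law d "arch_fun d \<psi>" \<mu> for d \<psi> \<mu> +
  assumes gen: "generator \<psi>"
begin

text \<open>Up to a null set the event is the box with corner \<open>\<psi> (a i)\<close>, and the
  copula at that corner is \<open>\<psi>\<close> of the sum. The null set is where a coordinate is 0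
  and \<open>real_inv\<close> takes its conventional value.\<close>

lemma survival:
  assumes a: "\<And>i. i < d \<Longrightarrow> 0 \<le> a i"
  shows "measure \<mu> {x \<in> icube d. \<forall>i<d. a i \<le> real_inv \<psi> (x i)} = \<psi> (\<Sum>i<d. a i)"
proof -
  let ?A = "{x \<in> icube d. \<forall>i<d. a i \<le> real_inv \<psi> (x i)}"
  let ?y = "\<lambda>i\<in>{..<d}. \<psi> (a i)"
  let ?B = "{x \<in> icube d. \<forall>i<d. x i \<le> ?y i}"
  have y: "?y \<in> icube d" by (rule gen_icube[OF gen a])
  have A: "?A \<in> sets \<mu>"
  proof (cases "{..<d} = {}")
    case False
    have "{x \<in> space \<mu>. \<forall>i\<in>{..<d}. a i \<le> real_inv \<psi> (x i)} \<in> sets (icube_borel d)"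
      unfolding space_mu space_icube_borel[symmetric]
      using False by (intro sets.sets_Collect_finite_All' borel_measurable_le real_inv_nth_measurable[OF gen]) auto
    then show ?thesis by (simp only: sets_mu space_mu Ball_def lessThan_iff)
  next
    case True
    then have "?A = space \<mu>" by (auto simp: space_mu)
    then show ?thesis by (simp only: sets.top)
  qed
  have "AE x in \<mu>. x \<in> ?A \<longleftrightarrow> x \<in> ?B"
  proof (rule AE_mp[OF AE_pos], rule AE_I2, rule impI)
    fix x assume x: "x \<in> space \<mu>" "\<forall>i<d. 0 < x i"
    then have "a i \<le> real_inv \<psi> (x i) \<longleftrightarrow> x i \<le> ?y i" if "i < d" for i
      using that le_real_inv_iff[OF gen, of "x i" "a i"] a by (auto simp: space_mu icube_iff)
    then show "x \<in> ?A \<longleftrightarrow> x \<in> ?B" by blast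
  qed
  then have "measure \<mu> ?A = measure \<mu> ?B"
    by (rule finite_measure_eq_AE[OF _ A le_sets])
  also have "\<dots> = arch_fun d \<psi> ?y" by (rule C_eq[OF y, symmetric])
  also have "\<dots> = \<psi> (\<Sum>i<d. a i)" by (rule arch_fun_gen[OF gen a])
  finally show ?thesis .
qed

text \<open>Inverses of close generators can be far apart, so they are never compared. Instead the
  same arguments z_i, taken from the inverse of \<open>\<phi>\<close>, are fed to
  \<open>\<psi>\<close>. This changes the outer value by at most e and each of the d coordinates by
  at most e, and a copula is 1-Lipschitz in every coordinate; hence the factor d+1.\<close>

lemma arch_fun_close:
  assumes \<phi>: "generator \<phi>" and e: "\<And>z. 0 \<le> z \<Longrightarrow> \<bar>\<phi> z - \<psi> z\<bar> \<le> e" and x: "x \<in> icube d"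
  shows "\<bar>arch_fun d \<phi> x - arch_fun d \<psi> x\<bar> \<le> (real d + 1) * e"
proof (cases "\<forall>i<d. 0 < x i")
  case False
  then obtain i where i: "i < d" "x i = 0" using x by (force simp: icube_iff)
  have "0 \<le> e" using e[of 0] by linarith
  then show ?thesis using arch_fun_zero[OF \<phi> x i] arch_fun_zero[OF gen x i] by simp
next
  case True
  define z where "z i = real_inv \<phi> (x i)" for i
  have z: "0 \<le> z i" for i by (simp add: z_def)
  let ?y = "\<lambda>i\<in>{..<d}. \<psi> (z i)"
  have y: "?y \<in> icube d" by (rule gen_icube[OF gen z])
  have "\<bar>arch_fun d \<psi> ?y - arch_fun d \<psi> x\<bar> \<le> (\<Sum>i<d. \<bar>?y i - x i\<bar>)"
    by (rule C_lipschitz[OF y x])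
  also have "\<dots> \<le> (\<Sum>i<d. e)"
  proof (rule sum_mono)
    fix i assume i: "i \<in> {..<d}"
    then have "\<phi> (z i) = x i" unfolding z_def using True x by (intro gen_real_inv[OF \<phi>]) (auto simp: icube_iff)
    then show "\<bar>?y i - x i\<bar> \<le> e" using e[OF z, of i] i by (simp add: abs_minus_commute)
  qed
  finally have 1: "\<bar>arch_fun d \<psi> ?y - arch_fun d \<psi> x\<bar> \<le> d * e" by simp
  have 2: "arch_fun d \<psi> ?y = \<psi> (\<Sum>i<d. z i)" by (rule arch_fun_gen[OF gen z])
  have 3: "arch_fun d \<phi> x = \<phi> (\<Sum>i<d. z i)" unfolding z_def using True by (intro arch_fun_pos[OF \<phi> x]) auto
  have "\<bar>\<phi> (\<Sum>i<d. z i) - \<psi> (\<Sum>i<d. z i)\<bar> \<le> e" by (intro e sum_nonneg z)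
  then show ?thesis using 1 2 3 by (simp add: algebra_simps abs_le_iff)
qed

end

text \<open>The converse of \<open>survival\<close>, by which Archimedean copulas are constructed.
  Positivity of \<open>\<phi>\<close> makes the event that a coordinate is at most 0 empty, in
  agreement with the value 0 of the formula on the lower faces.\<close>

lemma has_df_of_survival:
  assumes "prob_space M" and g: "generator \<phi>" and pos: "\<And>z. 0 \<le> z \<Longrightarrow> 0 < \<phi> z"
    and Z: "\<And>i. i < d \<Longrightarrow> Z i \<in> borel_measurable M" and Z0: "\<And>i \<omega>. 0 \<le> Z i \<omega>"
    and surv: "\<And>a. (\<And>i. i < d \<Longrightarrow> 0 \<le> a i) \<Longrightarrow>
      measure M {\<omega> \<in> space M. \<forall>i<d. a i \<le> Z i \<omega>} = \<phi> (\<Sum>i<d. a i)"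
  defines "X \<equiv> \<lambda>\<omega>. \<lambda>i\<in>{..<d}. \<phi> (Z i \<omega>)"
  shows "X \<in> M \<rightarrow>\<^sub>M icube_borel d" "has_df d (distr M (icube_borel d) X) (arch_fun d \<phi>)"
proof -
  interpret prob_space M by fact
  show X: "X \<in> M \<rightarrow>\<^sub>M icube_borel d"
    unfolding X_def icube_borel_def unit_borel_def
  proof (rule measurable_restrict, rule measurable_restrict_space2)
    fix i assume "i \<in> {..<d}"
    then have "(\<lambda>\<omega>. \<phi> (max 0 (Z i \<omega>))) \<in> borel_measurable M" by (intro gen_clamp_measurable[OF g] Z) simp
    then show "(\<lambda>\<omega>. \<phi> (Z i \<omega>)) \<in> borel_measurable M" using Z0 by simp
    show "(\<lambda>\<omega>. \<phi> (Z i \<omega>)) \<in> space M \<rightarrow> {0..1}" using generator_range[OF g] Z0 by auto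
  qed
  show "has_df d (distr M (icube_borel d) X) (arch_fun d \<phi>)"
    unfolding has_df_def
  proof (intro conjI ballI)
    show "prob_space (distr M (icube_borel d) X)" by (rule prob_space_distr[OF X])
    show "sets (distr M (icube_borel d) X) = sets (icube_borel d)" by simp
    fix x assume x: "x \<in> icube d"
    let ?B = "{y \<in> icube d. \<forall>i<d. y i \<le> x i}"
    have B: "?B \<in> sets (icube_borel d)" unfolding sets_icube_borel using x by blast
    have eq: "X -` ?B \<inter> space M = {\<omega> \<in> space M. \<forall>i<d. \<phi> (Z i \<omega>) \<le> x i}"
      using measurable_space[OF X] by (auto simp: space_icube_borel X_def)
    have "measure (distr M (icube_borel d) X) ?B = measure M {\<omega> \<in> space M. \<forall>i<d. \<phi> (Z i \<omega>) \<le> x i}"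
      unfolding measure_distr[OF X B] eq ..
    also have "\<dots> = arch_fun d \<phi> x"
    proof (cases "\<forall>i<d. 0 < x i")
      case False
      then obtain i where i: "i < d" "x i = 0" using x by (force simp: icube_iff)
      then have "{\<omega> \<in> space M. \<forall>i<d. \<phi> (Z i \<omega>) \<le> x i} = {}"
        using pos[OF Z0, of i] by (auto simp: not_le[symmetric])
      then show ?thesis using arch_fun_zero[OF g x i] by (simp only: measure_empty)
    next
      case True
      define a where "a i = real_inv \<phi> (x i)" for i
      have le: "\<phi> (Z i \<omega>) \<le> x i \<longleftrightarrow> a i \<le> Z i \<omega>" if "i < d" for i \<omega>
        unfolding a_def using True x that by (intro real_inv_le_iff[OF g, symmetric] Z0) (auto simp: icube_iff)
      have "{\<omega> \<in> space M. \<forall>i<d. \<phi> (Z i \<omega>) \<le> x i} = {\<omega> \<in> space M. \<forall>i<d. a i \<le> Z i \<omega>}"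
        using le by blast
      then have "measure M {\<omega> \<in> space M. \<forall>i<d. \<phi> (Z i \<omega>) \<le> x i} = \<phi> (\<Sum>i<d. a i)"
        using surv[of a] by (simp only: a_def real_inv_nonneg)
      then show ?thesis using arch_fun_pos[OF g x] True by (simp add: a_def)
    qed
    finally show "measure (distr M (icube_borel d) X) ?B = arch_fun d \<phi> x" .
  qed
qed

section \<open>Scale mixtures of generators\<close>

definition unit_uniform :: "real measure" where
  "unit_uniform = uniform_measure lborel {0..1}"

interpretation unit_uniform: prob_space unit_uniform
  unfolding unit_uniform_def by (rule prob_space_uniform_measure) auto

lemma sets_unit_uniform [measurable_cong, simp]: "sets unit_uniform = sets borel"
  by (simp add: unit_uniform_def)

lemma space_unit_uniform [simp]: "space unit_uniform = UNIV"
  by (simp add: unit_uniform_def)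

lemma AE_unit_uniform: "AE w in unit_uniform. 0 \<le> w \<and> w \<le> 1"
  unfolding unit_uniform_def by (rule AE_uniform_measureI) auto

lemma measure_unit_uniform_Icc:
  assumes "0 \<le> a" "a \<le> b" "b \<le> 1"
  shows "measure unit_uniform {a..b} = b - a"
proof -
  have "{0..1} \<inter> {a..b} = {a..b}" using assms by auto
  then show ?thesis using assms unfolding unit_uniform_def
    by (subst measure_uniform_measure) auto
qed

lemma AE_unit_uniform_neq: "AE w in unit_uniform. w \<noteq> c"
proof -
  have "AE w in lborel. w \<noteq> c" by (rule AE_lborel_singleton)
  then have "AE w in lborel. w \<in> {0..1} \<longrightarrow> w \<noteq> c" by eventually_elim simp
  then show ?thesis unfolding unit_uniform_def by (intro AE_uniform_measureI) auto
qed

text \<open>An almost sure property holds at some point of every interval up to 1. It is used near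
  1, where the weight is as small as desired.\<close>

lemma AE_unit_uniform_witness:
  assumes "AE w in unit_uniform. P w" "0 \<le> c" "c < 1"
  obtains w where "c \<le> w" "w < 1" "P w"
proof (rule ccontr)
  assume "\<not> thesis"
  then have n: "\<not> (c \<le> w \<and> w < 1 \<and> P w)" for w using that by blast
  have "AE w in unit_uniform. w \<notin> {c..1}"
    using assms(1) AE_unit_uniform_neq[of 1] by eventually_elim (use n in force)
  then have "measure unit_uniform {c..1} = 0"
    by (subst (asm) AE_iff_measurable[of "{c..1}"]) (auto simp: measure_def)
  then show False using measure_unit_uniform_Icc[of c 1] assms by simp
qed

text \<open>Absolute value and maximum only serve to keep the weight in \<open>[0, 1]\<close> outside the unit interval.\<close>

definition weight :: "nat \<Rightarrow> real \<Rightarrow> real" where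
  "weight n w = max 0 (1 - \<bar>w\<bar> ^ n)"

lemma weight_range: "0 \<le> weight n w" "weight n w \<le> 1"
  by (auto simp: weight_def)

lemma weight_pos: "0 < n \<Longrightarrow> 0 \<le> w \<Longrightarrow> w < 1 \<Longrightarrow> 0 < weight n w"
  by (auto simp: weight_def power_less_one_iff)

lemma AE_weight_pos: "0 < n \<Longrightarrow> AE w in unit_uniform. 0 < weight n w"
  using AE_unit_uniform AE_unit_uniform_neq[of 1] by eventually_elim (rule weight_pos; simp)

lemma weight_measurable [measurable]: "weight n \<in> borel_measurable borel"
  unfolding weight_def by measurable

lemma weight_small:
  assumes "0 < n" "0 < r" "0 \<le> z"
  obtains c where "0 \<le> c" "c < 1" "\<And>w. c \<le> w \<Longrightarrow> w < 1 \<Longrightarrow> z * weight n w \<le> r"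
proof -
  have "isCont (\<lambda>w. z * weight n w) 1" unfolding weight_def by (intro continuous_intros)
  then have "((\<lambda>w. z * weight n w) \<longlongrightarrow> z * weight n 1) (at_left 1)"
    unfolding isCont_def by (rule filterlim_mono[OF _ order_refl]) (simp add: at_le)
  then have "eventually (\<lambda>w. z * weight n w < r) (at_left 1)"
    using assms by (intro order_tendstoD(2)) (auto simp: weight_def)
  then obtain b where b: "b < 1" "\<And>w. b < w \<Longrightarrow> w < 1 \<Longrightarrow> z * weight n w < r"
    by (auto simp: eventually_at_left_field)
  show ?thesis
  proof (rule that)
    \<comment> \<open>Any point strictly between b and 1 would do, cut at 0; being strictly above b,
      it allows the weak bound on w in the conclusion.\<close>
    show "0 \<le> max 0 ((b + 1) / 2)" "max 0 ((b + 1) / 2) < 1" using b by auto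
    fix w assume "max 0 ((b + 1) / 2) \<le> w" "w < 1"
    moreover have "b < (b + 1) / 2" using b by simp
    ultimately have "b < w" by linarith
    then show "z * weight n w \<le> r" using b \<open>w < 1\<close> by fastforce
  qed
qed

text \<open>The generator z -> E \<open>\<psi>\<close>(zW) with W = 1 - U^n. Clamping z at 0 makes
  the integrand meaningful, and the function continuous, on the whole line.\<close>

definition mixture :: "nat \<Rightarrow> (real \<Rightarrow> real) \<Rightarrow> real \<Rightarrow> real" where
  "mixture n \<psi> z = (LINT w|unit_uniform. \<psi> (max 0 z * weight n w))"

context
  fixes \<psi> :: "real \<Rightarrow> real" and n :: nat
  assumes g: "generator \<psi>" and n: "0 < n"
begin

lemma mixture_measurable: "(\<lambda>w. \<psi> (max 0 z * weight n w)) \<in> borel_measurable unit_uniform"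
proof -
  have "(\<lambda>w. \<psi> (max 0 (max 0 z * weight n w))) \<in> borel_measurable unit_uniform"
    by (rule gen_clamp_measurable[OF g]) measurable
  then show ?thesis by (simp add: weight_range)
qed

lemma mixture_integrand_range: "0 \<le> \<psi> (max 0 z * weight n w)" "\<psi> (max 0 z * weight n w) \<le> 1"
  using generator_range[OF g] weight_range by auto

lemma mixture_integrable: "integrable unit_uniform (\<lambda>w. \<psi> (max 0 z * weight n w))"
  using mixture_measurable mixture_integrand_range
  by (intro unit_uniform.integrable_const_bound[where B=1]) auto

lemma mixture_range: "0 \<le> mixture n \<psi> z" "mixture n \<psi> z \<le> 1"
proof -
  show "0 \<le> mixture n \<psi> z" unfolding mixture_def using mixture_integrand_range by (intro integral_nonneg_AE) auto
  show "mixture n \<psi> z \<le> 1" unfolding mixture_def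
    using mixture_integrand_range mixture_integrable by (intro unit_uniform.integral_le_const) auto
qed

lemma gen_clamp_tendsto: "(f \<longlongrightarrow> l) F \<Longrightarrow> ((\<lambda>x. \<psi> (max 0 (f x))) \<longlongrightarrow> \<psi> (max 0 l)) F"
  using generator_clamp_continuous[OF g] continuous_on_tendsto_compose[of UNIV "\<lambda>z. \<psi> (max 0 z)"] by force

lemma mixture_continuous: "continuous_on S (mixture n \<psi>)"
proof -
  have "isCont (mixture n \<psi>) z" for z
  proof (rule continuous_at_sequentiallyI)
    fix u :: "nat \<Rightarrow> real" assume u: "u \<longlonglongrightarrow> z"
    show "(\<lambda>k. mixture n \<psi> (u k)) \<longlonglongrightarrow> mixture n \<psi> z"
      unfolding mixture_def
    proof (rule integral_dominated_convergence[where w="\<lambda>_. 1"])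
      show "AE w in unit_uniform. (\<lambda>k. \<psi> (max 0 (u k) * weight n w)) \<longlonglongrightarrow> \<psi> (max 0 z * weight n w)"
      proof (rule AE_I2)
        fix w
        have "(\<lambda>k. \<psi> (max 0 (max 0 (u k) * weight n w))) \<longlonglongrightarrow> \<psi> (max 0 (max 0 z * weight n w))"
          by (intro gen_clamp_tendsto tendsto_intros u)
        then show "(\<lambda>k. \<psi> (max 0 (u k) * weight n w)) \<longlonglongrightarrow> \<psi> (max 0 z * weight n w)"
          by (simp add: weight_range)
      qed
    qed (use mixture_measurable mixture_integrand_range in auto)
  qed
  then show ?thesis by (simp add: continuous_at_imp_continuous_on)
qed

text \<open>Since \<open>\<psi>\<close> is positive near 0 and W takes arbitrarily small positive
  values, every z admits a weight at which \<open>\<psi>\<close> has not yet reached 0. The property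
  P carries an almost sure equation that is to be refuted at that weight.\<close>

lemma mixture_witness:
  assumes "0 \<le> z" "AE w in unit_uniform. P w"
  obtains w where "0 < weight n w" "0 < \<psi> (z * weight n w)" "P w"
proof -
  have "((\<lambda>x. \<psi> (max 0 x)) \<longlongrightarrow> \<psi> (max 0 0)) (at_right 0)"
    by (rule gen_clamp_tendsto) (rule tendsto_ident_at)
  then have "eventually (\<lambda>x. 0 < \<psi> (max 0 x)) (at_right 0)"
    using g by (intro order_tendstoD(1)) (auto simp: generator_def)
  then obtain b where b: "0 < b" "\<And>x. 0 < x \<Longrightarrow> x < b \<Longrightarrow> 0 < \<psi> (max 0 x)"
    by (auto simp: eventually_at_right_field)
  obtain c where c: "0 \<le> c" "c < 1" "\<And>w. c \<le> w \<Longrightarrow> w < 1 \<Longrightarrow> z * weight n w \<le> b / 2"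
    using weight_small[OF n, of "b / 2" z] b assms by auto
  obtain w where w: "c \<le> w" "w < 1" "P w" by (rule AE_unit_uniform_witness[OF assms(2) c(1,2)])
  have "0 < \<psi> (b / 2)" using b(2)[of "b / 2"] b(1) by simp
  also have "\<psi> (b / 2) \<le> \<psi> (z * weight n w)"
    using c w assms weight_range by (intro generator_antimono[OF g]) auto
  finally show ?thesis using that w c weight_pos[OF n, of w] by auto
qed

lemma mixture_pos: "0 < mixture n \<psi> z"
proof (rule ccontr)
  assume "\<not> ?thesis"
  then have "mixture n \<psi> z = 0" using mixture_range[of z] by linarith
  then have "AE w in unit_uniform. \<psi> (max 0 z * weight n w) = 0"
    unfolding mixture_def using mixture_integrable mixture_integrand_range
    by (subst (asm) integral_nonneg_eq_0_iff_AE) auto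
  then obtain w where "0 < \<psi> (max 0 z * weight n w)" "\<psi> (max 0 z * weight n w) = 0"
    by (rule mixture_witness[OF max.cobounded1])
  then show False by simp
qed

lemma mixture_le: "0 \<le> x \<Longrightarrow> x \<le> y \<Longrightarrow> mixture n \<psi> y \<le> mixture n \<psi> x"
  unfolding mixture_def
  by (intro integral_mono mixture_integrable generator_antimono[OF g] mult_right_mono weight_range)
    (auto simp: weight_range)

text \<open>Equality of the two integrals would force the ordered integrands to agree almost surely,
  but at the witness weight \<open>\<psi>\<close> is still positive and therefore strictly
  decreasing.\<close>

lemma mixture_strict:
  assumes "0 \<le> x" "x < y"
  shows "mixture n \<psi> y < mixture n \<psi> x"
proof (rule ccontr)
  assume "\<not> ?thesis"
  then have eq: "mixture n \<psi> x - mixture n \<psi> y = 0" using mixture_le[of x y] assms by simp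
  let ?f = "\<lambda>w. \<psi> (max 0 x * weight n w) - \<psi> (max 0 y * weight n w)"
  have nn: "0 \<le> ?f w" for w
    using assms weight_range[of n w] generator_antimono[OF g, of "x * weight n w" "y * weight n w"]
    by (simp add: mult_right_mono)
  have "integral\<^sup>L unit_uniform ?f = 0"
    using eq unfolding mixture_def by (subst Bochner_Integration.integral_diff) (auto intro: mixture_integrable)
  then have ae: "AE w in unit_uniform. ?f w = 0"
    using nn by (subst (asm) integral_nonneg_eq_0_iff_AE) (auto intro: mixture_integrable)
  obtain w where w: "0 < weight n w" "0 < \<psi> (x * weight n w)" "?f w = 0"
    by (rule mixture_witness[OF assms(1) ae])
  have "\<psi> (y * weight n w) < \<psi> (x * weight n w)"
    using w assms by (intro generator_strict[OF g]) auto
  then show False using w assms by simp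
qed

lemma mixture_limit: "(mixture n \<psi> \<longlongrightarrow> 0) at_top"
proof -
  have "((\<lambda>z. LINT w|unit_uniform. \<psi> (max 0 z * weight n w)) \<longlongrightarrow> (LINT w|unit_uniform. 0)) at_top"
  proof (rule integral_dominated_convergence_at_top[where w="\<lambda>_. 1"])
    show "AE w in unit_uniform. ((\<lambda>z. \<psi> (max 0 z * weight n w)) \<longlongrightarrow> 0) at_top"
      using AE_weight_pos[OF n]
    proof eventually_elim
      case (elim w)
      have "filterlim (\<lambda>z. max 0 z * weight n w) at_top at_top"
      proof (rule filterlim_at_top_mono)
        show "filterlim (\<lambda>z. z * weight n w) at_top at_top"
          using elim by (intro filterlim_at_top_mult_tendsto_pos[OF tendsto_const]) (auto simp: filterlim_ident)
      qed (auto intro!: always_eventually mult_right_mono weight_range)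
      moreover have "(\<psi> \<longlongrightarrow> 0) at_top" using g by (simp add: generator_def)
      ultimately show ?case by (rule filterlim_compose[rotated])
    qed
  qed (use mixture_measurable mixture_integrand_range in auto)
  then show ?thesis by (simp add: mixture_def[abs_def])
qed

lemma mixture_generator: "generator (mixture n \<psi>)"
  unfolding generator_def
proof (intro conjI)
  show "mixture n \<psi> \<in> {0..} \<rightarrow> {0..1}" using mixture_range by auto
  show "continuous_on {0..} (mixture n \<psi>)" by (rule mixture_continuous)
  show "antimono_on {0..} (mixture n \<psi>)" using mixture_le by (auto simp: monotone_on_def)
  show "mixture n \<psi> 0 = 1" using g by (simp add: mixture_def generator_def unit_uniform.prob_space[simplified])
  show "(mixture n \<psi> \<longlongrightarrow> 0) at_top" by (rule mixture_limit)
  show "strict_antimono_on {x. 0 \<le> x \<and> ennreal x < Inf (ennreal ` {z. 0 \<le> z \<and> mixture n \<psi> z = 0})} (mixture n \<psi>)"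
    using mixture_strict by (auto simp: monotone_on_def)
qed

end

text \<open>Scaling displaces z by an amount proportional to z, so uniform continuity alone does not
  help. On a bounded interval the displacement is small; beyond it \<open>\<psi>\<close> is below e
  both at z and at the scaled point.\<close>

lemma generator_scaling:
  assumes g: "generator \<psi>" and e: "0 < e"
  obtains \<delta> where "0 < \<delta>" "\<delta> \<le> 1 / 2"
    "\<And>z v. 0 \<le> z \<Longrightarrow> 1 - \<delta> \<le> v \<Longrightarrow> v \<le> 1 \<Longrightarrow> \<psi> (z * v) - \<psi> z \<le> e"
proof -
  have "(\<psi> \<longlongrightarrow> 0) at_top" using g by (simp add: generator_def)
  then have "eventually (\<lambda>z. \<psi> z < e) at_top" using e by (auto dest: order_tendstoD)
  then obtain M0 where M0: "\<And>z. M0 \<le> z \<Longrightarrow> \<psi> z < e" by (auto simp: eventually_at_top_linorder)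
  define M where "M = max 1 M0"
  have M: "1 \<le> M" "\<And>z. M \<le> z \<Longrightarrow> \<psi> z < e" using M0 by (auto simp: M_def)
  have "uniformly_continuous_on {0..2 * M} \<psi>"
    using g by (intro compact_uniformly_continuous) (auto simp: generator_def elim: continuous_on_subset)
  then obtain r where r: "0 < r" "\<And>x y. x \<in> {0..2 * M} \<Longrightarrow> y \<in> {0..2 * M} \<Longrightarrow> \<bar>x - y\<bar> < r \<Longrightarrow> \<bar>\<psi> x - \<psi> y\<bar> < e"
    using e unfolding uniformly_continuous_on_def dist_real_def by metis
  \<comment> \<open>The bound 1/2 keeps the scaled point above M when z exceeds 2M; the other bound
    gives a displacement of at most r/2 for z up to 2M.\<close>
  define \<delta> where "\<delta> = min (1 / 2) (r / (4 * M))"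
  have d: "0 < \<delta>" "\<delta> \<le> 1 / 2" "\<delta> \<le> r / (4 * M)" using r M by (auto simp: \<delta>_def)
  have "\<psi> (z * v) - \<psi> z \<le> e" if z: "0 \<le> z" and v: "1 - \<delta> \<le> v" "v \<le> 1" for z v
  proof (cases "z \<le> 2 * M")
    case True
    have v0: "0 \<le> v" using v d by linarith
    have "z * v - z = - (z * (1 - v))" by (simp add: algebra_simps)
    moreover have "0 \<le> z * (1 - v)" using z v by simp
    ultimately have "\<bar>z * v - z\<bar> = z * (1 - v)" by linarith
    also have "\<dots> \<le> (2 * M) * (r / (4 * M))" using z v d True by (intro mult_mono) auto
    also have "\<dots> < r" using M r by simp
    finally have "\<bar>z * v - z\<bar> < r" .
    moreover have "z * v \<le> z" using z v v0 by (simp add: mult_left_le)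
    ultimately have "\<bar>\<psi> (z * v) - \<psi> z\<bar> < e" using z v0 True by (intro r) auto
    then show ?thesis by linarith
  next
    case False
    then have "(2 * M) * (1 / 2) \<le> z * v" using M v d by (intro mult_mono) auto
    then have "\<psi> (z * v) < e" using M by simp
    then show ?thesis using generator_range[OF g z] by linarith
  qed
  then show ?thesis using that d by blast
qed

text \<open>For U below 1 - e' the power U^n is at most \<open>\<delta>\<close>, so W is close to 1
  and \<open>generator_scaling\<close> applies. The remaining values of U have probability e', and
  there the integrand is at most 1. The lower bound holds pointwise because W is at most 1.\<close>

lemma mixture_close:
  assumes g: "generator \<psi>" and e: "0 < e"
  obtains n where "0 < n" "\<And>z. 0 \<le> z \<Longrightarrow> \<bar>mixture n \<psi> z - \<psi> z\<bar> \<le> e"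
proof -
  \<comment> \<open>Both sources of error cost e', hence the half; the cut at 1 keeps the
    exceptional interval inside the unit interval.\<close>
  define e' where "e' = min e 1 / 2"
  have e': "0 < e'" "e' < 1" "2 * e' \<le> e" using e by (auto simp: e'_def)
  obtain \<delta> where \<delta>: "0 < \<delta>" "\<delta> \<le> 1 / 2"
    "\<And>z v. 0 \<le> z \<Longrightarrow> 1 - \<delta> \<le> v \<Longrightarrow> v \<le> 1 \<Longrightarrow> \<psi> (z * v) - \<psi> z \<le> e'"
    using generator_scaling[OF g e'(1)] by metis
  obtain k where k: "(1 - e') ^ k < \<delta>" using real_arch_pow_inv[OF \<delta>(1), of "1 - e'"] e' by auto
  define n where "n = Suc k"
  have "(1 - e') ^ n \<le> (1 - e') ^ k" using e' by (simp add: n_def mult_left_le_one_le)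
  then have n: "0 < n" "(1 - e') ^ n < \<delta>" using k by (auto simp: n_def)
  have "\<bar>mixture n \<psi> z - \<psi> z\<bar> \<le> e" if z: "0 \<le> z" for z
  proof -
    let ?f = "\<lambda>w. \<psi> (max 0 z * weight n w)"
    have int: "integrable unit_uniform ?f" by (rule mixture_integrable[OF g n(1)])
    have ind: "integrable unit_uniform (indicator {1 - e'..1} :: real \<Rightarrow> real)"
      by (rule integrable_real_indicator) (auto simp: unit_uniform.emeasure_eq_measure)
    have ge: "\<psi> z \<le> ?f w" for w
      using z weight_range[of n w] by (simp, intro generator_antimono[OF g]) (auto simp: mult_left_le)
    have le: "AE w in unit_uniform. ?f w \<le> (\<psi> z + e') + indicator {1 - e'..1} w"
      using AE_unit_uniform
    proof eventually_elim
      case (elim w)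
      show ?case
      proof (cases "w \<in> {1 - e'..1}")
        case True
        have "?f w \<le> 1" by (rule mixture_integrand_range[OF g n(1)])
        then show ?thesis using True generator_range[OF g z] e' by simp
      next
        case False
        then have "\<bar>w\<bar> ^ n \<le> (1 - e') ^ n" using elim by (intro power_mono) auto
        then have "1 - \<delta> \<le> weight n w" using n by (simp add: weight_def)
        then have "\<psi> (z * weight n w) - \<psi> z \<le> e'" using z weight_range by (intro \<delta>(3)) auto
        then show ?thesis using False z by simp
      qed
    qed
    have "mixture n \<psi> z \<le> (LINT w|unit_uniform. (\<psi> z + e') + indicator {1 - e'..1} w)"
      unfolding mixture_def using int ind le by (intro integral_mono_AE) auto
    also have "\<dots> = (\<psi> z + e') + measure unit_uniform {1 - e'..1}"
      using ind by (simp add: unit_uniform.prob_space[simplified] unit_uniform.emeasure_eq_measure)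
    also have "measure unit_uniform {1 - e'..1} = e'" using e' by (subst measure_unit_uniform_Icc) auto
    finally have "mixture n \<psi> z \<le> \<psi> z + e" using e' by linarith
    moreover have "\<psi> z \<le> mixture n \<psi> z"
      unfolding mixture_def using int ge by (intro unit_uniform.integral_ge_const) auto
    ultimately show ?thesis by linarith
  qed
  with n(1) show ?thesis by (rule that)
qed

section \<open>Archimedean copulas without atoms on level sets\<close>

lemma weight_inj:
  assumes "0 < n" "0 \<le> v" "v \<le> 1" "0 \<le> w" "w \<le> 1" "weight n v = weight n w"
  shows "v = w"
proof -
  have "v ^ n \<le> 1" "w ^ n \<le> 1" using assms by (auto intro: power_le_one)
  then have "v ^ n = w ^ n" using assms by (simp add: weight_def)
  then show ?thesis using assms power_eq_iff_eq_base by blast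
qed

context arch_law
begin

context
  fixes n :: nat
  assumes n: "0 < n"
begin

abbreviation "\<phi> \<equiv> mixture n \<psi>"
abbreviation "M \<equiv> \<mu> \<Otimes>\<^sub>M unit_uniform"

text \<open>The variables Z_i / W on the product space, with one W shared by all coordinates. Where
  W vanishes, the quotient is 0 by convention; this is a null event.\<close>

definition scaled :: "nat \<Rightarrow> (nat \<Rightarrow> real) \<times> real \<Rightarrow> real" where
  "scaled i p = real_inv \<psi> (fst p i) / weight n (snd p)"

definition scaled_law :: "(nat \<Rightarrow> real) measure" where
  "scaled_law = distr M (icube_borel d) (\<lambda>p. \<lambda>i\<in>{..<d}. \<phi> (scaled i p))"

interpretation pair_prob_space \<mu> unit_uniform ..

lemma scaled_nonneg: "0 \<le> scaled i p"
  by (simp add: scaled_def weight_range)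

lemma scaled_measurable: 
  assumes "i < d" shows "scaled i \<in> borel_measurable M"
proof -
  have "(\<lambda>x. real_inv \<psi> (x i)) \<in> borel_measurable \<mu>"
    using real_inv_nth_measurable[OF gen assms] by (simp add: measurable_cong_sets[OF sets_mu refl])
  then have "(\<lambda>p. real_inv \<psi> (fst p i)) \<in> borel_measurable M"
    by (rule measurable_compose[OF measurable_fst])
  moreover have "(\<lambda>p. weight n (snd p)) \<in> borel_measurable M"
    by measurable
  ultimately show ?thesis unfolding scaled_def by (rule borel_measurable_divide)
qed

text \<open>Given W = w, the event asks that Z_i be at least a_i w, so its conditional probability
  is \<open>\<psi>\<close> of w times the sum of the a_i. Integrating over w yields the
  mixture.\<close>

lemma scaled_survival:
  assumes a: "\<And>i. i < d \<Longrightarrow> 0 \<le> a i"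
  shows "measure M {p \<in> space M. \<forall>i<d. a i \<le> scaled i p} = \<phi> (\<Sum>i<d. a i)"
proof -
  let ?A = "{p \<in> space M. \<forall>i<d. a i \<le> scaled i p}"
  have A: "?A \<in> sets M"
  proof -
    have "{p \<in> space M. \<forall>i. i < d \<longrightarrow> a i \<le> scaled i p} \<in> sets M"
    proof (rule sets.sets_Collect_countable_All)
      fix i
      show "{p \<in> space M. i < d \<longrightarrow> a i \<le> scaled i p} \<in> sets M"
      proof (cases "i < d")
        case True
        have "{p \<in> space M. a i \<le> scaled i p} \<in> sets M"
          by (rule borel_measurable_le[OF _ scaled_measurable[OF True]]) simp
        with True show ?thesis by (simp only: simp_thms)
      next
        case False
        then have "{p \<in> space M. i < d \<longrightarrow> a i \<le> scaled i p} = space M" by blast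
        then show ?thesis by (simp only: sets.top)
      qed
    qed
    then show ?thesis .
  qed
  have s: "0 \<le> (\<Sum>i<d. a i)" using a by (intro sum_nonneg) auto
  have "emeasure M ?A = (\<integral>\<^sup>+w. emeasure \<mu> ((\<lambda>x. (x, w)) -` ?A) \<partial>unit_uniform)"
    by (rule emeasure_pair_measure_alt2[OF A])
  also have "\<dots> = (\<integral>\<^sup>+w. ennreal (\<psi> (max 0 (\<Sum>i<d. a i) * weight n w)) \<partial>unit_uniform)"
  proof (rule nn_integral_cong_AE, use AE_weight_pos[OF n] in eventually_elim)
    fix w assume w: "0 < weight n w"
    have "(\<lambda>x. (x, w)) -` ?A = {x \<in> icube d. \<forall>i<d. a i * weight n w \<le> real_inv \<psi> (x i)}"
      using w by (auto simp: space_pair_measure space_mu scaled_def field_simps)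
    then have "emeasure \<mu> ((\<lambda>x. (x, w)) -` ?A) =
        ennreal (measure \<mu> {x \<in> icube d. \<forall>i<d. a i * weight n w \<le> real_inv \<psi> (x i)})"
      by (simp only: emeasure_mu)
    also have "\<dots> = ennreal (\<psi> (\<Sum>i<d. a i * weight n w))"
      using a w by (subst survival) auto
    also have "(\<Sum>i<d. a i * weight n w) = max 0 (\<Sum>i<d. a i) * weight n w"
      using s by (simp add: sum_distrib_right)
    finally show "emeasure \<mu> ((\<lambda>x. (x, w)) -` ?A) = ennreal (\<psi> (max 0 (\<Sum>i<d. a i) * weight n w))" .
  qed
  also have "\<dots> = ennreal (\<phi> (\<Sum>i<d. a i))"
    unfolding mixture_def
    by (rule nn_integral_eq_integral[OF mixture_integrable[OF gen n]])
      (auto intro!: AE_I2 mixture_integrand_range[OF gen n])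
  finally show ?thesis using mixture_range[OF gen n] by (simp add: measure_def)
qed

lemma scaled_law_facts:
  "(\<lambda>p. \<lambda>i\<in>{..<d}. \<phi> (scaled i p)) \<in> M \<rightarrow>\<^sub>M icube_borel d"
  "has_df d scaled_law (arch_fun d \<phi>)"
  using has_df_of_survival[OF P.prob_space_axioms mixture_generator[OF gen n] mixture_pos[OF gen n]
      scaled_measurable scaled_nonneg scaled_survival]
  by (simp_all add: scaled_law_def)

lemma scaled_law_arch_law: "arch_law d \<phi> scaled_law"
proof
  show "has_df d scaled_law (arch_fun d \<phi>)" by (rule scaled_law_facts)
  have "arch_fun d \<phi> \<in> archimedean_copulas d"
    using scaled_law_facts by (auto simp: arch_fun_copula_iff[OF mixture_generator[OF gen n]])
  then show "copula d (arch_fun d \<phi>)" by (simp add: archimedean_copulas_def)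
  show "generator \<phi>" by (rule mixture_generator[OF gen n])
qed

text \<open>For fixed x, the equation S/W = s determines W, hence U, since the weight is injective
  on the unit interval. A single value of U has probability 0, and Fubini concludes.\<close>

lemma scaled_sum_null:
  assumes s: "0 < s"
  shows "measure M {p \<in> space M. (\<Sum>i<d. scaled i p) = s} = 0"
proof -
  let ?A = "{p \<in> space M. (\<Sum>i<d. scaled i p) = s}"
  have S: "(\<lambda>p. \<Sum>i<d. scaled i p) \<in> borel_measurable M"
    by (intro borel_measurable_sum scaled_measurable) simp
  have A: "?A \<in> sets M"
    using S by (rule borel_measurable_eq) simp
  have "emeasure M ?A = (\<integral>\<^sup>+x. emeasure unit_uniform (Pair x -` ?A) \<partial>\<mu>)"
    by (rule unit_uniform.emeasure_pair_measure_alt[OF A])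
  also have "\<dots> = (\<integral>\<^sup>+x. 0 \<partial>\<mu>)"
  proof (rule nn_integral_cong)
    fix x assume x: "x \<in> space \<mu>"
    let ?sol = "\<lambda>w. (\<Sum>i<d. real_inv \<psi> (x i)) / weight n w = s"
    have "AE w in unit_uniform. \<not> ?sol w"
    proof (cases "\<exists>w0. 0 \<le> w0 \<and> w0 \<le> 1 \<and> ?sol w0")
      case True
      then obtain w0 where w0: "0 \<le> w0" "w0 \<le> 1" "?sol w0" by blast
      show ?thesis using AE_unit_uniform AE_unit_uniform_neq[of w0]
      proof eventually_elim
        case (elim w)
        show ?case
        proof
          assume sol: "?sol w"
          \<comment> \<open>Division by a vanishing weight gives 0, which differs from s because s
            is positive.\<close>
          then have "weight n w \<noteq> 0" "weight n w0 \<noteq> 0" using w0 s by auto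
          then have "s * weight n w = s * weight n w0" using sol w0(3) by (simp add: field_simps)
          then have eq: "weight n w = weight n w0" using s by simp
          have "w = w0" by (rule weight_inj[OF n _ _ _ _ eq]) (simp_all only: elim w0)
          then show False using elim by simp
        qed
      qed
    next
      case False
      show ?thesis using AE_unit_uniform by eventually_elim (use False in blast)
    qed
    moreover have "Pair x -` ?A = {w. ?sol w}"
      using x by (auto simp: space_pair_measure scaled_def sum_divide_distrib)
    moreover have "Pair x -` ?A \<in> sets unit_uniform" by (rule sets_Pair1[OF A])
    ultimately show "emeasure unit_uniform (Pair x -` ?A) = 0"
      by (subst (asm) AE_iff_measurable[of "{w. ?sol w}"]) auto
  qed
  finally show ?thesis by (simp add: measure_def)
qed

text \<open>Levels up to 0 are never attained by the constructed vector because the mixture is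
  positive. Levels strictly between 0 and 1 correspond to one value of the scaled sum. For levels
  from 1 on, a copula is bounded by its first coordinate, which would have to equal 1.\<close>

lemma scaled_law_level_null:
  assumes d: "0 < d"
  shows "measure scaled_law {x \<in> icube d. arch_fun d \<phi> x = t} = 0"
proof -
  interpret \<nu>: arch_law d \<phi> scaled_law by (rule scaled_law_arch_law)
  let ?X = "\<lambda>p. \<lambda>i\<in>{..<d}. \<phi> (scaled i p)"
  let ?L = "{x \<in> icube d. arch_fun d \<phi> x = t}"
  have X: "?X \<in> M \<rightarrow>\<^sub>M icube_borel d" by (rule scaled_law_facts)
  have L: "?L \<in> sets (icube_borel d)"
    unfolding space_icube_borel[symmetric]
    by (rule borel_measurable_eq[OF arch_fun_measurable[OF \<nu>.gen]]) simp
  have eq: "?X -` ?L \<inter> space M = {p \<in> space M. \<phi> (\<Sum>i<d. scaled i p) = t}"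
    using measurable_space[OF X] arch_fun_gen[OF \<nu>.gen scaled_nonneg]
    by (auto simp: space_icube_borel)
  have meas: "measure scaled_law ?L = measure M {p \<in> space M. \<phi> (\<Sum>i<d. scaled i p) = t}"
    unfolding scaled_law_def measure_distr[OF X L] eq ..
  consider "t \<le> 0" | "0 < t" "t < 1" | "1 \<le> t" by linarith
  then show ?thesis
  proof cases
    case 1
    then have "{p \<in> space M. \<phi> (\<Sum>i<d. scaled i p) = t} = {}"
      using mixture_pos[OF gen n] by (auto simp: not_le[symmetric])
    then show ?thesis unfolding meas by (simp only: measure_empty)
  next
    case 2
    define s where "s = real_inv \<phi> t"
    have "\<phi> s = t" using 2 by (simp add: s_def gen_real_inv[OF \<nu>.gen])
    then have s: "0 < s" using 2 \<nu>.gen real_inv_nonneg[of \<phi> t]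
      by (cases "s = 0") (auto simp: generator_def s_def[symmetric])
    have "measure M {p \<in> space M. \<phi> (\<Sum>i<d. scaled i p) = t} \<le> measure M {p \<in> space M. (\<Sum>i<d. scaled i p) = s}"
    proof (rule P.finite_measure_mono)
      show "{p \<in> space M. \<phi> (\<Sum>i<d. scaled i p) = t} \<subseteq> {p \<in> space M. (\<Sum>i<d. scaled i p) = s}"
      proof safe
        fix p assume p: "t = \<phi> (\<Sum>i<d. scaled i p)"
        have "real_inv \<phi> (\<phi> (\<Sum>i<d. scaled i p)) = (\<Sum>i<d. scaled i p)"
          using 2 p by (intro real_inv_gen[OF \<nu>.gen] sum_nonneg scaled_nonneg) simp
        then show "(\<Sum>i<d. scaled i p) = s" by (simp add: s_def p)
      qed
      show "{p \<in> space M. (\<Sum>i<d. scaled i p) = s} \<in> sets M"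
        by (intro borel_measurable_eq borel_measurable_sum scaled_measurable) auto
    qed
    then show ?thesis using meas scaled_sum_null[OF s] by (simp add: measure_le_0_iff)
  next
    case 3
    have "?L \<subseteq> {x \<in> icube d. x 0 = 1}"
    proof safe
      fix x assume x: "x \<in> icube d" "t = arch_fun d \<phi> x"
      then have "1 \<le> x 0" using 3 \<nu>.C_le_nth[OF x(1) d] by simp
      then show "x 0 = 1" using x d by (force simp: icube_iff)
    qed
    then have "measure scaled_law ?L \<le> measure scaled_law {x \<in> icube d. x 0 = 1}"
      by (rule \<nu>.finite_measure_mono) (rule \<nu>.margin_sets[OF d])
    also have "\<dots> = 0"
      using \<nu>.AE_margin_neq[OF d, of 1] \<nu>.margin_sets(3)[OF d, of 1]
      by (subst (asm) AE_iff_measurable[of "{x \<in> icube d. x 0 = 1}"]) (auto simp: \<nu>.space_mu measure_def)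
    finally show ?thesis by (simp add: measure_le_0_iff)
  qed
qed

end

end

section \<open>Invariance under translations that preserve the sum\<close>

lemma sets_PiM_rays:
  fixes d :: nat
  shows "sets (Pi\<^sub>M {..<d} (\<lambda>_. borel :: real measure)) =
    sigma_sets ({..<d} \<rightarrow>\<^sub>E UNIV) (range (\<lambda>a. {z \<in> {..<d} \<rightarrow>\<^sub>E UNIV. \<forall>i<d. a i \<le> z i}))"
proof -
  have "sets (Pi\<^sub>M {..<d} (\<lambda>_. borel :: real measure)) = sets (Pi\<^sub>M {..<d} (\<lambda>_. sigma UNIV (range (atLeast :: real \<Rightarrow> _))))"
    by (simp only: borel_Ici)
  also have "\<dots> = sets (sigma ({..<d} \<rightarrow>\<^sub>E UNIV)
      {{f \<in> {..<d} \<rightarrow>\<^sub>E UNIV. \<forall>i\<in>j. f i \<in> A i} | A j. j \<in> {{..<d}} \<and> A \<in> Pi j (\<lambda>_. range (atLeast :: real \<Rightarrow> _))})"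
  proof (rule sets_PiM_sigma)
    show "\<exists>S\<subseteq>range (atLeast :: real \<Rightarrow> _). countable S \<and> UNIV = \<Union>S"
    proof (intro exI[of _ "range (\<lambda>n::nat. {- real n..})"] conjI)
      have "\<exists>n. - real n \<le> x" for x using real_arch_simple[of "- x"] by (metis minus_le_iff)
      then show "UNIV = \<Union> (range (\<lambda>n::nat. {- real n..}))" by auto
    qed auto
  qed auto
  also have "{{f \<in> {..<d} \<rightarrow>\<^sub>E UNIV. \<forall>i\<in>j. f i \<in> A i} | A j. j \<in> {{..<d}} \<and> A \<in> Pi j (\<lambda>_. range (atLeast :: real \<Rightarrow> _))}
    = range (\<lambda>a. {z \<in> {..<d} \<rightarrow>\<^sub>E UNIV. \<forall>i<d. a i \<le> z i})" (is "?L = ?R")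
  proof (intro subset_antisym subsetI)
    fix Y assume "Y \<in> ?L"
    then obtain A where A: "\<And>i. i < d \<Longrightarrow> A i \<in> range (atLeast :: real \<Rightarrow> _)" "Y = {f \<in> {..<d} \<rightarrow>\<^sub>E UNIV. \<forall>i<d. f i \<in> A i}"
      by auto
    have "\<exists>s. A i = {s..}" if "i < d" for i
      using A(1)[OF that] by auto
    then obtain a where "\<And>i. i < d \<Longrightarrow> A i = {a i..}" by metis
    then have "Y = {z \<in> {..<d} \<rightarrow>\<^sub>E UNIV. \<forall>i<d. a i \<le> z i}" unfolding A(2) by auto
    then show "Y \<in> ?R" by blast
  next
    fix Y assume "Y \<in> ?R"
    then obtain a where "Y = {z \<in> {..<d} \<rightarrow>\<^sub>E UNIV. \<forall>i<d. a i \<le> z i}" by blast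
    then have "Y = {f \<in> {..<d} \<rightarrow>\<^sub>E UNIV. \<forall>i\<in>{..<d}. f i \<in> {a i..}}" by auto
    then show "Y \<in> ?L" by (intro CollectI exI[of _ "\<lambda>i. {a i..}"] exI[of _ "{..<d}"]) simp
  qed
  finally show ?thesis by (simp add: image_subset_iff)
qed

text \<open>Upper orthants form an intersection-stable generator, the intersection being taken by
  coordinatewise maxima, so the survival function determines a finite measure.\<close>

lemma measure_eqI_rays:
  fixes \<mu> \<nu> :: "(nat \<Rightarrow> real) measure"
  assumes "finite_measure \<mu>" "finite_measure \<nu>"
    and sets: "sets \<mu> = sets (Pi\<^sub>M {..<d} (\<lambda>_. borel :: real measure))" "sets \<nu> = sets (Pi\<^sub>M {..<d} (\<lambda>_. borel :: real measure))"
    and eq: "\<And>a. emeasure \<mu> {z \<in> {..<d} \<rightarrow>\<^sub>E UNIV. \<forall>i<d. a i \<le> z i} = emeasure \<nu> {z \<in> {..<d} \<rightarrow>\<^sub>E UNIV. \<forall>i<d. a i \<le> z i}"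
  shows "\<mu> = \<nu>"
proof -
  define ray where "ray a = {z :: nat \<Rightarrow> real. z \<in> {..<d} \<rightarrow>\<^sub>E UNIV \<and> (\<forall>i<d. a i \<le> z i)}" for a
  interpret \<mu>: finite_measure \<mu> by fact
  show ?thesis
  proof (rule measure_eqI_generator_eq[where E="range ray" and \<Omega>="{..<d} \<rightarrow>\<^sub>E UNIV" and A="\<lambda>n. ray (\<lambda>_. - real n)"])
    show "Int_stable (range ray)"
    proof (rule Int_stableI_image)
      fix a b
      have "ray a \<inter> ray b = ray (\<lambda>i. max (a i) (b i))" by (auto simp: ray_def)
      then show "\<exists>c\<in>UNIV. ray a \<inter> ray b = ray c" by blast
    qed
    show "range ray \<subseteq> Pow ({..<d} \<rightarrow>\<^sub>E UNIV)" by (auto simp: ray_def)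
    show "sets \<mu> = sigma_sets ({..<d} \<rightarrow>\<^sub>E UNIV) (range ray)" "sets \<nu> = sigma_sets ({..<d} \<rightarrow>\<^sub>E UNIV) (range ray)"
      unfolding sets sets_PiM_rays ray_def by simp_all
    show "emeasure \<mu> X = emeasure \<nu> X" if "X \<in> range ray" for X
      using that eq by (auto simp: ray_def)
    show "(\<Union>n. ray (\<lambda>_. - real n)) = {..<d} \<rightarrow>\<^sub>E UNIV"
    proof (intro subset_antisym subsetI)
      fix z :: "nat \<Rightarrow> real" assume z: "z \<in> {..<d} \<rightarrow>\<^sub>E UNIV"
      obtain n where n: "(\<Sum>i<d. \<bar>z i\<bar>) \<le> real n" using real_arch_simple by blast
      have "- real n \<le> z i" if "i < d" for i
        using n member_le_sum[of i "{..<d}" "\<lambda>i. \<bar>z i\<bar>"] that by fastforce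
      then show "z \<in> (\<Union>n. ray (\<lambda>_. - real n))" using z by (auto simp: ray_def)
    qed (auto simp: ray_def)
  qed auto
qed

lemma PiM_lborel_translation:
  fixes y :: "'i \<Rightarrow> real"
  assumes "finite I"
  shows "distr (Pi\<^sub>M I (\<lambda>_. lborel)) (Pi\<^sub>M I (\<lambda>_. lborel)) (\<lambda>v. \<lambda>i\<in>I. y i + v i) = Pi\<^sub>M I (\<lambda>_. lborel)"
proof -
  interpret product_sigma_finite "\<lambda>_::'i. lborel :: real measure" ..
  show ?thesis
  proof (rule PiM_eqI[OF assms])
    fix A :: "'i \<Rightarrow> real set" assume A: "\<And>i. i \<in> I \<Longrightarrow> A i \<in> sets lborel"
    have A': "(\<lambda>x. y i + x) -` A i \<in> sets lborel" if "i \<in> I" for i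
      using measurable_sets[of "(+) (y i)" borel borel "A i"] A[OF that] by simp
    have "emeasure (distr (Pi\<^sub>M I (\<lambda>_. lborel)) (Pi\<^sub>M I (\<lambda>_. lborel)) (\<lambda>v. \<lambda>i\<in>I. y i + v i)) (Pi\<^sub>E I A) =
      emeasure (Pi\<^sub>M I (\<lambda>_. lborel)) ((\<lambda>v. \<lambda>i\<in>I. y i + v i) -` Pi\<^sub>E I A \<inter> space (Pi\<^sub>M I (\<lambda>_. lborel)))"
      using A assms by (intro emeasure_distr sets_PiM_I_finite) auto
    also have "(\<lambda>v. \<lambda>i\<in>I. y i + v i) -` Pi\<^sub>E I A \<inter> space (Pi\<^sub>M I (\<lambda>_. lborel)) = Pi\<^sub>E I (\<lambda>i. (\<lambda>x. y i + x) -` A i)"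
      by (auto simp: space_PiM PiE_iff)
    also have "emeasure (Pi\<^sub>M I (\<lambda>_. lborel)) \<dots> = (\<Prod>i\<in>I. emeasure lborel ((\<lambda>x. y i + x) -` A i))"
      using A' by (intro emeasure_PiM assms) auto
    also have "\<dots> = (\<Prod>i\<in>I. emeasure lborel (A i))"
    proof (rule prod.cong[OF refl])
      fix i assume i: "i \<in> I"
      have "emeasure lborel (A i) = emeasure (distr lborel borel ((+) (y i))) (A i)"
        by (simp only: lborel_distr_plus)
      also have "\<dots> = emeasure lborel ((\<lambda>x. y i + x) -` A i)"
        using A[OF i] by (subst emeasure_distr) auto
      finally show "emeasure lborel ((\<lambda>x. y i + x) -` A i) = emeasure lborel (A i)" by simp
    qed
    finally show "emeasure (distr (Pi\<^sub>M I (\<lambda>_. lborel)) (Pi\<^sub>M I (\<lambda>_. lborel)) (\<lambda>v. \<lambda>i\<in>I. y i + v i)) (Pi\<^sub>E I A) =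
      (\<Prod>i\<in>I. emeasure lborel (A i))" .
  qed simp
qed

text \<open>Isolates what yields absolute continuity: the joint survival probability depends on the
  thresholds only through their sum. The number of coordinates is k+1, so that k is the dimension of
  the conditioning vector.\<close>

locale simplex_survival = prob_space M for M :: "'a measure" +
  fixes k :: nat and Z :: "nat \<Rightarrow> 'a \<Rightarrow> real" and \<phi> :: "real \<Rightarrow> real"
  assumes Z_meas: "\<And>i. i < Suc k \<Longrightarrow> Z i \<in> borel_measurable M"
    and Z_nonneg: "\<And>i \<omega>. 0 \<le> Z i \<omega>"
    and Z_pos: "AE \<omega> in M. \<forall>i<Suc k. 0 < Z i \<omega>"
    and surv: "\<And>a. (\<And>i. i < Suc k \<Longrightarrow> 0 \<le> a i) \<Longrightarrow>
      measure M {\<omega> \<in> space M. \<forall>i<Suc k. a i \<le> Z i \<omega>} = \<phi> (\<Sum>i<Suc k. a i)"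
begin

abbreviation "P \<equiv> Pi\<^sub>M {..<Suc k} (\<lambda>_. borel :: real measure)"
abbreviation "L \<equiv> Pi\<^sub>M {..<k} (\<lambda>_. lborel :: real measure)"

definition "head_coords \<omega> = (\<lambda>i\<in>{..<k}. Z i \<omega>)"
definition "coord_sum \<omega> = (\<Sum>i<Suc k. Z i \<omega>)"

lemma Z_Collect_sets: "{\<omega> \<in> space M. \<forall>i<Suc k. a i \<le> Z i \<omega>} \<in> sets M"
proof -
  have "{\<omega> \<in> space M. \<forall>i\<in>{..<Suc k}. a i \<le> Z i \<omega>} \<in> sets M"
    by (intro sets.sets_Collect_finite_All' borel_measurable_le Z_meas) auto
  then show ?thesis by (simp only: Ball_def lessThan_iff)
qed

lemma shift_measurable: "(\<lambda>\<omega>. \<lambda>i\<in>{..<Suc k}. Z i \<omega> - s i) \<in> M \<rightarrow>\<^sub>M P"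
  by (intro measurable_restrict borel_measurable_diff Z_meas) auto

text \<open>The survival function only depends on the sum of the arguments, so mass may be moved
  along the hyperplanes on which the sum of the coordinates is constant.\<close>

lemma shift_eq:
  assumes s: "\<And>i. i < Suc k \<Longrightarrow> 0 \<le> s i" and t: "\<And>i. i < Suc k \<Longrightarrow> 0 \<le> t i"
    and st: "(\<Sum>i<Suc k. s i) = (\<Sum>i<Suc k. t i)" and G: "G \<in> sets P"
  shows "emeasure M {\<omega> \<in> space M. (\<lambda>i\<in>{..<Suc k}. Z i \<omega> - s i) \<in> G \<and> (\<forall>i<Suc k. s i \<le> Z i \<omega>)} =
    emeasure M {\<omega> \<in> space M. (\<lambda>i\<in>{..<Suc k}. Z i \<omega> - t i) \<in> G \<and> (\<forall>i<Suc k. t i \<le> Z i \<omega>)}"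
proof -
  \<comment> \<open>The law of Z - s, restricted to the event that Z dominates s.\<close>
  define \<kappa> where "\<kappa> s = distr (density M (indicator {\<omega> \<in> space M. \<forall>i<Suc k. s i \<le> Z i \<omega>})) P
    (\<lambda>\<omega>. \<lambda>i\<in>{..<Suc k}. Z i \<omega> - s i)" for s
  have \<kappa>: "emeasure (\<kappa> s) G =
    emeasure M {\<omega> \<in> space M. (\<lambda>i\<in>{..<Suc k}. Z i \<omega> - s i) \<in> G \<and> (\<forall>i<Suc k. s i \<le> Z i \<omega>)}"
    if G: "G \<in> sets P" for G s
  proof -
    let ?U = "\<lambda>\<omega>. \<lambda>i\<in>{..<Suc k}. Z i \<omega> - s i" and ?S = "{\<omega> \<in> space M. \<forall>i<Suc k. s i \<le> Z i \<omega>}"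
    have "emeasure (\<kappa> s) G = emeasure (density M (indicator ?S)) (?U -` G \<inter> space M)"
      unfolding \<kappa>_def using shift_measurable[of s] G by (subst emeasure_distr) auto
    also have "\<dots> = emeasure M (?S \<inter> (?U -` G \<inter> space M))"
      by (rule emeasure_restricted[OF Z_Collect_sets measurable_sets[OF shift_measurable G]])
    also have "?S \<inter> (?U -` G \<inter> space M) = {\<omega> \<in> space M. ?U \<omega> \<in> G \<and> (\<forall>i<Suc k. s i \<le> Z i \<omega>)}" by blast
    finally show ?thesis .
  qed
  have fin: "finite_measure (\<kappa> s)" for s
  proof (rule finite_measureI)
    have "emeasure (\<kappa> s) (space P) \<le> emeasure M (space M)"
      unfolding \<kappa>[OF sets.top] by (rule emeasure_mono) auto
    also have "\<dots> < \<infinity>" by (simp add: emeasure_space_1)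
    finally show "emeasure (\<kappa> s) (space (\<kappa> s)) \<noteq> \<infinity>" by (simp add: \<kappa>_def)
  qed
  \<comment> \<open>On the restricted event Z - s is nonnegative, so negative thresholds act like 0.
    What remains depends on s only through its sum.\<close>
  have ray: "emeasure (\<kappa> s) {z \<in> {..<Suc k} \<rightarrow>\<^sub>E UNIV. \<forall>i<Suc k. a i \<le> z i} =
      ennreal (\<phi> ((\<Sum>i<Suc k. s i) + (\<Sum>i<Suc k. max 0 (a i))))"
    if s: "\<And>i. i < Suc k \<Longrightarrow> 0 \<le> s i" for s a
  proof -
    have "{z \<in> {..<Suc k} \<rightarrow>\<^sub>E UNIV. \<forall>i<Suc k. a i \<le> z i} \<in> sets P"
      unfolding sets_PiM_rays by blast
    from \<kappa>[OF this] have "emeasure (\<kappa> s) {z \<in> {..<Suc k} \<rightarrow>\<^sub>E UNIV. \<forall>i<Suc k. a i \<le> z i} = emeasure M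
      {\<omega> \<in> space M. (\<lambda>i\<in>{..<Suc k}. Z i \<omega> - s i) \<in> {z \<in> {..<Suc k} \<rightarrow>\<^sub>E UNIV. \<forall>i<Suc k. a i \<le> z i} \<and> (\<forall>i<Suc k. s i \<le> Z i \<omega>)}" .
    also have "{\<omega> \<in> space M. (\<lambda>i\<in>{..<Suc k}. Z i \<omega> - s i) \<in> {z \<in> {..<Suc k} \<rightarrow>\<^sub>E UNIV. \<forall>i<Suc k. a i \<le> z i} \<and> (\<forall>i<Suc k. s i \<le> Z i \<omega>)} =
      {\<omega> \<in> space M. \<forall>i<Suc k. s i + max 0 (a i) \<le> Z i \<omega>}"
    proof -
      have iff: "(\<forall>i<Suc k. a i \<le> (\<lambda>i\<in>{..<Suc k}. Z i \<omega> - s i) i) \<and> (\<forall>i<Suc k. s i \<le> Z i \<omega>) \<longleftrightarrow>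
        (\<forall>i<Suc k. s i + max 0 (a i) \<le> Z i \<omega>)" for \<omega>
      proof -
        have "(a i \<le> (\<lambda>i\<in>{..<Suc k}. Z i \<omega> - s i) i \<and> s i \<le> Z i \<omega>) = (s i + max 0 (a i) \<le> Z i \<omega>)"
          if "i < Suc k" for i
          using that by simp linarith
        then show ?thesis by blast
      qed
      have ext: "(\<lambda>i\<in>{..<Suc k}. Z i \<omega> - s i) \<in> {..<Suc k} \<rightarrow>\<^sub>E UNIV" for \<omega> by simp
      show ?thesis
        by (intro Collect_cong conj_cong refl) (use iff ext in \<open>simp only: mem_Collect_eq simp_thms\<close>)
    qed
    also have "emeasure M \<dots> = ennreal (\<phi> (\<Sum>i<Suc k. s i + max 0 (a i)))"
      using s unfolding emeasure_eq_measure by (subst surv) auto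
    finally show ?thesis by (simp only: sum.distrib)
  qed
  have "\<kappa> s = \<kappa> t"
    by (rule measure_eqI_rays[where d="Suc k"]) (simp_all only: fin ray s t st, simp_all add: \<kappa>_def)
  then show ?thesis using \<kappa>[OF G] by metis
qed

lemma head_measurable: "head_coords \<in> M \<rightarrow>\<^sub>M L"
proof -
  have "(\<lambda>\<omega>. \<lambda>i\<in>{..<k}. Z i \<omega>) \<in> M \<rightarrow>\<^sub>M L"
    by (intro measurable_restrict) (simp add: Z_meas)
  then show ?thesis by (simp only: head_coords_def[abs_def])
qed

lemma coord_sum_measurable: "coord_sum \<in> borel_measurable M"
proof -
  have "(\<lambda>\<omega>. \<Sum>i<Suc k. Z i \<omega>) \<in> borel_measurable M"
    by (intro borel_measurable_sum Z_meas) simp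
  then show ?thesis by (simp only: coord_sum_def[abs_def])
qed

text \<open>Apply \<open>shift_eq\<close> to s = (v, 0) and t = (0, ..., 0, V), where V is the sum
  of v. Subtracting s and subtracting t give the same restricted law; in terms of the original
  vector this replaces the head Z by Z + v while the sum stays S. The margin \<open>\<delta>\<close>
  ensures that Z dominates s, and on the other side the constraint that the last coordinate be at
  least V is dropped, which leaves an inequality.\<close>

lemma shift_bound:
  assumes B: "B \<in> sets (L \<Otimes>\<^sub>M borel)" and v: "\<And>i. i < k \<Longrightarrow> 0 \<le> v i \<and> v i \<le> \<delta>"
  shows "emeasure M {\<omega> \<in> space M. (head_coords \<omega>, coord_sum \<omega>) \<in> B \<and> (\<forall>i<k. \<delta> \<le> Z i \<omega>)} \<le>
    emeasure M {\<omega> \<in> space M. ((\<lambda>i\<in>{..<k}. Z i \<omega> + v i), coord_sum \<omega>) \<in> B}"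
proof -
  let ?s = "\<lambda>i. if i < k then v i else 0"
  let ?V = "\<Sum>i<k. v i"
  let ?t = "\<lambda>i. if i < k then 0 else ?V"
  \<comment> \<open>Recovers the head and the sum of Z from Z - s. Applied to Z - t, it returns the
    translated head together with the same sum.\<close>
  define g where "g z = ((\<lambda>i\<in>{..<k}. z i + v i), (\<Sum>i<Suc k. z i) + ?V)" for z :: "nat \<Rightarrow> real"
  have g: "g \<in> P \<rightarrow>\<^sub>M L \<Otimes>\<^sub>M borel"
    unfolding g_def
  proof (intro measurable_Pair measurable_restrict)
    show "(\<lambda>z. (\<Sum>i<Suc k. z i) + ?V) \<in> borel_measurable P"
      by (intro borel_measurable_add borel_measurable_sum borel_measurable_const measurable_component_singleton)
    fix i assume "i \<in> {..<k}"
    then have "(\<lambda>z. z i) \<in> borel_measurable P" by (intro measurable_component_singleton) simp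
    then show "(\<lambda>z. z i + v i) \<in> P \<rightarrow>\<^sub>M lborel" by simp
  qed
  define G where "G = {z \<in> space P. g z \<in> B \<and> (\<forall>i<k. \<delta> \<le> z i + v i)}"
  have G: "G \<in> sets P"
  proof -
    have "{z \<in> space P. g z \<in> B} \<in> sets P" using measurable_sets[OF g B] by (simp add: vimage_def Int_def conj_commute)
    moreover have "{z \<in> space P. \<forall>i. i < k \<longrightarrow> \<delta> \<le> z i + v i} \<in> sets P"
    proof (rule sets.sets_Collect_countable_All)
      fix i
      show "{z \<in> space P. i < k \<longrightarrow> \<delta> \<le> z i + v i} \<in> sets P"
      proof (cases "i < k")
        case True
        then have [measurable]: "(\<lambda>z. z i) \<in> borel_measurable P" by (intro measurable_component_singleton) simp
        have "{z \<in> space P. \<delta> \<le> z i + v i} \<in> sets P" by measurable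
        with True show ?thesis by (simp only: simp_thms)
      next
        case False
        then have "{z \<in> space P. i < k \<longrightarrow> \<delta> \<le> z i + v i} = space P" by blast
        then show ?thesis by (simp only: sets.top)
      qed
    qed
    ultimately have "{z \<in> space P. g z \<in> B} \<inter> {z \<in> space P. \<forall>i. i < k \<longrightarrow> \<delta> \<le> z i + v i} \<in> sets P"
      by (rule sets.Int)
    moreover have "{z \<in> space P. g z \<in> B} \<inter> {z \<in> space P. \<forall>i. i < k \<longrightarrow> \<delta> \<le> z i + v i} = G"
      by (auto simp: G_def)
    ultimately show ?thesis by (simp only:)
  qed
  have V: "0 \<le> ?V" using v by (intro sum_nonneg) auto
  have sum_s: "(\<Sum>i<Suc k. ?s i) = ?V" "(\<Sum>i<Suc k. ?t i) = ?V" by simp_all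
  have gs: "g (\<lambda>i\<in>{..<Suc k}. Z i \<omega> - ?s i) = (head_coords \<omega>, coord_sum \<omega>)" for \<omega>
  proof -
    have "(\<Sum>i<Suc k. (\<lambda>i\<in>{..<Suc k}. Z i \<omega> - ?s i) i) = (\<Sum>i<Suc k. Z i \<omega> - ?s i)"
      by (intro sum.cong) auto
    also have "\<dots> = (\<Sum>i<Suc k. Z i \<omega>) - ?V" by (simp only: sum_subtractf sum_s)
    finally show ?thesis by (auto simp: g_def head_coords_def coord_sum_def simp del: sum.lessThan_Suc)
  qed
  have gt: "g (\<lambda>i\<in>{..<Suc k}. Z i \<omega> - ?t i) = ((\<lambda>i\<in>{..<k}. Z i \<omega> + v i), coord_sum \<omega>)" for \<omega>
  proof -
    have "(\<Sum>i<Suc k. (\<lambda>i\<in>{..<Suc k}. Z i \<omega> - ?t i) i) = (\<Sum>i<Suc k. Z i \<omega> - ?t i)"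
      by (intro sum.cong) auto
    also have "\<dots> = (\<Sum>i<Suc k. Z i \<omega>) - ?V" by (simp only: sum_subtractf sum_s)
    finally show ?thesis by (auto simp: g_def coord_sum_def simp del: sum.lessThan_Suc)
  qed
  have sp: "(\<lambda>i\<in>{..<Suc k}. Z i \<omega> - s i) \<in> space P" for s \<omega> by (simp add: space_PiM)
  have "{\<omega> \<in> space M. (head_coords \<omega>, coord_sum \<omega>) \<in> B \<and> (\<forall>i<k. \<delta> \<le> Z i \<omega>)} =
    {\<omega> \<in> space M. (\<lambda>i\<in>{..<Suc k}. Z i \<omega> - ?s i) \<in> G \<and> (\<forall>i<Suc k. ?s i \<le> Z i \<omega>)}" (is "?l = ?r")
  proof (rule Collect_cong, rule conj_cong[OF refl])
    fix \<omega>
    let ?U = "\<lambda>i\<in>{..<Suc k}. Z i \<omega> - ?s i"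
    let ?Q = "\<forall>i<k. \<delta> \<le> Z i \<omega>" and ?S = "\<forall>i<Suc k. ?s i \<le> Z i \<omega>"
    have "(\<forall>i<k. \<delta> \<le> ?U i + v i) \<longleftrightarrow> ?Q" by auto
    then have in_G: "?U \<in> G \<longleftrightarrow> (head_coords \<omega>, coord_sum \<omega>) \<in> B \<and> ?Q"
      unfolding G_def using sp gs[of \<omega>] by (simp only: mem_Collect_eq simp_thms)
    have QS: ?S if ?Q
    proof (intro allI impI)
      fix i assume "i < Suc k"
      show "?s i \<le> Z i \<omega>" using that v[of i] Z_nonneg[of i \<omega>] by (cases "i < k") force+
    qed
    show "(head_coords \<omega>, coord_sum \<omega>) \<in> B \<and> ?Q \<longleftrightarrow> ?U \<in> G \<and> ?S"
    proof
      assume h: "(head_coords \<omega>, coord_sum \<omega>) \<in> B \<and> ?Q"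
      show "?U \<in> G \<and> ?S" unfolding in_G by (intro conjI h conjunct1[OF h] conjunct2[OF h] QS)
    next
      assume "?U \<in> G \<and> ?S"
      then show "(head_coords \<omega>, coord_sum \<omega>) \<in> B \<and> ?Q" unfolding in_G by (rule conjunct1)
    qed
  qed
  then have "emeasure M ?l = emeasure M ?r" by (rule arg_cong)
  also have "\<dots> = emeasure M {\<omega> \<in> space M. (\<lambda>i\<in>{..<Suc k}. Z i \<omega> - ?t i) \<in> G \<and> (\<forall>i<Suc k. ?t i \<le> Z i \<omega>)}"
  proof (rule shift_eq[OF _ _ _ G])
    show "(\<Sum>i<Suc k. ?s i) = (\<Sum>i<Suc k. ?t i)" by (simp only: sum_s)
  qed (use v V in auto)
  also have "\<dots> \<le> emeasure M {\<omega> \<in> space M. ((\<lambda>i\<in>{..<k}. Z i \<omega> + v i), coord_sum \<omega>) \<in> B}"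
  proof (rule emeasure_mono)
    show "{\<omega> \<in> space M. (\<lambda>i\<in>{..<Suc k}. Z i \<omega> - ?t i) \<in> G \<and> (\<forall>i<Suc k. ?t i \<le> Z i \<omega>)} \<subseteq>
      {\<omega> \<in> space M. ((\<lambda>i\<in>{..<k}. Z i \<omega> + v i), coord_sum \<omega>) \<in> B}"
      unfolding G_def using gt by auto
    have "(\<lambda>\<omega>. ((\<lambda>i\<in>{..<k}. Z i \<omega> + v i), coord_sum \<omega>)) \<in> M \<rightarrow>\<^sub>M L \<Otimes>\<^sub>M borel"
      by (intro measurable_Pair measurable_restrict coord_sum_measurable) (auto intro!: borel_measurable_add Z_meas)
    from measurable_sets[OF this B]
    show "{\<omega> \<in> space M. ((\<lambda>i\<in>{..<k}. Z i \<omega> + v i), coord_sum \<omega>) \<in> B} \<in> sets M"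
      by (simp add: vimage_def Int_def conj_commute)
  qed
  finally show ?thesis .
qed

text \<open>Averaging \<open>shift_bound\<close> over v in the box [0, \<open>\<delta>\<close>]^k
  bounds P(A) \<open>\<delta>\<close>^k by the integral over all v of P((Z + v, S) in B). By Fubini
  and translation invariance this equals the expected Lebesgue measure of the S-section of B, which
  is 0. Letting \<open>\<delta>\<close> run through 1/(n+1) exhausts the space because all Z_i are
  positive almost surely.\<close>

lemma head_sum_null:
  assumes B: "B \<in> sets (L \<Otimes>\<^sub>M borel)"
    and null: "AE s in distr M borel coord_sum. emeasure L {y \<in> space L. (y, s) \<in> B} = 0"
  shows "AE \<omega> in M. (head_coords \<omega>, coord_sum \<omega>) \<notin> B"
proof -
  interpret L: product_sigma_finite "\<lambda>_::nat. lborel :: real measure" ..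
  interpret L: finite_product_sigma_finite "\<lambda>_::nat. lborel :: real measure" "{..<k}" by standard simp
  interpret pair: pair_sigma_finite M L ..
  let ?A = "\<lambda>\<delta>. {\<omega> \<in> space M. (head_coords \<omega>, coord_sum \<omega>) \<in> B \<and> (\<forall>i<k. \<delta> \<le> Z i \<omega>)}"
  have A: "?A \<delta> \<in> sets M" for \<delta>
  proof -
    have "(\<lambda>\<omega>. (head_coords \<omega>, coord_sum \<omega>)) \<in> M \<rightarrow>\<^sub>M L \<Otimes>\<^sub>M borel"
      by (intro measurable_Pair head_measurable coord_sum_measurable)
    from measurable_sets[OF this B] have "{\<omega> \<in> space M. (head_coords \<omega>, coord_sum \<omega>) \<in> B} \<in> sets M"
      by (simp add: vimage_def Int_def conj_commute)
    moreover have "{\<omega> \<in> space M. \<forall>i<Suc k. (if i < k then \<delta> else 0) \<le> Z i \<omega>} \<in> sets M" by (rule Z_Collect_sets)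
    ultimately have "{\<omega> \<in> space M. (head_coords \<omega>, coord_sum \<omega>) \<in> B} \<inter>
      {\<omega> \<in> space M. \<forall>i<Suc k. (if i < k then \<delta> else 0) \<le> Z i \<omega>} \<in> sets M" by (rule sets.Int)
    moreover have "{\<omega> \<in> space M. (head_coords \<omega>, coord_sum \<omega>) \<in> B} \<inter>
      {\<omega> \<in> space M. \<forall>i<Suc k. (if i < k then \<delta> else 0) \<le> Z i \<omega>} = ?A \<delta>"
      using Z_nonneg by (auto simp: less_Suc_eq)
    ultimately show ?thesis by (simp only:)
  qed
  define h where "h = (\<lambda>(\<omega>, v). ((\<lambda>i\<in>{..<k}. Z i \<omega> + v i), coord_sum \<omega>))"
  have h: "h \<in> M \<Otimes>\<^sub>M L \<rightarrow>\<^sub>M L \<Otimes>\<^sub>M borel"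
    unfolding h_def case_prod_beta
  proof (intro measurable_Pair measurable_restrict)
    show "(\<lambda>x. coord_sum (fst x)) \<in> borel_measurable (M \<Otimes>\<^sub>M L)"
      by (rule measurable_compose[OF measurable_fst coord_sum_measurable])
    fix i assume i: "i \<in> {..<k}"
    have "(\<lambda>x. Z i (fst x)) \<in> borel_measurable (M \<Otimes>\<^sub>M L)"
      using i by (intro measurable_compose[OF measurable_fst Z_meas]) simp
    moreover have "(\<lambda>x. snd x i) \<in> borel_measurable (M \<Otimes>\<^sub>M L)"
      using i by (intro measurable_compose[OF measurable_snd]) simp
    ultimately show "(\<lambda>x. Z i (fst x) + snd x i) \<in> (M \<Otimes>\<^sub>M L) \<rightarrow>\<^sub>M lborel" by simp
  qed
  define H where "H = h -` B \<inter> space (M \<Otimes>\<^sub>M L)"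
  have H: "H \<in> sets (M \<Otimes>\<^sub>M L)" unfolding H_def by (rule measurable_sets[OF h B])
  \<comment> \<open>The section at a fixed outcome is a translate, by the head, of the section of B
    at the value of the sum.\<close>
  have sect: "emeasure L (Pair \<omega> -` H) = emeasure L {y \<in> space L. (y, coord_sum \<omega>) \<in> B}" if \<omega>: "\<omega> \<in> space M" for \<omega>
  proof -
    let ?T = "\<lambda>v. \<lambda>i\<in>{..<k}. Z i \<omega> + v i"
    have T: "?T \<in> L \<rightarrow>\<^sub>M L" by (intro measurable_restrict) simp
    have Bs: "{y \<in> space L. (y, coord_sum \<omega>) \<in> B} \<in> sets L"
    proof -
      have "(\<lambda>y. (y, coord_sum \<omega>)) \<in> L \<rightarrow>\<^sub>M L \<Otimes>\<^sub>M borel" by simp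
      from measurable_sets[OF this B] show ?thesis by (simp add: vimage_def Int_def conj_commute)
    qed
    have "emeasure L {y \<in> space L. (y, coord_sum \<omega>) \<in> B} = emeasure (distr L L ?T) {y \<in> space L. (y, coord_sum \<omega>) \<in> B}"
      by (simp only: PiM_lborel_translation[OF finite_lessThan])
    also have "\<dots> = emeasure L (?T -` {y \<in> space L. (y, coord_sum \<omega>) \<in> B} \<inter> space L)"
      by (rule emeasure_distr[OF T Bs])
    also have "?T -` {y \<in> space L. (y, coord_sum \<omega>) \<in> B} \<inter> space L = Pair \<omega> -` H"
      using \<omega> measurable_space[OF T] by (auto simp: H_def h_def space_pair_measure)
    finally show ?thesis by (rule sym)
  qed
  have "emeasure (M \<Otimes>\<^sub>M L) H = (\<integral>\<^sup>+\<omega>. emeasure L (Pair \<omega> -` H) \<partial>M)"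
    by (rule L.emeasure_pair_measure_alt[OF H])
  also have "\<dots> = (\<integral>\<^sup>+\<omega>. emeasure L {y \<in> space L. (y, coord_sum \<omega>) \<in> B} \<partial>M)"
    by (rule nn_integral_cong) (rule sect)
  also have "\<dots> = (\<integral>\<^sup>+\<omega>. 0 \<partial>M)"
  proof (rule nn_integral_cong_AE)
    show "AE \<omega> in M. emeasure L {y \<in> space L. (y, coord_sum \<omega>) \<in> B} = 0"
      by (rule AE_distrD[OF coord_sum_measurable null])
  qed
  finally have H0: "emeasure (M \<Otimes>\<^sub>M L) H = 0" by simp
  have A0: "AE \<omega> in M. \<omega> \<notin> ?A \<delta>" if \<delta>: "0 < \<delta>" for \<delta>
  proof -
    define box where "box = ({..<k} \<rightarrow>\<^sub>E {0..\<delta>})"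
    have box: "box \<in> sets L" unfolding box_def by (intro sets_PiM_I_finite) auto
    have "emeasure L box = (\<Prod>i<k. emeasure lborel {0..\<delta>})"
      unfolding box_def by (intro L.emeasure_PiM) auto
    also have "\<dots> = ennreal (\<delta> ^ k)" using \<delta> by (simp add: ennreal_power)
    finally have box_pos: "emeasure L box \<noteq> 0" using \<delta> by simp
    have "emeasure M (?A \<delta>) * emeasure L box = (\<integral>\<^sup>+v\<in>box. emeasure M (?A \<delta>) \<partial>L)"
      using box by (simp add: nn_integral_cmult_indicator)
    also have "\<dots> \<le> (\<integral>\<^sup>+v. emeasure M ((\<lambda>\<omega>. (\<omega>, v)) -` H) \<partial>L)"
    proof (rule nn_integral_mono)
      fix v assume v: "v \<in> space L"
      show "emeasure M (?A \<delta>) * indicator box v \<le> emeasure M ((\<lambda>\<omega>. (\<omega>, v)) -` H)"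
      proof (cases "v \<in> box")
        case True
        have "(\<lambda>\<omega>. (\<omega>, v)) -` H = {\<omega> \<in> space M. ((\<lambda>i\<in>{..<k}. Z i \<omega> + v i), coord_sum \<omega>) \<in> B}"
          using v by (auto simp: H_def h_def space_pair_measure)
        moreover have "emeasure M (?A \<delta>) \<le> emeasure M {\<omega> \<in> space M. ((\<lambda>i\<in>{..<k}. Z i \<omega> + v i), coord_sum \<omega>) \<in> B}"
          using True by (intro shift_bound[OF B]) (auto simp: box_def PiE_iff)
        ultimately show ?thesis using True by simp
      qed simp
    qed
    also have "\<dots> = emeasure (M \<Otimes>\<^sub>M L) H" by (rule pair.emeasure_pair_measure_alt2[OF H, symmetric])
    finally have "emeasure M (?A \<delta>) = 0" using box_pos H0 by simp
    then show ?thesis using A[of \<delta>] by (intro AE_not_in) (simp add: null_sets_def)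
  qed
  have "AE \<omega> in M. \<forall>n. \<omega> \<notin> ?A (1 / real (Suc n))"
    unfolding AE_all_countable by (intro allI A0) simp
  then show ?thesis using Z_pos
  proof (rule AE_mp[OF _ AE_mp], intro AE_I2 impI notI)
    fix \<omega> assume \<omega>: "\<omega> \<in> space M" "\<forall>i<Suc k. 0 < Z i \<omega>" "\<forall>n. \<omega> \<notin> ?A (1 / real (Suc n))"
      and "(head_coords \<omega>, coord_sum \<omega>) \<in> B"
    have ev: "eventually (\<lambda>n. 1 / real (Suc n) < Z i \<omega>) sequentially" if "i < k" for i
      using \<omega> that by (intro order_tendstoD(2)[OF LIMSEQ_Suc[OF lim_1_over_n]]) auto
    have "eventually (\<lambda>n. \<forall>i\<in>{..<k}. 1 / real (Suc n) < Z i \<omega>) sequentially"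
      using ev by (intro eventually_ball_finite) auto
    then obtain n where "\<forall>i\<in>{..<k}. 1 / real (Suc n) < Z i \<omega>" by (auto simp: eventually_sequentially)
    then have "\<omega> \<in> ?A (1 / real (Suc n))"
      using \<omega>(1) \<open>(head_coords \<omega>, coord_sum \<omega>) \<in> B\<close> by (auto intro: less_imp_le)
    then show False using \<omega>(3) by blast
  qed
qed

end

section \<open>Conditional distributions\<close>

text \<open>Divide the joint density f by its marginal g. The resulting kernel is dominated by N at
  every y, not just almost everywhere, so null sets of N stay null after conditioning.\<close>

lemma kernel_of_absolutely_continuous:
  fixes L :: "'a measure" and N :: "'b measure" and Q :: "('a \<times> 'b) measure"
  assumes L: "sigma_finite_measure L" and N: "prob_space N" and Q: "prob_space Q"
    and sets_Q: "sets Q = sets (L \<Otimes>\<^sub>M N)" and ac: "absolutely_continuous (L \<Otimes>\<^sub>M N) Q"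
  obtains \<kappa> where "\<kappa> \<in> L \<rightarrow>\<^sub>M prob_algebra N"
    "\<And>y A. y \<in> space L \<Longrightarrow> A \<in> sets N \<Longrightarrow> emeasure N A = 0 \<Longrightarrow> emeasure (\<kappa> y) A = 0"
    "\<And>B. B \<in> sets (L \<Otimes>\<^sub>M N) \<Longrightarrow> emeasure Q B = (\<integral>\<^sup>+y. emeasure (\<kappa> y) (Pair y -` B) \<partial>distr Q L fst)"
proof -
  interpret L: sigma_finite_measure L by fact
  interpret N: prob_space N by fact
  interpret Q: prob_space Q by fact
  interpret pair_sigma_finite L N ..
  define f where "f = RN_deriv (L \<Otimes>\<^sub>M N) Q"
  have f [measurable]: "f \<in> borel_measurable (L \<Otimes>\<^sub>M N)" by (simp add: f_def)
  have dens: "density (L \<Otimes>\<^sub>M N) f = Q"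
    unfolding f_def by (rule density_RN_deriv[OF ac sets_Q])
  have Q_eq: "emeasure Q B = (\<integral>\<^sup>+y. \<integral>\<^sup>+s. f (y, s) * indicator B (y, s) \<partial>N \<partial>L)"
    if B [measurable]: "B \<in> sets (L \<Otimes>\<^sub>M N)" for B
  proof -
    have "emeasure Q B = (\<integral>\<^sup>+z. f z * indicator B z \<partial>(L \<Otimes>\<^sub>M N))"
      by (subst dens[symmetric], subst emeasure_density) auto
    also have "\<dots> = (\<integral>\<^sup>+y. \<integral>\<^sup>+s. f (y, s) * indicator B (y, s) \<partial>N \<partial>L)"
      by (subst N.nn_integral_fst[symmetric]) auto
    finally show ?thesis .
  qed
  define g where "g y = (\<integral>\<^sup>+s. f (y, s) \<partial>N)" for y
  have g [measurable]: "g \<in> borel_measurable L" unfolding g_def by measurable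
  have "(\<integral>\<^sup>+y. g y \<partial>L) = emeasure Q (space (L \<Otimes>\<^sub>M N))"
    unfolding g_def by (subst Q_eq) (auto intro!: nn_integral_cong simp: space_pair_measure)
  also have "\<dots> = 1" using Q.emeasure_space_1 sets_eq_imp_space_eq[OF sets_Q] by simp
  finally have "AE y in L. g y \<noteq> \<infinity>" by (intro nn_integral_PInf_AE) auto
  \<comment> \<open>Where g is 0 or infinite, N itself keeps the kernel a probability measure
    dominated by N. Points with g = 0 contribute nothing to Q, and g is almost everywhere finite
    because its integral is 1.\<close>
  define \<kappa> where "\<kappa> y = (if g y \<noteq> 0 \<and> g y \<noteq> \<infinity> then density N (\<lambda>s. f (y, s) / g y) else N)" for y
  have f_sect: "(\<lambda>s. f (y, s)) \<in> borel_measurable N" if "y \<in> space L" for y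
    using that by measurable
  have \<kappa>_eq: "emeasure (\<kappa> y) A =
      (if g y \<noteq> 0 \<and> g y \<noteq> \<infinity> then (\<integral>\<^sup>+s. f (y, s) * indicator A s \<partial>N) / g y else emeasure N A)"
    if y: "y \<in> space L" and A: "A \<in> sets N" for y A
  proof (cases "g y \<noteq> 0 \<and> g y \<noteq> \<infinity>")
    case True
    have "emeasure (\<kappa> y) A = (\<integral>\<^sup>+s. f (y, s) / g y * indicator A s \<partial>N)"
      using True f_sect[OF y] A by (simp add: \<kappa>_def emeasure_density)
    also have "\<dots> = (\<integral>\<^sup>+s. f (y, s) * indicator A s / g y \<partial>N)"
      by (intro nn_integral_cong) (simp add: indicator_def)
    also have "\<dots> = (\<integral>\<^sup>+s. f (y, s) * indicator A s \<partial>N) / g y"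
      using f_sect[OF y] A by (intro nn_integral_divide) auto
    finally show ?thesis using True by simp
  qed (auto simp: \<kappa>_def)
  have sets_\<kappa>: "sets (\<kappa> y) = sets N" for y by (simp add: \<kappa>_def)
  have \<kappa>_prob: "prob_space (\<kappa> y)" if y: "y \<in> space L" for y
  proof
    have "space (\<kappa> y) = space N" by (rule sets_eq_imp_space_eq[OF sets_\<kappa>])
    then have "emeasure (\<kappa> y) (space (\<kappa> y)) =
        (if g y \<noteq> 0 \<and> g y \<noteq> \<infinity> then (\<integral>\<^sup>+s. f (y, s) * indicator (space N) s \<partial>N) / g y else emeasure N (space N))"
      using \<kappa>_eq[OF y sets.top] by simp
    also have "(\<integral>\<^sup>+s. f (y, s) * indicator (space N) s \<partial>N) = g y"
      unfolding g_def by (intro nn_integral_cong) auto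
    finally show "emeasure (\<kappa> y) (space (\<kappa> y)) = 1"
      by (simp add: N.emeasure_space_1 ennreal_divide_self top.not_eq_extremum split: if_splits)
  qed
  have \<kappa>_meas: "\<kappa> \<in> L \<rightarrow>\<^sub>M prob_algebra N"
  proof (intro measurable_prob_algebraI measurable_subprob_algebra \<kappa>_prob sets_\<kappa>)
    fix y assume "y \<in> space L"
    then show "subprob_space (\<kappa> y)" by (intro prob_space_imp_subprob_space \<kappa>_prob)
  next
    fix A assume A [measurable]: "A \<in> sets N"
    have "(\<lambda>y. if g y \<noteq> 0 \<and> g y \<noteq> \<infinity> then (\<integral>\<^sup>+s. f (y, s) * indicator A s \<partial>N) / g y else emeasure N A) \<in> borel_measurable L"
      by measurable
    then show "(\<lambda>y. emeasure (\<kappa> y) A) \<in> borel_measurable L"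
      by (rule measurable_cong[THEN iffD1, rotated]) (simp add: \<kappa>_eq[OF _ A])
  qed
  have marg: "distr Q L fst = density L g"
  proof (rule measure_eqI)
    fix A assume "A \<in> sets (distr Q L fst)"
    then have A [measurable]: "A \<in> sets L" by simp
    have fst: "fst \<in> Q \<rightarrow>\<^sub>M L" by (simp add: measurable_cong_sets[OF sets_Q refl])
    have "emeasure (distr Q L fst) A = emeasure Q (fst -` A \<inter> space Q)"
      by (rule emeasure_distr[OF fst A])
    also have "fst -` A \<inter> space Q = A \<times> space N"
      using sets_eq_imp_space_eq[OF sets_Q] sets.sets_into_space[OF A] by (auto simp: space_pair_measure)
    also have "emeasure Q \<dots> = (\<integral>\<^sup>+y. \<integral>\<^sup>+s. f (y, s) * indicator (A \<times> space N) (y, s) \<partial>N \<partial>L)"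
      by (rule Q_eq) simp
    also have "\<dots> = (\<integral>\<^sup>+y. g y * indicator A y \<partial>L)"
      unfolding g_def by (intro nn_integral_cong, simp add: indicator_def)
        (intro conjI impI nn_integral_cong; simp)
    also have "\<dots> = emeasure (density L g) A" by (subst emeasure_density) auto
    finally show "emeasure (distr Q L fst) A = emeasure (density L g) A" .
  qed simp
  show ?thesis
  proof (rule that[OF \<kappa>_meas])
    fix y A assume y: "y \<in> space L" and A: "A \<in> sets N" "emeasure N A = 0"
    have "AE s in N. s \<notin> A" using A by (intro AE_not_in) (auto simp: null_sets_def)
    then have "(\<integral>\<^sup>+s. f (y, s) * indicator A s \<partial>N) = (\<integral>\<^sup>+s. 0 \<partial>N)"
      by (intro nn_integral_cong_AE) (auto elim: AE_mp)
    then show "emeasure (\<kappa> y) A = 0" using A by (simp add: \<kappa>_eq[OF y A(1)])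
  next
    fix B assume B [measurable]: "B \<in> sets (L \<Otimes>\<^sub>M N)"
    have sect: "Pair y -` B \<in> sets N" for y by (rule sets_Pair1[OF B])
    have [measurable]: "(\<lambda>y. emeasure (\<kappa> y) (Pair y -` B)) \<in> borel_measurable L"
    proof (rule emeasure_measurable_subprob_algebra2[OF _ measurable_prob_algebraD[OF \<kappa>_meas]])
      have "Sigma (space L) (\<lambda>y. Pair y -` B) = B"
        using sets.sets_into_space[OF B] by (auto simp: space_pair_measure)
      then show "Sigma (space L) (\<lambda>y. Pair y -` B) \<in> sets (L \<Otimes>\<^sub>M N)" using B by simp
    qed
    have "emeasure Q B = (\<integral>\<^sup>+y. \<integral>\<^sup>+s. f (y, s) * indicator (Pair y -` B) s \<partial>N \<partial>L)"
      unfolding Q_eq[OF B] by (intro nn_integral_cong) (simp add: indicator_def)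
    also have "\<dots> = (\<integral>\<^sup>+y. g y * emeasure (\<kappa> y) (Pair y -` B) \<partial>L)"
    proof (rule nn_integral_cong_AE, rule AE_mp[OF \<open>AE y in L. g y \<noteq> \<infinity>\<close>], rule AE_I2, rule impI)
      fix y assume y: "y \<in> space L" "g y \<noteq> \<infinity>"
      show "(\<integral>\<^sup>+s. f (y, s) * indicator (Pair y -` B) s \<partial>N) = g y * emeasure (\<kappa> y) (Pair y -` B)"
      proof (cases "g y = 0")
        case True
        have "(\<integral>\<^sup>+s. f (y, s) * indicator (Pair y -` B) s \<partial>N) \<le> g y"
          unfolding g_def by (intro nn_integral_mono) (simp add: indicator_def)
        then show ?thesis using True by simp
      next
        case False
        then show ?thesis using y
          by (simp add: \<kappa>_eq[OF y(1) sect] ennreal_times_divide mult.commute[of "g y"] ennreal_mult_divide_eq mult_divide_eq_ennreal)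
      qed
    qed
    also have "\<dots> = (\<integral>\<^sup>+y. emeasure (\<kappa> y) (Pair y -` B) \<partial>distr Q L fst)"
      unfolding marg by (subst nn_integral_density) auto
    finally show "emeasure Q B = (\<integral>\<^sup>+y. emeasure (\<kappa> y) (Pair y -` B) \<partial>distr Q L fst)" .
  qed
qed


section \<open>Transfer to the coordinates of the copula\<close>

lemma (in arch_law) simplex_survival:
  assumes d: "d = Suc k"
  shows "simplex_survival \<mu> k (\<lambda>i x. real_inv \<psi> (x i)) \<psi>"
proof
  show "(\<lambda>x. real_inv \<psi> (x i)) \<in> borel_measurable \<mu>" if "i < Suc k" for i
    using real_inv_nth_measurable[OF gen, of i d] that by (simp add: d measurable_cong_sets[OF sets_mu refl])
  show "0 \<le> real_inv \<psi> (x i)" for i x by simp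
  have "AE x in \<mu>. \<forall>i\<in>{..<d}. x i \<noteq> 1"
    using AE_margin_neq by (subst AE_ball_countable) auto
  then show "AE x in \<mu>. \<forall>i<Suc k. 0 < real_inv \<psi> (x i)"
    using AE_pos
  proof (rule AE_mp[OF _ AE_mp], intro AE_I2 impI allI)
    fix x i assume x: "x \<in> space \<mu>" "\<forall>i<d. 0 < x i" "\<forall>i\<in>{..<d}. x i \<noteq> 1" and i: "i < Suc k"
    have "real_inv \<psi> (x i) \<noteq> 0"
    proof
      assume "real_inv \<psi> (x i) = 0"
      then have "\<psi> 0 = x i" using gen_real_inv[OF gen, of "x i"] x i d by (auto simp: space_mu icube_iff)
      then show False using gen x i d by (auto simp: generator_def)
    qed
    then show "0 < real_inv \<psi> (x i)" using real_inv_nonneg[of \<psi> "x i"] by linarith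
  qed
  show "measure \<mu> {x \<in> space \<mu>. \<forall>i<Suc k. a i \<le> real_inv \<psi> (x i)} = \<psi> (\<Sum>i<Suc k. a i)"
    if "\<And>i. i < Suc k \<Longrightarrow> 0 \<le> a i" for a
    using survival[of a] that by (simp add: d[symmetric] space_mu del: sum.lessThan_Suc)
qed

lemma restrict_icube_measurable: "(\<lambda>x. restrict x {..<k}) \<in> icube_borel (Suc k) \<rightarrow>\<^sub>M icube_borel k"
  unfolding icube_borel_def by (rule measurable_restrict_subset) auto

lemma (in copula_law) marginal_has_df:
  assumes d: "d = Suc k"
  shows "has_df k (distr \<mu> (icube_borel k) (\<lambda>x. restrict x {..<k})) (marginal d C)"
proof -
  have r: "(\<lambda>x. restrict x {..<k}) \<in> \<mu> \<rightarrow>\<^sub>M icube_borel k"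
    using restrict_icube_measurable by (simp add: d measurable_cong_sets[OF sets_mu refl])
  show ?thesis
    unfolding has_df_def
  proof (intro conjI ballI)
    show "prob_space (distr \<mu> (icube_borel k) (\<lambda>x. restrict x {..<k}))" by (rule prob_space_distr[OF r])
    show "sets (distr \<mu> (icube_borel k) (\<lambda>x. restrict x {..<k})) = sets (icube_borel k)" by simp
    fix x assume x: "x \<in> icube k"
    let ?B = "{y \<in> icube k. \<forall>i<k. y i \<le> x i}"
    have B: "?B \<in> sets (icube_borel k)" unfolding sets_icube_borel using x by blast
    have x1: "x(k := 1) \<in> icube d" using x by (auto simp: icube_iff d extensional_def)
    have "(\<lambda>x. restrict x {..<k}) -` ?B \<inter> space \<mu> = {y \<in> icube d. \<forall>i<d. y i \<le> (x(k := 1)) i}"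
      by (auto simp: space_mu icube_iff d less_Suc_eq)
    then have "measure (distr \<mu> (icube_borel k) (\<lambda>x. restrict x {..<k})) ?B = C (x(k := 1))"
      unfolding measure_distr[OF r B] C_eq[OF x1] by (rule arg_cong)
    then show "measure (distr \<mu> (icube_borel k) (\<lambda>x. restrict x {..<k})) ?B = marginal d C x"
      using x by (simp add: marginal_def d)
  qed
qed

text \<open>Given the head y, the last coordinate is a function of the sum, namely
  \<open>\<psi>\<close> of S minus the sum of y. Pushing the kernel of S given the head forward
  under this map yields a kernel for X. An interior value t comes from a single value of S, which
  has conditional mass 0 because S has no atoms.\<close>

lemma (in arch_law) cond_kernel_exists:
  assumes d: "d = Suc k" and lev: "\<And>t. measure \<mu> {x \<in> icube d. arch_fun d \<psi> x = t} = 0"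
  obtains K where "cond_kernel d (arch_fun d \<psi>) K"
    "AE x in copula_measure k (marginal d (arch_fun d \<psi>)). \<forall>t\<in>{0..1}. emeasure (K x) {t} = 0"
proof -
  interpret S: simplex_survival \<mu> k "\<lambda>i x. real_inv \<psi> (x i)" \<psi>
    by (rule simplex_survival[OF d])
  interpret LP: product_sigma_finite "\<lambda>_::nat. lborel :: real measure" ..
  interpret LP: finite_product_sigma_finite "\<lambda>_::nat. lborel :: real measure" "{..<k}" by standard simp
  define L where "L = Pi\<^sub>M {..<k} (\<lambda>_. lborel :: real measure)"
  define N where "N = distr \<mu> borel S.coord_sum"
  define T where "T x = (S.head_coords x, S.coord_sum x)" for x
  define Q where "Q = distr \<mu> (L \<Otimes>\<^sub>M borel) T"
  have sets_N: "sets N = sets borel" by (simp add: N_def)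
  have head: "S.head_coords \<in> \<mu> \<rightarrow>\<^sub>M L" unfolding L_def by (rule S.head_measurable)
  have T: "T \<in> \<mu> \<rightarrow>\<^sub>M L \<Otimes>\<^sub>M borel"
    unfolding T_def by (intro measurable_Pair head S.coord_sum_measurable)
  have sets_LN: "sets (L \<Otimes>\<^sub>M N) = sets (L \<Otimes>\<^sub>M borel)" by (rule sets_pair_measure_cong[OF refl sets_N])
  interpret N: prob_space N unfolding N_def by (rule prob_space_distr[OF S.coord_sum_measurable])
  interpret L: sigma_finite_measure L unfolding L_def by (rule LP.sigma_finite_measure_axioms)
  interpret LN: pair_sigma_finite L N ..
  have ac: "absolutely_continuous (L \<Otimes>\<^sub>M N) Q"
    unfolding absolutely_continuous_def
  proof
    fix B assume "B \<in> null_sets (L \<Otimes>\<^sub>M N)"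
    then have B: "B \<in> sets (L \<Otimes>\<^sub>M N)" "emeasure (L \<Otimes>\<^sub>M N) B = 0" by (auto simp: null_sets_def)
    then have B': "B \<in> sets (L \<Otimes>\<^sub>M borel)" by (simp only: sets_LN)
    have sect: "(\<lambda>y. (y, s)) -` B = {y \<in> space L. (y, s) \<in> B}" for s
      using sets.sets_into_space[OF B'] by (auto simp: space_pair_measure)
    have "(\<integral>\<^sup>+s. emeasure L ((\<lambda>y. (y, s)) -` B) \<partial>N) = 0"
      using LN.emeasure_pair_measure_alt2[OF B(1)] B(2) by simp
    then have "AE s in N. emeasure L {y \<in> space L. (y, s) \<in> B} = 0"
      using LN.measurable_emeasure_Pair2[OF B(1)] by (subst (asm) nn_integral_0_iff_AE) (simp_all add: sect)
    then have "AE x in \<mu>. T x \<notin> B"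
      unfolding T_def N_def L_def by (intro S.head_sum_null B'[unfolded L_def])
    moreover have "T -` B \<inter> space \<mu> \<in> sets \<mu>" by (rule measurable_sets[OF T B'])
    ultimately have "emeasure \<mu> (T -` B \<inter> space \<mu>) = 0"
      by (subst (asm) AE_iff_measurable[of "T -` B \<inter> space \<mu>"]) auto
    then show "B \<in> null_sets Q"
      using B' emeasure_distr[OF T B'] by (simp add: null_sets_def Q_def)
  qed
  obtain \<kappa> where \<kappa>: "\<kappa> \<in> L \<rightarrow>\<^sub>M prob_algebra N"
    and \<kappa>_null: "\<And>y A. y \<in> space L \<Longrightarrow> A \<in> sets N \<Longrightarrow> emeasure N A = 0 \<Longrightarrow> emeasure (\<kappa> y) A = 0"
    and \<kappa>_eq: "\<And>B. B \<in> sets (L \<Otimes>\<^sub>M N) \<Longrightarrow> emeasure Q B = (\<integral>\<^sup>+y. emeasure (\<kappa> y) (Pair y -` B) \<partial>distr Q L fst)"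
  proof (rule kernel_of_absolutely_continuous[of L N Q])
    show "prob_space Q" unfolding Q_def by (rule prob_space_distr[OF T])
    show "sets Q = sets (L \<Otimes>\<^sub>M N)" by (simp add: Q_def sets_LN)
  qed (use ac in \<open>auto intro: L.sigma_finite_measure_axioms N.prob_space_axioms\<close>)
  have N_atomless: "emeasure N {s} = 0" for s
  proof -
    have "emeasure N {s} = emeasure \<mu> (S.coord_sum -` {s} \<inter> space \<mu>)"
      unfolding N_def by (rule emeasure_distr[OF S.coord_sum_measurable]) simp
    also have "\<dots> = 0"
    proof -
      \<comment> \<open>An atom of S at s would put its mass on the level set of the copula at
        \<open>\<psi> s\<close>.\<close>
      let ?L = "{x \<in> icube d. arch_fun d \<psi> x = \<psi> s}"
      have L: "?L \<in> sets \<mu>"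
        unfolding sets_mu space_icube_borel[symmetric]
        by (rule borel_measurable_eq[OF arch_fun_measurable[OF gen]]) simp
      have "emeasure \<mu> ?L = 0" using lev[of "\<psi> s"] by (simp add: emeasure_mu)
      then have "AE x in \<mu>. x \<notin> ?L" using L by (intro AE_not_in) (auto simp: null_sets_def)
      then have "AE x in \<mu>. x \<notin> S.coord_sum -` {s} \<inter> space \<mu>" using AE_pos
      proof (rule AE_mp[OF _ AE_mp], intro AE_I2 impI notI)
        fix x assume x: "x \<in> space \<mu>" "\<forall>i<d. 0 < x i" "x \<notin> ?L" "x \<in> S.coord_sum -` {s} \<inter> space \<mu>"
        then have "arch_fun d \<psi> x = \<psi> s"
          using arch_fun_pos[OF gen, of x d] by (simp add: space_mu S.coord_sum_def d del: sum.lessThan_Suc)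
        then show False using x by (simp add: space_mu)
      qed
      then show ?thesis
        using measurable_sets[OF S.coord_sum_measurable, of "{s}"]
        by (subst (asm) AE_iff_measurable[of "S.coord_sum -` {s} \<inter> space \<mu>"]) auto
    qed
    finally show ?thesis .
  qed
  define \<psi>c where "\<psi>c z = \<psi> (max 0 z)" for z
  have \<psi>c: "\<psi>c \<in> borel \<rightarrow>\<^sub>M unit_borel"
    unfolding unit_borel_def \<psi>c_def using generator_range[OF gen]
    by (intro measurable_restrict_space2 gen_clamp_measurable[OF gen]) auto
  define Y where "Y x = (\<lambda>i\<in>{..<k}. real_inv \<psi> (x i))" for x
  have Y: "Y \<in> icube_borel k \<rightarrow>\<^sub>M L"
    unfolding Y_def L_def by (intro measurable_restrict) (simp add: real_inv_nth_measurable[OF gen])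
  \<comment> \<open>The clamp inside \<open>\<psi>c\<close> makes this total: pairs with s below the
    sum of y, which the pair (head, S) never attains, are sent to 1.\<close>
  define r where "r y s = \<psi>c (s - (\<Sum>i<k. y i))" for y :: "nat \<Rightarrow> real" and s
  have nth_L: "(\<lambda>y. y i) \<in> borel_measurable L" if "i < k" for i
  proof -
    have "(\<lambda>y. y i) \<in> L \<rightarrow>\<^sub>M lborel" unfolding L_def using that by (intro measurable_component_singleton) simp
    then show ?thesis by simp
  qed
  have r: "(\<lambda>(y, s). r y s) \<in> L \<Otimes>\<^sub>M borel \<rightarrow>\<^sub>M unit_borel"
    unfolding r_def case_prod_beta
    by (intro measurable_compose[OF _ \<psi>c] borel_measurable_diff borel_measurable_sum
      measurable_compose[OF measurable_fst nth_L]) auto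
  have rN: "(\<lambda>(y, s). r y s) \<in> L \<Otimes>\<^sub>M N \<rightarrow>\<^sub>M unit_borel"
    using r by (simp only: measurable_cong_sets[OF sets_LN refl])
  define K0 where "K0 y = distr (\<kappa> y) unit_borel (r y)" for y
  have K0: "K0 \<in> L \<rightarrow>\<^sub>M prob_algebra unit_borel"
    unfolding K0_def by (rule measurable_distr_prob_space2[OF \<kappa> rN])
  have sets_\<kappa>: "sets (\<kappa> y) = sets N" if "y \<in> space L" for y
    using subprob_measurableD(2)[OF measurable_prob_algebraD[OF \<kappa>] that] .
  have K0_eq: "emeasure (K0 y) F = emeasure (\<kappa> y) {s. r y s \<in> F}"
    if y: "y \<in> space L" and F: "F \<in> sets unit_borel" for y F
  proof -
    have "r y \<in> N \<rightarrow>\<^sub>M unit_borel" using measurable_compose[OF measurable_Pair1'[OF y] rN] by simp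
    then have ry: "r y \<in> \<kappa> y \<rightarrow>\<^sub>M unit_borel" by (simp only: measurable_cong_sets[OF sets_\<kappa>[OF y] refl])
    have "space (\<kappa> y) = UNIV" using sets_eq_imp_space_eq[OF sets_\<kappa>[OF y]] sets_eq_imp_space_eq[OF sets_N] by simp
    then show ?thesis unfolding K0_def emeasure_distr[OF ry F] by (simp add: vimage_def)
  qed
  define K where "K x = K0 (Y x)" for x
  have K: "K \<in> icube_borel k \<rightarrow>\<^sub>M prob_algebra unit_borel"
    unfolding K_def by (rule measurable_compose[OF Y K0])
  define m where "m = copula_measure k (marginal d (arch_fun d \<psi>))"
  have m: "m = distr \<mu> (icube_borel k) (\<lambda>x. restrict x {..<k})"
    unfolding m_def by (rule copula_measure_eq[OF marginal_has_df[OF d]])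
  have restr: "(\<lambda>x. restrict x {..<k}) \<in> \<mu> \<rightarrow>\<^sub>M icube_borel k"
    using restrict_icube_measurable by (simp add: d measurable_cong_sets[OF sets_mu refl])
  have cond: "emeasure \<mu> {y \<in> icube d. restrict y {..<k} \<in> E \<and> y k \<in> F} = (\<integral>\<^sup>+x\<in>E. emeasure (K x) F \<partial>m)"
    if E: "E \<in> sets (icube_borel k)" and F: "F \<in> sets unit_borel" for E F
  proof -
    \<comment> \<open>Undoes the passage from X to Z on the first k coordinates, so that membership
      in E can be expressed through the head alone.\<close>
    define c where "c y = (\<lambda>i\<in>{..<k}. \<psi>c (y i))" for y :: "nat \<Rightarrow> real"
    have c: "c \<in> L \<rightarrow>\<^sub>M icube_borel k"
      unfolding c_def icube_borel_def by (intro measurable_restrict measurable_compose[OF nth_L \<psi>c]) simp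
    define B where "B = {z \<in> space (L \<Otimes>\<^sub>M borel). c (fst z) \<in> E \<and> r (fst z) (snd z) \<in> F}"
    have B: "B \<in> sets (L \<Otimes>\<^sub>M borel)"
    proof -
      have "(\<lambda>z. c (fst z)) -` E \<inter> space (L \<Otimes>\<^sub>M borel) \<in> sets (L \<Otimes>\<^sub>M (borel :: real measure))"
        by (rule measurable_sets[OF measurable_compose[OF measurable_fst c] E])
      moreover have "(\<lambda>(y, s). r y s) -` F \<inter> space (L \<Otimes>\<^sub>M borel) \<in> sets (L \<Otimes>\<^sub>M borel)"
        by (rule measurable_sets[OF r F])
      ultimately have "((\<lambda>z. c (fst z)) -` E \<inter> space (L \<Otimes>\<^sub>M borel)) \<inter> ((\<lambda>(y, s). r y s) -` F \<inter> space (L \<Otimes>\<^sub>M borel)) \<in> sets (L \<Otimes>\<^sub>M borel)"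
        by (rule sets.Int)
      moreover have "((\<lambda>z. c (fst z)) -` E \<inter> space (L \<Otimes>\<^sub>M borel)) \<inter> ((\<lambda>(y, s). r y s) -` F \<inter> space (L \<Otimes>\<^sub>M borel)) = B"
        unfolding B_def by auto
      ultimately show ?thesis by (simp only:)
    qed
    \<comment> \<open>These inversions hold off the null set where some coordinate is 0, which is
      why the identities below are argued almost everywhere.\<close>
    have inv: "c (S.head_coords x) = restrict x {..<k}" "r (S.head_coords x) (S.coord_sum x) = x k"
      "Y (restrict x {..<k}) = S.head_coords x"
      if x: "x \<in> icube d" "\<forall>i<d. 0 < x i" for x
    proof -
      have inv: "\<psi>c (real_inv \<psi> (x i)) = x i" if "i < d" for i
        using x that by (auto simp: \<psi>c_def icube_iff intro!: gen_real_inv[OF gen])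
      show "c (S.head_coords x) = restrict x {..<k}"
        using inv d by (auto simp: c_def S.head_coords_def)
      have "S.coord_sum x - (\<Sum>i<k. S.head_coords x i) = real_inv \<psi> (x k)"
        by (simp add: S.coord_sum_def S.head_coords_def)
      then show "r (S.head_coords x) (S.coord_sum x) = x k" using inv[of k] d by (simp add: r_def)
      show "Y (restrict x {..<k}) = S.head_coords x" by (auto simp: Y_def S.head_coords_def)
    qed
    have "emeasure \<mu> {y \<in> icube d. restrict y {..<k} \<in> E \<and> y k \<in> F} = emeasure \<mu> (T -` B \<inter> space \<mu>)"
    proof (rule emeasure_eq_AE)
      have "{y \<in> icube d. restrict y {..<k} \<in> E \<and> y k \<in> F} =
        ((\<lambda>x. restrict x {..<k}) -` E \<inter> space \<mu>) \<inter> ((\<lambda>x. x k) -` F \<inter> space \<mu>)"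
        by (auto simp: space_mu)
      moreover have nth: "(\<lambda>x. x k) \<in> \<mu> \<rightarrow>\<^sub>M unit_borel"
        using measurable_icube_nth[of k d] by (simp add: d measurable_cong_sets[OF sets_mu refl])
      ultimately show "{y \<in> icube d. restrict y {..<k} \<in> E \<and> y k \<in> F} \<in> sets \<mu>"
        using sets.Int[OF measurable_sets[OF restr E] measurable_sets[OF nth F]] by (simp only:)
      show "T -` B \<inter> space \<mu> \<in> sets \<mu>" by (rule measurable_sets[OF T B])
      show "AE x in \<mu>. (x \<in> {y \<in> icube d. restrict y {..<k} \<in> E \<and> y k \<in> F}) = (x \<in> T -` B \<inter> space \<mu>)"
      proof (rule AE_mp[OF AE_pos], intro AE_I2 impI)
        fix x assume x: "x \<in> space \<mu>" "\<forall>i<d. 0 < x i"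
        have "T x \<in> space (L \<Otimes>\<^sub>M borel)" by (rule measurable_space[OF T x(1)])
        then show "(x \<in> {y \<in> icube d. restrict y {..<k} \<in> E \<and> y k \<in> F}) = (x \<in> T -` B \<inter> space \<mu>)"
          using x inv[of x] by (simp add: space_mu B_def T_def)
      qed
    qed
    also have "\<dots> = emeasure Q B" unfolding Q_def by (rule emeasure_distr[OF T B, symmetric])
    also have "\<dots> = (\<integral>\<^sup>+y. emeasure (\<kappa> y) (Pair y -` B) \<partial>distr Q L fst)"
      using B by (intro \<kappa>_eq) (simp only: sets_LN)
    also have "distr Q L fst = distr \<mu> L S.head_coords"
      unfolding Q_def by (subst distr_distr[OF measurable_fst T]) (simp add: T_def comp_def)
    also have "(\<integral>\<^sup>+y. emeasure (\<kappa> y) (Pair y -` B) \<partial>distr \<mu> L S.head_coords) =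
        (\<integral>\<^sup>+y. emeasure (K0 y) F * indicator E (c y) \<partial>distr \<mu> L S.head_coords)"
    proof (rule nn_integral_cong)
      fix y assume "y \<in> space (distr \<mu> L S.head_coords)"
      then have y: "y \<in> space L" by simp
      have "Pair y -` B = (if c y \<in> E then {s. r y s \<in> F} else {})"
        using y by (auto simp: B_def space_pair_measure)
      then show "emeasure (\<kappa> y) (Pair y -` B) = emeasure (K0 y) F * indicator E (c y)"
        by (simp add: K0_eq[OF y F])
    qed
    also have "\<dots> = (\<integral>\<^sup>+x. emeasure (K0 (S.head_coords x)) F * indicator E (c (S.head_coords x)) \<partial>\<mu>)"
    proof (rule nn_integral_distr[OF head])
      have "(\<lambda>y. emeasure (K0 y) F) \<in> borel_measurable L"
        using measurable_compose[OF measurable_prob_algebraD[OF K0] measurable_emeasure_subprob_algebra[OF F]] .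
      moreover have "(\<lambda>y. indicator E (c y) :: ennreal) \<in> borel_measurable L"
        using measurable_compose[OF c borel_measurable_indicator[OF E]] .
      ultimately show "(\<lambda>y. emeasure (K0 y) F * indicator E (c y)) \<in> borel_measurable (distr \<mu> L S.head_coords)"
        unfolding measurable_distr_eq1 by (rule borel_measurable_times_ennreal)
    qed
    also have "\<dots> = (\<integral>\<^sup>+x. emeasure (K (restrict x {..<k})) F * indicator E (restrict x {..<k}) \<partial>\<mu>)"
      by (rule nn_integral_cong_AE, rule AE_mp[OF AE_pos], rule AE_I2) (simp add: K_def inv space_mu)
    also have "\<dots> = (\<integral>\<^sup>+x\<in>E. emeasure (K x) F \<partial>m)"
      unfolding m
    proof (rule nn_integral_distr[OF restr, symmetric])
      have "(\<lambda>x. emeasure (K x) F) \<in> borel_measurable (icube_borel k)"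
        using measurable_compose[OF measurable_prob_algebraD[OF K] measurable_emeasure_subprob_algebra[OF F]] .
      then show "(\<lambda>x. emeasure (K x) F * indicator E x) \<in> borel_measurable (distr \<mu> (icube_borel k) (\<lambda>x. restrict x {..<k}))"
        unfolding measurable_distr_eq1 using borel_measurable_indicator[OF E] by (rule borel_measurable_times_ennreal)
    qed
    finally show ?thesis .
  qed
  have copm: "copula_measure d (arch_fun d \<psi>) = \<mu>" by (rule copula_measure_eq[OF df])
  have dk: "d - 1 = k" by (simp add: d)
  have kern: "cond_kernel d (arch_fun d \<psi>) K"
    unfolding cond_kernel_def dk copm m_def[symmetric] using K cond by blast
  have sing: "{t} \<in> sets unit_borel" if "t \<in> {0..1}" for t :: real
    using that by (auto simp: unit_borel_def sets_restrict_space image_iff intro!: bexI[of _ "{t}"])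
  \<comment> \<open>At 0 and 1 the map from S to the last coordinate can be constant on a half-line,
    so the single-point argument fails. For one fixed t the mass vanishes for almost every x because
    the last margin is uniform. The exceptional set depends on t, so this serves only the two
    endpoints.\<close>
  have endpoint: "AE x in m. emeasure (K x) {t} = 0" if t: "t \<in> {0..1}" for t
  proof -
    have "space (icube_borel k) \<in> sets (icube_borel k)" by (rule sets.top)
    then have icube: "icube k \<in> sets (icube_borel k)" by (simp only: space_icube_borel)
    have "AE x in \<mu>. x \<notin> {y \<in> icube d. restrict y {..<k} \<in> icube k \<and> y k \<in> {t}}"
      using AE_margin_neq[of k t] d by (auto elim: AE_mp)
    moreover have "{y \<in> icube d. restrict y {..<k} \<in> icube k \<and> y k \<in> {t}} = {y \<in> icube d. y k = t}"
      using d by (auto simp: icube_iff)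
    ultimately have "emeasure \<mu> {y \<in> icube d. restrict y {..<k} \<in> icube k \<and> y k \<in> {t}} = 0"
      using margin_sets(3)[of k t] d
      by (subst (asm) AE_iff_measurable[of "{y \<in> icube d. y k = t}"]) (auto simp: space_mu)
    then have "(\<integral>\<^sup>+x\<in>icube k. emeasure (K x) {t} \<partial>m) = 0" using cond[OF icube sing[OF t]] by simp
    moreover have "(\<lambda>x. emeasure (K x) {t}) \<in> borel_measurable m"
      using measurable_compose[OF measurable_prob_algebraD[OF K] measurable_emeasure_subprob_algebra[OF sing[OF t]]]
      by (simp add: m)
    moreover have "icube k \<in> sets m" using icube by (simp add: m)
    ultimately have ae: "AE x in m. emeasure (K x) {t} * indicator (icube k) x = 0"
      by (subst (asm) nn_integral_0_iff_AE) auto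
    have "space m = icube k" by (simp add: m space_icube_borel)
    then show ?thesis by - (rule AE_mp[OF ae], rule AE_I2, simp)
  qed
  have "AE x in m. \<forall>t\<in>{0..1}. emeasure (K x) {t} = 0"
    using endpoint[of 0, simplified] endpoint[of 1, simplified]
  proof (rule AE_mp[OF _ AE_mp], intro AE_I2 impI ballI)
    fix x t assume x: "x \<in> space m" "emeasure (K x) {0} = 0" "emeasure (K x) {1} = 0" and t: "t \<in> {0..1::real}"
    consider "t = 0" | "t = 1" | "0 < t" "t < 1" using t by fastforce
    then show "emeasure (K x) {t} = 0"
    proof cases
      case 3
      have Yx: "Y x \<in> space L" using measurable_space[OF Y] x by (simp add: m)
      let ?s = "real_inv \<psi> t + (\<Sum>i<k. Y x i)"
      have sub: "{s. r (Y x) s \<in> {t}} \<subseteq> {?s}"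
      proof
        fix s assume "s \<in> {s. r (Y x) s \<in> {t}}"
        then have e: "\<psi> (max 0 (s - (\<Sum>i<k. Y x i))) = t" by (simp add: r_def \<psi>c_def)
        then have "max 0 (s - (\<Sum>i<k. Y x i)) = real_inv \<psi> t"
          using real_inv_gen[OF gen, of "max 0 (s - (\<Sum>i<k. Y x i))"] 3 by simp
        moreover have "s - (\<Sum>i<k. Y x i) > 0"
        proof (rule ccontr)
          assume "\<not> ?thesis"
          then have "max 0 (s - (\<Sum>i<k. Y x i)) = 0" by simp
          then show False using e gen 3 by (simp add: generator_def)
        qed
        ultimately show "s \<in> {?s}" by simp
      qed
      have "emeasure (\<kappa> (Y x)) {?s} = 0"
        by (rule \<kappa>_null[OF Yx]) (simp_all add: sets_N N_atomless)
      moreover have "emeasure (\<kappa> (Y x)) {s. r (Y x) s \<in> {t}} \<le> emeasure (\<kappa> (Y x)) {?s}"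
        using sub by (rule emeasure_mono) (simp add: sets_\<kappa>[OF Yx] sets_N)
      ultimately show ?thesis unfolding K_def K0_eq[OF Yx sing[OF t]] by simp
    qed (use x in simp_all)
  qed
  then show ?thesis using kern that unfolding m_def by blast
qed


text \<open>For fixed F both functions are densities of the same measure, which sends E to the mass
  of E x F. The exceptional null set depends on F, so only countably many F can be treated at
  once.\<close>

lemma cond_kernel_AE_eq:
  assumes K: "cond_kernel d C K" and K': "cond_kernel d C K'" and F: "F \<in> sets unit_borel"
    and m: "has_df (d - 1) (copula_measure (d - 1) (marginal d C)) (marginal d C)"
  shows "AE x in copula_measure (d - 1) (marginal d C). emeasure (K x) F = emeasure (K' x) F"
proof -
  let ?m = "copula_measure (d - 1) (marginal d C)"
  interpret m: prob_space ?m using m by (simp add: has_df_def)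
  have sets_m: "sets ?m = sets (icube_borel (d - 1))" using m by (simp add: has_df_def)
  have meas: "(\<lambda>x. emeasure (K x) F) \<in> borel_measurable ?m" if "cond_kernel d C K" for K
  proof -
    have "K \<in> icube_borel (d - 1) \<rightarrow>\<^sub>M subprob_algebra unit_borel"
      using that by (intro measurable_prob_algebraD) (simp add: cond_kernel_def)
    from measurable_compose[OF this measurable_emeasure_subprob_algebra[OF F]]
    show ?thesis by (simp only: measurable_cong_sets[OF sets_m refl])
  qed
  show ?thesis
  proof (rule m.density_unique[OF meas[OF K] meas[OF K']], rule measure_eqI)
    fix E assume "E \<in> sets (density ?m (\<lambda>x. emeasure (K x) F))"
    then have E: "E \<in> sets ?m" by simp
    then have E': "E \<in> sets (icube_borel (d - 1))" by (simp only: sets_m)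
    have rect: "emeasure (copula_measure d C) {y \<in> icube d. restrict y {..<d - 1} \<in> E \<and> y (d - 1) \<in> F} =
        (\<integral>\<^sup>+x\<in>E. emeasure (K x) F \<partial>?m)" if "cond_kernel d C K" for K
      using that E' F unfolding cond_kernel_def by blast
    have "(\<integral>\<^sup>+x\<in>E. emeasure (K x) F \<partial>?m) = (\<integral>\<^sup>+x\<in>E. emeasure (K' x) F \<partial>?m)"
      by (rule trans[OF rect[OF K, symmetric] rect[OF K']])
    then show "emeasure (density ?m (\<lambda>x. emeasure (K x) F)) E = emeasure (density ?m (\<lambda>x. emeasure (K' x) F)) E"
      by (simp only: emeasure_density[OF meas[OF K] E] emeasure_density[OF meas[OF K'] E])
  qed simp
qed

lemma unit_borel_Int: "A \<in> sets borel \<Longrightarrow> {0..1} \<inter> A \<in> sets unit_borel"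
  unfolding unit_borel_def sets_restrict_space by (rule imageI)

text \<open>Two versions of the kernel agree almost everywhere on all cells of the grids of mesh
  \<open>1 / Suc n\<close>, and every point lies in arbitrarily small cells.\<close>

lemma cond_kernel_AE_atomless:
  assumes K: "cond_kernel d C K" and K': "cond_kernel d C K'"
    and m: "has_df (d - 1) (copula_measure (d - 1) (marginal d C)) (marginal d C)"
    and atomless: "AE x in copula_measure (d - 1) (marginal d C). \<forall>t\<in>{0..1}. emeasure (K' x) {t} = 0"
  shows "AE x in copula_measure (d - 1) (marginal d C). \<forall>t\<in>{0..1}. emeasure (K x) {t} = 0"
proof -
  let ?m = "copula_measure (d - 1) (marginal d C)"
  \<comment> \<open>Half-open on the left; the index j = 0 yields the cell consisting of 0 alone, so
    the cells cover the whole unit interval.\<close>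
  define cell where "cell n j = {0..1} \<inter> {t. real j - 1 < real (Suc n) * t \<and> real (Suc n) * t \<le> real j}" for n j :: nat
  have cell: "cell n j \<in> sets unit_borel" for n j
    unfolding cell_def by (rule unit_borel_Int) measurable
  have sp: "space ?m = space (icube_borel (d - 1))"
    using m by (intro sets_eq_imp_space_eq) (simp add: has_df_def)
  have prob: "prob_space (K x)" "sets (K x) = sets unit_borel" if "cond_kernel d C K" "x \<in> space ?m" for K x
  proof -
    have "K x \<in> space (prob_algebra unit_borel)"
      using that sp by (intro measurable_space[of K "icube_borel (d - 1)"]) (auto simp: cond_kernel_def)
    then show "prob_space (K x)" "sets (K x) = sets unit_borel" by (auto simp: space_prob_algebra)
  qed
  have "AE x in ?m. \<forall>n. \<forall>j. emeasure (K x) (cell n j) = emeasure (K' x) (cell n j)"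
    unfolding AE_all_countable by (intro allI cond_kernel_AE_eq[OF K K' cell m])
  then show ?thesis using atomless
  proof (rule AE_mp[OF _ AE_mp], intro AE_I2 impI ballI)
    fix x t assume x: "x \<in> space ?m" and at: "\<forall>t\<in>{0..1}. emeasure (K' x) {t} = 0"
      and eq: "\<forall>n j. emeasure (K x) (cell n j) = emeasure (K' x) (cell n j)" and t: "t \<in> {0..1::real}"
    interpret K': prob_space "K' x" by (rule prob(1)[OF K' x])
    \<comment> \<open>A closed interval around t containing the mesh cell of t. Its mass under K'
      decreases to that of the point t, whereas the cells of t for different n need not be
      nested.\<close>
    define I where "I n = {0..1} \<inter> {t - 1 / real (Suc n)..t + 1 / real (Suc n)}" for n
    have I: "I n \<in> sets unit_borel" for n unfolding I_def by (rule unit_borel_Int) simp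
    have "(\<lambda>n. emeasure (K' x) (I n)) \<longlonglongrightarrow> emeasure (K' x) (\<Inter>n. I n)"
    proof (rule Lim_emeasure_decseq)
      show "range I \<subseteq> sets (K' x)" using I prob(2)[OF K' x] by auto
      have "1 / real (Suc n) \<le> 1 / real (Suc m)" if "m \<le> n" for m n using that by (simp add: frac_le)
      then show "decseq I" unfolding decseq_def I_def by fastforce
    qed simp
    moreover have "(\<Inter>n. I n) = {t}"
    proof (intro subset_antisym subsetI)
      fix s assume s: "s \<in> (\<Inter>n. I n)"
      have "\<bar>s - t\<bar> \<le> 0 + e" if e: "0 < e" for e
      proof -
        obtain n where n: "inverse (real (Suc n)) < e" using reals_Archimedean[OF e] by blast
        have "s \<in> I n" using s by blast
        then have "\<bar>s - t\<bar> \<le> 1 / real (Suc n)" by (auto simp: I_def abs_le_iff)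
        then show ?thesis using n by (simp add: inverse_eq_divide)
      qed
      then have "\<bar>s - t\<bar> \<le> 0" by (rule field_le_epsilon)
      then show "s \<in> {t}" by simp
    qed (use t in \<open>auto simp: I_def\<close>)
    ultimately have lim: "(\<lambda>n. emeasure (K' x) (I n)) \<longlonglongrightarrow> 0" using at t by simp
    have "emeasure (K x) {t} \<le> emeasure (K' x) (I n)" for n
    proof -
      define j where "j = nat \<lceil>real (Suc n) * t\<rceil>"
      have "0 \<le> real (Suc n) * t" using t by simp
      then have j: "real j - 1 < real (Suc n) * t" "real (Suc n) * t \<le> real j"
        unfolding j_def by linarith+
      have "emeasure (K x) {t} \<le> emeasure (K x) (cell n j)"
        using j t cell prob(2)[OF K x] by (intro emeasure_mono) (auto simp: cell_def)
      also have "\<dots> = emeasure (K' x) (cell n j)" using eq by blast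
      also have "\<dots> \<le> emeasure (K' x) (I n)"
      proof (rule emeasure_mono)
        show "cell n j \<subseteq> I n"
        proof
          fix s assume s: "s \<in> cell n j"
          then have "\<bar>real (Suc n) * s - real (Suc n) * t\<bar> \<le> 1" using j unfolding cell_def by (simp del: of_nat_Suc) linarith
          then have "real (Suc n) * \<bar>s - t\<bar> \<le> 1" by (simp add: abs_mult right_diff_distrib[symmetric] del: of_nat_Suc)
          then have "\<bar>s - t\<bar> \<le> 1 / real (Suc n)" by (simp add: field_simps)
          then show "s \<in> I n" using s by (auto simp: I_def cell_def abs_le_iff)
        qed
        show "I n \<in> sets (K' x)" using I prob(2)[OF K' x] by simp
      qed
      finally show ?thesis .
    qed
    then have "emeasure (K x) {t} \<le> 0" by (intro LIMSEQ_le_const[OF lim]) blast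
    then show "emeasure (K x) {t} = 0" by simp
  qed
qed

text \<open>\<open>copula_kernel\<close> is an arbitrary choice among the versions, so the atomless
  version constructed above serves only through the almost everywhere comparison of
  versions.\<close>

lemma (in arch_law) discrete_component_zero:
  assumes d: "d = Suc k" and lev: "\<And>t. measure \<mu> {x \<in> icube d. arch_fun d \<psi> x = t} = 0"
  shows "discrete_component d (arch_fun d \<psi>) E F = 0"
proof -
  let ?m = "copula_measure (d - 1) (marginal d (arch_fun d \<psi>))"
  have dk: "d - 1 = k" by (simp add: d)
  obtain K where K: "cond_kernel d (arch_fun d \<psi>) K"
    and at: "AE x in ?m. \<forall>t\<in>{0..1}. emeasure (K x) {t} = 0"
    by (rule cond_kernel_exists[OF d lev, folded dk])
  have C: "cond_kernel d (arch_fun d \<psi>) (copula_kernel d (arch_fun d \<psi>))"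
    unfolding copula_kernel_def by (rule someI[of "cond_kernel d (arch_fun d \<psi>)", OF K])
  have m: "has_df (d - 1) ?m (marginal d (arch_fun d \<psi>))"
    using marginal_has_df[OF d] unfolding dk copula_measure_eq[OF marginal_has_df[OF d]] .
  have sp: "space ?m = space (icube_borel (d - 1))"
    using m by (intro sets_eq_imp_space_eq) (simp add: has_df_def)
  have "AE x in ?m. emeasure (discrete_part (copula_kernel d (arch_fun d \<psi>) x)) F * indicator E x = 0"
  proof (rule AE_mp[OF cond_kernel_AE_atomless[OF C K m at]], intro AE_I2 impI)
    fix x assume x: "x \<in> space ?m" and a: "\<forall>t\<in>{0..1}. emeasure (copula_kernel d (arch_fun d \<psi>) x) {t} = 0"
    let ?\<nu> = "copula_kernel d (arch_fun d \<psi>) x"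
    have "?\<nu> \<in> space (prob_algebra unit_borel)"
      using C x sp by (intro measurable_space[of "copula_kernel d (arch_fun d \<psi>)" "icube_borel (d - 1)"])
        (auto simp: cond_kernel_def)
    then have "sets ?\<nu> = sets unit_borel" by (auto simp: space_prob_algebra)
    then have "space ?\<nu> = {0..1}"
      by (auto dest: sets_eq_imp_space_eq simp: unit_borel_def space_restrict_space)
    then have "{t \<in> space ?\<nu>. emeasure ?\<nu> {t} \<noteq> 0} = {}" using a by auto
    then have dp: "discrete_part ?\<nu> = density ?\<nu> (indicator {})" by (simp only: discrete_part_def)
    have "emeasure (discrete_part ?\<nu>) F = 0"
    \<comment> \<open>A set that is not measurable has measure 0 by convention, which lets F be
      arbitrary.\<close>
    proof (cases "F \<in> sets ?\<nu>")
      case True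
      then show ?thesis unfolding dp by (subst emeasure_restricted) auto
    next
      case False
      then show ?thesis unfolding dp by (intro emeasure_notin_sets) simp
    qed
    then show "emeasure (discrete_part ?\<nu>) F * indicator E x = 0" by simp
  qed
  then have "discrete_component d (arch_fun d \<psi>) E F = (\<integral>\<^sup>+x. 0 \<partial>?m)"
    unfolding discrete_component_def by (rule nn_integral_cong_AE)
  then show ?thesis by simp
qed

section \<open>Baire category\<close>

lemma (in copula_law) copula_measure: "copula_measure d C = \<mu>"
  by (rule copula_measure_eq[OF df])

lemma archimedean_arch_law:
  assumes "C \<in> archimedean_copulas d"
  obtains \<psi> where "C = arch_fun d \<psi>" "arch_law d \<psi> (copula_measure d C)"
proof -
  obtain \<psi> where \<psi>: "generator \<psi>" "C = arch_fun d \<psi>" by (rule archimedean_arch_fun[OF assms])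
  have cop: "copula d C" using assms by (simp add: archimedean_copulas_def)
  have "arch_law d \<psi> (copula_measure d C)"
    using cop has_df_copula_measure[OF cop] \<psi> by unfold_locales simp_all
  then show ?thesis using that \<psi> by blast
qed

lemma archimedean_copula_law: "C \<in> archimedean_copulas d \<Longrightarrow> copula_law d C (copula_measure d C)"
  by (simp add: copula_law_def has_df_copula_measure archimedean_copulas_def)

lemma (in arch_law) arch_fun_archimedean: "arch_fun d \<psi> \<in> archimedean_copulas d"
  using df arch_fun_copula_iff[OF gen] by blast

text \<open>Null level sets mean that the distribution function of C(X) is continuous, hence
  uniformly continuous on a compact interval; short bands around a level then have small mass
  uniformly in the level.\<close>

lemma (in arch_law) level_uniformly_small:
  assumes null: "\<And>t. measure \<mu> {x \<in> icube d. arch_fun d \<psi> x = t} = 0" and \<theta>: "0 < \<theta>"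
  obtains \<epsilon> where "0 < \<epsilon>" "\<And>t. t \<in> {0..1} \<Longrightarrow> measure \<mu> {x \<in> icube d. \<bar>arch_fun d \<psi> x - t\<bar> \<le> 2 * \<epsilon>} \<le> \<theta>"
proof -
  let ?V = "arch_fun d \<psi>"
  have V: "?V \<in> borel_measurable \<mu>"
    using arch_fun_measurable[OF gen] by (simp add: measurable_cong_sets[OF sets_mu refl])
  define N where "N = distr \<mu> borel ?V"
  interpret N: real_distribution N unfolding N_def by (rule real_distribution_distr[OF V])
  have N_eq: "measure N A = measure \<mu> {x \<in> icube d. ?V x \<in> A}" if "A \<in> sets borel" for A
    unfolding N_def measure_distr[OF V that] by (rule arg_cong[of _ _ "measure \<mu>"]) (auto simp: space_mu)
  have "isCont (cdf N) t" for t
    using null[of t] N_eq[of "{t}"] by (simp add: N.isCont_cdf)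
  then have "uniformly_continuous_on {-1..2} (cdf N)"
    by (intro compact_uniformly_continuous continuous_at_imp_continuous_on) auto
  then obtain \<rho> where \<rho>: "0 < \<rho>"
    "\<And>s t. s \<in> {-1..2} \<Longrightarrow> t \<in> {-1..2} \<Longrightarrow> dist t s < \<rho> \<Longrightarrow> dist (cdf N t) (cdf N s) < \<theta>"
    unfolding uniformly_continuous_on_def using \<theta> by meson
  \<comment> \<open>The bound 1/4 keeps both endpoints within [-1, 2], and \<open>\<rho>\<close>/8
    makes their distance 5 \<open>\<epsilon>\<close> smaller than \<open>\<rho>\<close>. The left
    endpoint is moved from 2 \<open>\<epsilon>\<close> to 3 \<open>\<epsilon>\<close> so that the
    half-open interval contains the closed one.\<close>
  define \<epsilon> where "\<epsilon> = min (1 / 4) (\<rho> / 8)"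
  have \<epsilon>: "0 < \<epsilon>" "\<epsilon> \<le> 1 / 4" "\<epsilon> \<le> \<rho> / 8" using \<rho> by (auto simp: \<epsilon>_def)
  have "measure \<mu> {x \<in> icube d. \<bar>?V x - t\<bar> \<le> 2 * \<epsilon>} \<le> \<theta>" if t: "t \<in> {0..1}" for t
  proof -
    have "measure \<mu> {x \<in> icube d. \<bar>?V x - t\<bar> \<le> 2 * \<epsilon>} = measure N {t - 2 * \<epsilon>..t + 2 * \<epsilon>}"
      by (subst N_eq) (auto intro!: arg_cong[of _ _ "measure \<mu>"])
    also have "\<dots> \<le> measure N {t - 3 * \<epsilon><..t + 2 * \<epsilon>}"
      using \<epsilon> by (intro N.finite_measure_mono) auto
    also have "\<dots> = cdf N (t + 2 * \<epsilon>) - cdf N (t - 3 * \<epsilon>)"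
      using \<epsilon> by (intro N.cdf_diff_eq[symmetric]) simp
    also have "\<dots> \<le> dist (cdf N (t + 2 * \<epsilon>)) (cdf N (t - 3 * \<epsilon>))" by (simp add: dist_real_def)
    also have "\<dots> < \<theta>" using \<epsilon> t \<rho>(1) by (intro \<rho>(2)) (auto simp: dist_real_def)
    finally show ?thesis by simp
  qed
  then show ?thesis using that \<epsilon> by blast
qed

text \<open>The band width \<open>\<epsilon>\<close> is chosen first, then a mesh across which the
  copula varies by at most \<open>\<epsilon>\<close>, and only then the distance
  \<open>\<eta>\<close>, small against the number of cells. A point in a cell meeting {D = t} has
  copula value within \<open>\<epsilon>\<close> + \<open>\<eta>\<close> of t, hence in the band of
  half-width 2 \<open>\<epsilon>\<close>.\<close>

lemma (in arch_law) level_stable: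
  assumes null: "\<And>t. measure \<mu> {x \<in> icube d. arch_fun d \<psi> x = t} = 0" and \<theta>: "0 < \<theta>"
  obtains \<eta> where "0 < \<eta>" "\<And>D \<nu> t. copula_law d D \<nu> \<Longrightarrow> (\<And>x. x \<in> icube d \<Longrightarrow> \<bar>D x - arch_fun d \<psi> x\<bar> \<le> \<eta>) \<Longrightarrow>
    measure \<nu> {x \<in> icube d. D x = t} < \<theta>"
proof -
  let ?V = "arch_fun d \<psi>"
  have "0 < \<theta> / 2" using \<theta> by simp
  then obtain \<epsilon> where \<epsilon>: "0 < \<epsilon>"
    "\<And>t. t \<in> {0..1} \<Longrightarrow> measure \<mu> {x \<in> icube d. \<bar>?V x - t\<bar> \<le> 2 * \<epsilon>} \<le> \<theta> / 2"
    using level_uniformly_small[OF null] by blast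
  obtain m :: nat where m: "real d / \<epsilon> < real m" using reals_Archimedean2 by blast
  then have m0: "0 < m" using \<epsilon> by (metis divide_nonneg_pos of_nat_0_le_iff of_nat_0_less_iff order.strict_trans1)
  have dm: "real d * (1 / real m) \<le> \<epsilon>" using m \<epsilon> m0 by (simp add: field_simps)
  define c where "c = (2 * (real m + 1)) ^ d"
  have c: "0 < c" by (simp add: c_def)
  define \<eta> where "\<eta> = min \<epsilon> (\<theta> / (4 * c))"
  have \<eta>: "0 < \<eta>" "\<eta> \<le> \<epsilon>" "\<eta> \<le> \<theta> / (4 * c)" using \<epsilon> \<theta> c by (auto simp: \<eta>_def)
  have "c * \<eta> \<le> c * (\<theta> / (4 * c))" using \<eta> c by (intro mult_left_mono) auto
  also have "\<dots> = \<theta> / 4" using c by simp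
  finally have c\<eta>: "c * \<eta> \<le> \<theta> / 4" .
  have "measure \<nu> {x \<in> icube d. D x = t} < \<theta>"
    if D: "copula_law d D \<nu>" and close: "\<And>x. x \<in> icube d \<Longrightarrow> \<bar>D x - ?V x\<bar> \<le> \<eta>" for D \<nu> t
  \<comment> \<open>The uniform bound covers levels in the unit interval; a nonempty level set
    forces t to lie there.\<close>
  proof (cases "{x \<in> icube d. D x = t} = {}")
    case True
    then show ?thesis using \<theta> by (simp only: measure_empty)
  next
    case False
    interpret \<nu>: copula_law d D \<nu> by fact
    have t: "t \<in> {0..1}" using False \<nu>.C_range by auto
    let ?B = "{x \<in> icube d. \<bar>?V x - t\<bar> \<le> 2 * \<epsilon>}"
    have B: "?B \<in> sets \<mu>"
      unfolding sets_mu space_icube_borel[symmetric]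
      by (intro borel_measurable_le borel_measurable_abs borel_measurable_diff arch_fun_measurable[OF gen]) simp_all
    have "measure \<nu> {x \<in> icube d. D x = t} \<le> measure \<mu> ?B + (2 * (real m + 1)) ^ d * \<eta>"
    proof (rule measure_grid_le[OF D copula_law_axioms close _ B m0])
      fix x y assume x: "x \<in> {x \<in> icube d. D x = t}" and y: "y \<in> icube d"
        and xy: "\<And>i. i < d \<Longrightarrow> \<bar>x i - y i\<bar> \<le> 1 / real m"
      have "\<bar>?V x - ?V y\<bar> \<le> (\<Sum>i<d. \<bar>x i - y i\<bar>)" using x y by (intro C_lipschitz) auto
      also have "\<dots> \<le> (\<Sum>i<d. 1 / real m)" using xy by (intro sum_mono) auto
      also have "\<dots> \<le> \<epsilon>" using dm by simp
      finally have "\<bar>?V x - ?V y\<bar> \<le> \<epsilon>" .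
      moreover have "\<bar>t - ?V x\<bar> \<le> \<eta>" using close[of x] x by simp
      ultimately have "\<bar>?V y - t\<bar> \<le> 2 * \<epsilon>" using \<eta>(2) by linarith
      then show "y \<in> ?B" using y by simp
    qed auto
    also have "\<dots> \<le> \<theta> / 2 + \<theta> / 4"
      using \<epsilon>(2)[OF t] c\<eta> by (simp add: c_def add.commute)
    finally show ?thesis using \<theta> by linarith
  qed
  then show ?thesis using that \<eta>(1) by blast
qed

section \<open>Density and nowhere density in the uniform metric\<close>

lemma archimedean_bdd_above:
  assumes "A \<in> archimedean_copulas d" "B \<in> archimedean_copulas d"
  shows "bdd_above ((\<lambda>x. \<bar>A x - B x\<bar>) ` icube d)"
proof (rule bdd_aboveI2)
  fix x assume x: "x \<in> icube d"
  have "0 \<le> C x \<and> C x \<le> 1" if "C \<in> archimedean_copulas d" for C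
    by (rule copula_law.C_range[OF archimedean_copula_law[OF that] x])
  from this[OF assms(1)] this[OF assms(2)] show "\<bar>A x - B x\<bar> \<le> 1" by linarith
qed

lemma mdist_archimedean_le:
  assumes "A \<in> archimedean_copulas d" "B \<in> archimedean_copulas d"
    and "\<And>x. x \<in> icube d \<Longrightarrow> \<bar>A x - B x\<bar> \<le> e"
  shows "mdist (archimedean_metric d) A B \<le> e"
proof -
  have "icube d \<noteq> {}" by (auto simp: icube_def PiE_eq_empty_iff)
  then show ?thesis unfolding mdist_archimedean[OF assms(1,2)] using assms(3) by (rule cSUP_least)
qed

lemma le_mdist_archimedean:
  assumes "A \<in> archimedean_copulas d" "B \<in> archimedean_copulas d" "x \<in> icube d"
  shows "\<bar>A x - B x\<bar> \<le> mdist (archimedean_metric d) A B"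
  unfolding mdist_archimedean[OF assms(1,2)]
  by (rule cSUP_upper[OF assms(3) archimedean_bdd_above[OF assms(1,2)]])

text \<open>Replacing \<open>(Z\<^sub>1, \<dots>, Z\<^sub>d)\<close> by \<open>(Z\<^sub>1, \<dots>, Z\<^sub>d) / W\<close> with an independent \<open>W\<close> that is close to 1 and
  has no atoms.\<close>

lemma level_null_dense:
  assumes C: "C \<in> archimedean_copulas d" and d: "0 < d" and r: "0 < r"
  obtains \<phi> \<nu> where "arch_law d \<phi> \<nu>" "mdist (archimedean_metric d) C (arch_fun d \<phi>) < r"
    "\<And>t. measure \<nu> {x \<in> icube d. arch_fun d \<phi> x = t} = 0"
proof -
  obtain \<psi> where \<psi>: "C = arch_fun d \<psi>" "arch_law d \<psi> (copula_measure d C)"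
    by (rule archimedean_arch_law[OF C])
  interpret arch_law d \<psi> "copula_measure d C" by (rule \<psi>(2))
  \<comment> \<open>Compensates the factor d+1 of \<open>arch_fun_close\<close> and leaves a
    distance of at most r/2, strictly below r.\<close>
  define e where "e = r / (2 * (real d + 1))"
  have e: "0 < e" using r by (simp add: e_def)
  obtain n where n: "0 < n" "\<And>z. 0 \<le> z \<Longrightarrow> \<bar>mixture n \<psi> z - \<psi> z\<bar> \<le> e"
    using mixture_close[OF gen e] by blast
  let ?\<phi> = "mixture n \<psi>"
  interpret \<nu>: arch_law d ?\<phi> "scaled_law n" by (rule scaled_law_arch_law[OF n(1)])
  have "\<bar>C x - arch_fun d ?\<phi> x\<bar> \<le> (real d + 1) * e" if "x \<in> icube d" for x
    using arch_fun_close[OF \<nu>.gen n(2) that] by (simp add: \<psi>(1)[symmetric] abs_minus_commute)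
  then have "mdist (archimedean_metric d) C (arch_fun d ?\<phi>) \<le> (real d + 1) * e"
    by (intro mdist_archimedean_le C \<nu>.arch_fun_archimedean)
  also have "\<dots> = r / 2" by (simp add: e_def field_simps)
  also have "\<dots> < r" using r by simp
  finally show ?thesis
    using that[OF \<nu>.arch_law_axioms] scaled_law_level_null[OF n(1) d] by blast
qed

definition level_atom :: "nat \<Rightarrow> nat \<Rightarrow> ((nat \<Rightarrow> real) \<Rightarrow> real) set" where
  "level_atom d n = {C \<in> archimedean_copulas d.
     \<exists>t. 1 / real (Suc n) \<le> measure (copula_measure d C) {x \<in> icube d. C x = t}}"

text \<open>A ball inside the closure would contain a copula without level atoms. By
  \<open>level_stable\<close> that copula has a whole neighbourhood disjoint from
  \<open>level_atom\<close>, so it cannot lie in the closure.\<close>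

lemma level_atom_nowhere_dense:
  assumes d: "0 < d"
  shows "nowhere_dense_in (mtopology_of (archimedean_metric d)) (level_atom d n)"
proof -
  let ?m = "archimedean_metric d" and ?A = "archimedean_copulas d"
  interpret Metric_space ?A "mdist ?m"
    using Metric_space_mspace_mdist[of ?m] by (simp add: mspace_archimedean)
  have top: "mtopology_of ?m = mtopology"
    by (simp add: mtopology_of_def mspace_archimedean)
  have "C \<notin> mtopology interior_of (mtopology closure_of level_atom d n)" for C
  proof
    assume "C \<in> mtopology interior_of (mtopology closure_of level_atom d n)"
    then obtain r where C: "C \<in> ?A" and r: "0 < r" "mball C r \<subseteq> mtopology closure_of level_atom d n"
      unfolding metric_interior_of by blast
    obtain \<phi> \<nu> where \<nu>: "arch_law d \<phi> \<nu>" and dist: "mdist ?m C (arch_fun d \<phi>) < r"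
      and null: "\<And>t. measure \<nu> {x \<in> icube d. arch_fun d \<phi> x = t} = 0"
      using level_null_dense[OF C d r(1)] by metis
    interpret \<nu>: arch_law d \<phi> \<nu> by (rule \<nu>)
    let ?C = "arch_fun d \<phi>"
    obtain \<eta> where \<eta>: "0 < \<eta>" and small: "\<And>D \<sigma> t. copula_law d D \<sigma> \<Longrightarrow>
        (\<And>x. x \<in> icube d \<Longrightarrow> \<bar>D x - ?C x\<bar> \<le> \<eta>) \<Longrightarrow> measure \<sigma> {x \<in> icube d. D x = t} < 1 / real (Suc n)"
      using \<nu>.level_stable[OF null, of "1 / real (Suc n)"] by auto
    have "?C \<in> mball C r" using C dist \<nu>.arch_fun_archimedean by simp
    then have "?C \<in> mtopology closure_of level_atom d n" using r(2) by blast
    then obtain D where D: "D \<in> level_atom d n" "D \<in> mball ?C \<eta>"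
      using \<eta> unfolding metric_closure_of by blast
    then have DA: "D \<in> ?A" by (simp add: level_atom_def)
    have "\<bar>D x - ?C x\<bar> \<le> \<eta>" if "x \<in> icube d" for x
      using le_mdist_archimedean[OF \<nu>.arch_fun_archimedean DA that] D(2) by (simp add: abs_minus_commute)
    then have "measure (copula_measure d D) {x \<in> icube d. D x = t} < 1 / real (Suc n)" for t
      by (intro small archimedean_copula_law DA)
    then show False using D(1) unfolding level_atom_def by (simp add: not_le[symmetric])
  qed
  then show ?thesis
    unfolding nowhere_dense_in_def top by (auto simp: level_atom_def)
qed

theorem theorem6p11:
  fixes d :: nat
  assumes "d \<ge> 2"
  shows "comeager_in (mtopology_of (archimedean_metric d))
           {C \<in> archimedean_copulas d. discrete_component d C (icube (d - 1)) {0..1} = 0}"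
proof -
  let ?X = "mtopology_of (archimedean_metric d)"
  let ?G = "{C \<in> archimedean_copulas d. discrete_component d C (icube (d - 1)) {0..1} = 0}"
  obtain k where k: "d = Suc k" using assms by (cases d) auto
  have "topspace ?X - ?G \<subseteq> \<Union> (range (level_atom d))"
  proof
    fix C assume "C \<in> topspace ?X - ?G"
    then have C: "C \<in> archimedean_copulas d" "discrete_component d C (icube (d - 1)) {0..1} \<noteq> 0"
      by (auto simp: topspace_archimedean simp del: topspace_mtopology_of)
    obtain \<psi> where \<psi>: "C = arch_fun d \<psi>" "arch_law d \<psi> (copula_measure d C)"
      by (rule archimedean_arch_law[OF C(1)])
    have "\<exists>t. measure (copula_measure d C) {x \<in> icube d. C x = t} \<noteq> 0"
      using arch_law.discrete_component_zero[OF \<psi>(2) k] C(2) unfolding \<psi>(1)[symmetric] by blast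
    then obtain t where "0 < measure (copula_measure d C) {x \<in> icube d. C x = t}"
      by (auto simp: zero_less_measure_iff)
    then obtain n where "inverse (real (Suc n)) < measure (copula_measure d C) {x \<in> icube d. C x = t}"
      using reals_Archimedean by blast
    then have "C \<in> level_atom d n"
      using C(1) by (auto simp: level_atom_def inverse_eq_divide intro!: exI[of _ t])
    then show "C \<in> \<Union> (range (level_atom d))" by blast
  qed
  moreover have "nowhere_dense_in ?X (level_atom d n)" for n
    using assms by (intro level_atom_nowhere_dense) simp
  ultimately have "meager_in ?X (topspace ?X - ?G)"
    unfolding meager_in_def by (intro conjI exI[of _ "range (level_atom d)"]) auto
  then show ?thesis
    unfolding comeager_in_def by (auto simp: topspace_archimedean simp del: topspace_mtopology_of)
qed

end
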